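(* There is a computable function $f$ and an algorithm which, given a finite point set $P$ in the plane together with a clique-width expression of width $d$ whose value is the order type $\Omega(P)$, and an integer $k$, decides the General Position Subset problem (whether there is $Q\subseteq P$ with $|Q|\ge k$ and no three points of $Q$ collinear) in time $f(d)\cdot N$, where $N$ is the size of the input (linear FPT time with parameter $d$).
   Context: For a finite point set $P$ in the plane, its order type is the ternary relation $\Omega(P)\subseteq P^3$ with $(a,b,c)\in\Omega(P)$ iff $a,b,c$ are distinct and the triangle $abc$ is oriented counter-clockwise. The cyclic closure of $(a,b,c)$ is $\{(a,b,c),(b,c,a),(c,a,b)\}$. A clique-width expression uses unary labels (on points) and binary labels (on ordered pairs of points) and the operations (w1) create a new point with a single unary label $i$; (w2) disjoint union of two labelled structures; (w3) for all points $a$ of unary label $i$ and $b$ of unary label $j$ ($i\neq j$), give the ordered pair $(a,b)$ binary label $k$; (w4) for all pairwise distinct $a,b,c$ with $c$ of unary label $i$ and $(a,b)$ of binary label $k$, add the cyclic closure of $(a,b,c)$ to the ternary relation; (w4') under the same conditions add the cyclic closure of $(b,a,c)$; (w5) relabel all tuples (points or pairs) of label $i$ to label $j$ of the same arity. Its value is the ternary structure on the created points consisting of the triples added by (w4),(w4'); its width is the sum of the arities of the labels occurring in it. *)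

theory Defs
  imports "HOL-Analysis.Analysis"
begin

section \<open>Order types and general position\<close>

type_synonym point = "real ^ 2"

definition ccw :: "point \<Rightarrow> point \<Rightarrow> point \<Rightarrow> bool" where
  "ccw a b c \<longleftrightarrow> (b $ 1 - a $ 1) * (c $ 2 - a $ 2) - (b $ 2 - a $ 2) * (c $ 1 - a $ 1) > 0"

definition order_type :: "point set \<Rightarrow> (point \<times> point \<times> point) set" where
  "order_type P = {(a, b, c). a \<in> P \<and> b \<in> P \<and> c \<in> P \<and>
     a \<noteq> b \<and> b \<noteq> c \<and> a \<noteq> c \<and> ccw a b c}"

definition general_position :: "point set \<Rightarrow> bool" where
  "general_position Q \<longleftrightarrow>
     (\<forall>a\<in>Q. \<forall>b\<in>Q. \<forall>c\<in>Q. a \<noteq> b \<and> b \<noteq> c \<and> a \<noteq> c \<longrightarrow> \<not> collinear {a, b, c})"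

definition general_position_subset :: "point set \<Rightarrow> int \<Rightarrow> bool" where
  "general_position_subset P k \<longleftrightarrow> (\<exists>Q \<subseteq> P. int (card Q) \<ge> k \<and> general_position Q)"


section \<open>Clique-width expressions\<close>

text \<open>Unary and binary labels are both named by natural numbers, but they form two separate
  name spaces: unary label 0 and binary label 0 are different labels.\<close>

datatype 'p cw_expr =
    Create 'p nat
  | Disjoint_Union "'p cw_expr" "'p cw_expr"
  | Label_Pairs nat nat nat "'p cw_expr"
  | Add_Triples nat nat "'p cw_expr"
  | Add_Triples_Rev nat nat "'p cw_expr"
  | Relabel_Points nat nat "'p cw_expr"
  | Relabel_Pairs nat nat "'p cw_expr"

text \<open>Labels are relations, so a pair may carry several binary labels and giving it a new one
  does not remove the others. A point always carries exactly one unary label.\<close>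

record 'p lstruct =
  points :: "'p set"
  ulab :: "('p \<times> nat) set"
  blab :: "(('p \<times> 'p) \<times> nat) set"
  triples :: "('p \<times> 'p \<times> 'p) set"

definition cyc :: "'p \<Rightarrow> 'p \<Rightarrow> 'p \<Rightarrow> ('p \<times> 'p \<times> 'p) set" where
  "cyc a b c = {(a, b, c), (b, c, a), (c, a, b)}"

definition relabel :: "nat \<Rightarrow> nat \<Rightarrow> ('t \<times> nat) set \<Rightarrow> ('t \<times> nat) set" where
  "relabel i j L = (\<lambda>(t, l). (t, if l = i then j else l)) ` L"

text \<open>The triples \<open>(a, b, c)\<close> to which an operation with unary label \<open>i\<close> and binary
  label \<open>k\<close> applies.\<close>

definition selected :: "nat \<Rightarrow> nat \<Rightarrow> 'p lstruct \<Rightarrow> ('p \<times> 'p \<times> 'p) set" where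
  "selected i k S = {(a, b, c). a \<noteq> b \<and> b \<noteq> c \<and> a \<noteq> c \<and> (c, i) \<in> ulab S \<and> ((a, b), k) \<in> blab S}"

primrec cw_eval :: "'p cw_expr \<Rightarrow> 'p lstruct" where
  "cw_eval (Create p i) = \<lparr>points = {p}, ulab = {(p, i)}, blab = {}, triples = {}\<rparr>"
| "cw_eval (Disjoint_Union e1 e2) =
     (let S = cw_eval e1; T = cw_eval e2 in
      \<lparr>points = points S \<union> points T, ulab = ulab S \<union> ulab T,
       blab = blab S \<union> blab T, triples = triples S \<union> triples T\<rparr>)"
| "cw_eval (Label_Pairs i j k e) =
     (let S = cw_eval e in
      S\<lparr>blab := blab S \<union> {((a, b), k) | a b. (a, i) \<in> ulab S \<and> (b, j) \<in> ulab S}\<rparr>)"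
| "cw_eval (Add_Triples i k e) =
     (let S = cw_eval e in
      S\<lparr>triples := triples S \<union> (\<Union>(a, b, c)\<in>selected i k S. cyc a b c)\<rparr>)"
| "cw_eval (Add_Triples_Rev i k e) =
     (let S = cw_eval e in
      S\<lparr>triples := triples S \<union> (\<Union>(a, b, c)\<in>selected i k S. cyc b a c)\<rparr>)"
| "cw_eval (Relabel_Points i j e) =
     (let S = cw_eval e in S\<lparr>ulab := relabel i j (ulab S)\<rparr>)"
| "cw_eval (Relabel_Pairs i j e) =
     (let S = cw_eval e in S\<lparr>blab := relabel i j (blab S)\<rparr>)"

text \<open>Side conditions of the operations: unions are disjoint (so every point is created only
  once), and pairs are labelled between two different unary labels.\<close>

primrec cw_wf :: "'p cw_expr \<Rightarrow> bool" where
  "cw_wf (Create p i) \<longleftrightarrow> True"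
| "cw_wf (Disjoint_Union e1 e2) \<longleftrightarrow>
     cw_wf e1 \<and> cw_wf e2 \<and> points (cw_eval e1) \<inter> points (cw_eval e2) = {}"
| "cw_wf (Label_Pairs i j k e) \<longleftrightarrow> i \<noteq> j \<and> cw_wf e"
| "cw_wf (Add_Triples i k e) \<longleftrightarrow> cw_wf e"
| "cw_wf (Add_Triples_Rev i k e) \<longleftrightarrow> cw_wf e"
| "cw_wf (Relabel_Points i j e) \<longleftrightarrow> cw_wf e"
| "cw_wf (Relabel_Pairs i j e) \<longleftrightarrow> cw_wf e"

definition cw_value :: "'p cw_expr \<Rightarrow> 'p set \<times> ('p \<times> 'p \<times> 'p) set" where
  "cw_value e = (points (cw_eval e), triples (cw_eval e))"

primrec unary_labels :: "'p cw_expr \<Rightarrow> nat set" where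
  "unary_labels (Create p i) = {i}"
| "unary_labels (Disjoint_Union e1 e2) = unary_labels e1 \<union> unary_labels e2"
| "unary_labels (Label_Pairs i j k e) = {i, j} \<union> unary_labels e"
| "unary_labels (Add_Triples i k e) = {i} \<union> unary_labels e"
| "unary_labels (Add_Triples_Rev i k e) = {i} \<union> unary_labels e"
| "unary_labels (Relabel_Points i j e) = {i, j} \<union> unary_labels e"
| "unary_labels (Relabel_Pairs i j e) = unary_labels e"

primrec binary_labels :: "'p cw_expr \<Rightarrow> nat set" where
  "binary_labels (Create p i) = {}"
| "binary_labels (Disjoint_Union e1 e2) = binary_labels e1 \<union> binary_labels e2"
| "binary_labels (Label_Pairs i j k e) = {k} \<union> binary_labels e"
| "binary_labels (Add_Triples i k e) = {k} \<union> binary_labels e"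
| "binary_labels (Add_Triples_Rev i k e) = {k} \<union> binary_labels e"
| "binary_labels (Relabel_Points i j e) = binary_labels e"
| "binary_labels (Relabel_Pairs i j e) = {i, j} \<union> binary_labels e"

definition cw_width :: "'p cw_expr \<Rightarrow> nat" where
  "cw_width e = card (unary_labels e) + 2 * card (binary_labels e)"


section \<open>Random access machine\<close>

text \<open>
  The model of computation is the uniform-cost random access machine with addition and
  subtraction (no multiplication), with programs in structured form. The memory consists of
  arrays of natural numbers; a program mentions only finitely many of them, so they could be
  interleaved into a single one. A scalar variable is cell 0 of an array.

  A geometric input, a list of points with real coordinates, is read-only and can only be
  examined by comparing the values of polynomial expressions in its coordinates. Reals can not
  be stored, so the degrees of these polynomials are bounded by the program; this is weaker than
  the real RAM.

  Assignments and tests cost one step each. The expressions in them are part of the program,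
  so charging for their size would change the time by a constant factor only.
\<close>

type_synonym store = "nat \<Rightarrow> nat \<Rightarrow> nat"

datatype aexp = Const nat | Cell nat aexp | Plus aexp aexp | Minus aexp aexp

datatype rexp = RConst int | XCoord aexp | YCoord aexp
  | RPlus rexp rexp | RMinus rexp rexp | RTimes rexp rexp

datatype bexp = Less aexp aexp | Equal aexp aexp | RLess rexp rexp
  | BNot bexp | BAnd bexp bexp

datatype com = Skip
  | Assign nat aexp aexp
  | Seq com com
  | Cond bexp com com
  | While bexp com

primrec aval :: "store \<Rightarrow> aexp \<Rightarrow> nat" where
  "aval s (Const n) = n"
| "aval s (Cell A a) = s A (aval s a)"
| "aval s (Plus a b) = aval s a + aval s b"
| "aval s (Minus a b) = aval s a - aval s b"

text \<open>Coordinates of points outside of the input list read as 0.\<close>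

definition input_point :: "point list \<Rightarrow> nat \<Rightarrow> point" where
  "input_point ps i = (if i < length ps then ps ! i else 0)"

primrec rval :: "point list \<Rightarrow> store \<Rightarrow> rexp \<Rightarrow> real" where
  "rval ps s (RConst z) = real_of_int z"
| "rval ps s (XCoord a) = input_point ps (aval s a) $ 1"
| "rval ps s (YCoord a) = input_point ps (aval s a) $ 2"
| "rval ps s (RPlus r q) = rval ps s r + rval ps s q"
| "rval ps s (RMinus r q) = rval ps s r - rval ps s q"
| "rval ps s (RTimes r q) = rval ps s r * rval ps s q"

primrec bval :: "point list \<Rightarrow> store \<Rightarrow> bexp \<Rightarrow> bool" where
  "bval ps s (Less a b) \<longleftrightarrow> aval s a < aval s b"
| "bval ps s (Equal a b) \<longleftrightarrow> aval s a = aval s b"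
| "bval ps s (RLess r q) \<longleftrightarrow> rval ps s r < rval ps s q"
| "bval ps s (BNot b) \<longleftrightarrow> \<not> bval ps s b"
| "bval ps s (BAnd b c) \<longleftrightarrow> bval ps s b \<and> bval ps s c"

text \<open>\<open>Assign A a b\<close> stores the value of \<open>b\<close> in the cell of array \<open>A\<close> whose index is the
  value of \<open>a\<close>. \<open>exec ps c s t s'\<close>: started in store \<open>s\<close>, program \<open>c\<close> terminates
  after \<open>t\<close> steps in store \<open>s'\<close>.\<close>

inductive exec :: "point list \<Rightarrow> com \<Rightarrow> store \<Rightarrow> nat \<Rightarrow> store \<Rightarrow> bool" for ps :: "point list" where
  Skip: "exec ps Skip s 1 s"
| Assign: "exec ps (Assign A a b) s 1 (s(A := (s A)(aval s a := aval s b)))"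
| Seq: "exec ps c1 s t1 s1 \<Longrightarrow> exec ps c2 s1 t2 s2 \<Longrightarrow> exec ps (Seq c1 c2) s (t1 + t2) s2"
| CondTrue: "bval ps s b \<Longrightarrow> exec ps c1 s t s1 \<Longrightarrow> exec ps (Cond b c1 c2) s (1 + t) s1"
| CondFalse: "\<not> bval ps s b \<Longrightarrow> exec ps c2 s t s1 \<Longrightarrow> exec ps (Cond b c1 c2) s (1 + t) s1"
| WhileFalse: "\<not> bval ps s b \<Longrightarrow> exec ps (While b c) s 1 s"
| WhileTrue: "bval ps s b \<Longrightarrow> exec ps c s t1 s1 \<Longrightarrow> exec ps (While b c) s1 t2 s2 \<Longrightarrow>
    exec ps (While b c) s (1 + t1 + t2) s2"

lemma exec_deterministic:
  assumes "exec ps c s t s1" and "exec ps c s t' s1'"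
  shows "t = t' \<and> s1 = s1'"
  using assms
proof (induction arbitrary: t' s1')
  case (Skip s)
  then show ?case by (auto elim: exec.cases)
next
  case (Assign A a b s)
  then show ?case by (auto elim: exec.cases)
next
  case (Seq c1 s t1 s1 c2 t2 s2)
  from Seq.prems show ?case by cases (use Seq.IH in blast)
next
  case (CondTrue s b c1 t s1 c2)
  from CondTrue.prems show ?case by cases (use CondTrue in blast)+
next
  case (CondFalse s b c2 t s1 c1)
  from CondFalse.prems show ?case by cases (use CondFalse in blast)+
next
  case (WhileFalse s b c)
  from WhileFalse.prems show ?case by cases (use WhileFalse in blast)+
next
  case (WhileTrue s b c t1 s1 t2 s2)
  from WhileTrue.prems show ?case by cases (use WhileTrue in blast)+
qed

text \<open>The input words are in array 1 and their number is in cell 0 of array 0, where also the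
  output is expected; all other cells are 0 initially.\<close>

definition init_store :: "nat list \<Rightarrow> store" where
  "init_store ws = (\<lambda>A i.
     if A = 0 \<and> i = 0 then length ws
     else if A = 1 \<and> i < length ws then ws ! i
     else 0)"

definition result :: "store \<Rightarrow> nat" where
  "result s = s 0 0"

definition computable :: "(nat \<Rightarrow> nat) \<Rightarrow> bool" where
  "computable f \<longleftrightarrow> (\<exists>c. \<forall>n. \<exists>t s. exec [] c (init_store [n]) t s \<and> result s = f n)"


section \<open>Encoding of the input\<close>

text \<open>Expressions are written in postfix order, with an opcode before the arguments of each
  operation; points of the plane are represented by their index in the list of points.\<close>

primrec encode_expr :: "nat cw_expr \<Rightarrow> nat list" where
  "encode_expr (Create p i) = [1, p, i]"
| "encode_expr (Disjoint_Union e1 e2) = encode_expr e1 @ encode_expr e2 @ [2]"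
| "encode_expr (Label_Pairs i j k e) = encode_expr e @ [3, i, j, k]"
| "encode_expr (Add_Triples i k e) = encode_expr e @ [4, i, k]"
| "encode_expr (Add_Triples_Rev i k e) = encode_expr e @ [5, i, k]"
| "encode_expr (Relabel_Points i j e) = encode_expr e @ [6, i, j]"
| "encode_expr (Relabel_Pairs i j e) = encode_expr e @ [7, i, j]"

definition index_of :: "point list \<Rightarrow> point \<Rightarrow> nat" where
  "index_of ps p = (LEAST i. i < length ps \<and> ps ! i = p)"

definition input_words :: "point list \<Rightarrow> point cw_expr \<Rightarrow> int \<Rightarrow> nat list" where
  "input_words ps e k =
     [length ps, if k < 0 then 1 else 0, nat \<bar>k\<bar>] @ encode_expr (map_cw_expr (index_of ps) e)"

text \<open>Each word and each coordinate counts 1.\<close>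

definition input_size :: "point list \<Rightarrow> point cw_expr \<Rightarrow> int \<Rightarrow> nat" where
  "input_size ps e k = 2 * length ps + length (input_words ps e k)"

end

theory Submission
  imports Defs "HOL-Library.Nat_Bijection"
begin

text \<open>
  By induction on the expression one sees which subsets \<open>Q\<close> of the points are in general
  position from a finite summary of \<open>Q\<close>: the set of the types of the single points, the pairs
  and the triples of \<open>Q\<close> that are still uncovered. The type of a tuple lists the unary
  labels of its entries and the sets of binary labels between them. A triple is collinear iff
  no operation ever covers it, and whether an operation covers a triple, as well as its new type,
  depends on its type only. Hence the summaries (states) are computed bottom-up by a tree automaton
  whose size depends on the number of labels only, and the algorithm keeps a table which maps
  every state to the maximal cardinality of a set with this state.

  Two devices keep the programming simple. The transition function of the automaton works on numbers
  (sets of types are encoded as bit sets) and is built from sums and powers of two by a few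
  closure rules, each of which also yields a program whose running time is bounded by an iterated
  exponential. An operation with one argument is executed like a union, with a table in
  which only the empty set occurs as the second argument. Arbitrary labels are first
  renamed to consecutive numbers.
\<close>

section \<open>Running times of programs\<close>

text \<open>Collinearity ignores orientation: three points are collinear iff neither orientation of
  their triple is in the order type. Hence (w4) and (w4') act alike on a state, and the direction of
  a labelled pair can be forgotten too. The obstacle is uniformity. One fixed program serves all
  widths, so it has to compute the automaton itself from the number of labels, and \<open>f\<close>
  must be computable although the time bounds of the subprograms are merely known to exist. The
  closure rules settle the first point. For the second, every time is bounded by a tower of twos
  whose height depends on the program only, and \<open>f\<close> is such a tower. Labels in the
  input may be huge compared with the width, so they are renumbered by table lookup in a first pass.
  The coordinates enter only through the hypothesis on the value of the expression.\<close>

definition wp :: "point list \<Rightarrow> com \<Rightarrow> store \<Rightarrow> nat \<Rightarrow> (store \<Rightarrow> bool) \<Rightarrow> bool" where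
  "wp ps c s T Q \<longleftrightarrow> (\<exists>t s'. exec ps c s t s' \<and> t \<le> T \<and> Q s')"

lemma wp_intro: "exec ps c s t s' \<Longrightarrow> t \<le> T \<Longrightarrow> Q s' \<Longrightarrow> wp ps c s T Q"
  unfolding wp_def by (rule exI, rule exI, rule conjI, assumption, rule conjI)

lemma wp_mono:
  assumes "wp ps c s T Q" and "T \<le> T'" and "\<And>s'. Q s' \<Longrightarrow> Q' s'"
  shows "wp ps c s T' Q'"
proof -
  obtain t s' where "exec ps c s t s'" "t \<le> T" "Q s'"
    using assms(1) unfolding wp_def by blast
  then show ?thesis
    unfolding wp_def using assms(2,3) by (intro exI[of _ t] exI[of _ s']) auto
qed

lemma wp_Skip: "Q s \<Longrightarrow> wp ps Skip s 1 Q"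
  unfolding wp_def by (intro exI conjI, rule exec.Skip, simp_all)

lemma wp_Assign: "Q (s(A := (s A)(aval s a := aval s b))) \<Longrightarrow> wp ps (Assign A a b) s 1 Q"
  by (rule wp_intro[OF exec.Assign order_refl])

lemma wp_Seq:
  assumes "wp ps c1 s T1 (\<lambda>s1. wp ps c2 s1 T2 Q)"
  shows "wp ps (Seq c1 c2) s (T1 + T2) Q"
proof -
  obtain t1 s1 where 1: "exec ps c1 s t1 s1" "t1 \<le> T1" "wp ps c2 s1 T2 Q"
    using assms unfolding wp_def[of _ c1] by blast
  then obtain t2 s2 where "exec ps c2 s1 t2 s2" "t2 \<le> T2" "Q s2"
    unfolding wp_def by blast
  then show ?thesis
    unfolding wp_def using exec.Seq[OF 1(1)] 1(2) by (meson add_mono)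
qed

lemma wp_Assign_Seq:
  "wp ps c (s(A := (s A)(aval s a := aval s b))) T Q \<Longrightarrow> wp ps (Seq (Assign A a b) c) s (1 + T) Q"
  by (rule wp_Seq, rule wp_Assign)

lemma wp_Cond:
  assumes "bval ps s b \<Longrightarrow> wp ps c1 s T Q" and "\<not> bval ps s b \<Longrightarrow> wp ps c2 s T Q"
  shows "wp ps (Cond b c1 c2) s (1 + T) Q"
proof (cases "bval ps s b")
  case True
  then obtain t s' where "exec ps c1 s t s'" "t \<le> T" "Q s'"
    using assms(1) unfolding wp_def by blast
  then show ?thesis
    unfolding wp_def using exec.CondTrue[OF True] by (meson add_left_mono)
next
  case False
  then obtain t s' where "exec ps c2 s t s'" "t \<le> T" "Q s'"
    using assms(2) unfolding wp_def by blast
  then show ?thesis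
    unfolding wp_def using exec.CondFalse[OF False] by (meson add_left_mono)
qed

lemma wp_While_step:
  assumes "bval ps s b" and "wp ps c s T1 (\<lambda>s1. wp ps (While b c) s1 T2 Q)"
  shows "wp ps (While b c) s (1 + T1 + T2) Q"
proof -
  obtain t1 s1 where 1: "exec ps c s t1 s1" "t1 \<le> T1" "wp ps (While b c) s1 T2 Q"
    using assms(2) unfolding wp_def[of _ c] by blast
  then obtain t2 s2 where "exec ps (While b c) s1 t2 s2" "t2 \<le> T2" "Q s2"
    unfolding wp_def by blast
  then show ?thesis
    unfolding wp_def using exec.WhileTrue[OF assms(1) 1(1)] 1(2) by (meson add_mono add_left_mono)
qed

lemma wp_While_end: "\<not> bval ps s b \<Longrightarrow> Q s \<Longrightarrow> wp ps (While b c) s 1 Q"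
  by (rule wp_intro[OF exec.WhileFalse order_refl])

lemma wp_While_count:
  assumes "I 0 s"
    and step: "\<And>i s. i < n \<Longrightarrow> I i s \<Longrightarrow> bval ps s b \<and> wp ps c s T (I (Suc i))"
    and stop: "\<And>s. I n s \<Longrightarrow> \<not> bval ps s b"
  shows "wp ps (While b c) s (n * Suc T + 1) (I n)"
proof -
  \<comment> \<open>Induction on the number \<open>j\<close> of iterations still to come, because
    \<open>wp_While_step\<close> peels off the first iteration and not the last.\<close>
  have "wp ps (While b c) s (j * Suc T + 1) (I n)" if "j \<le> n" "I (n - j) s" for j s
    using that
  proof (induction j arbitrary: s)
    case 0
    then show ?case using wp_While_end[of ps s b "I n"] stop by simp
  next
    case (Suc j)
    have b: "bval ps s b" and w: "wp ps c s T (I (Suc (n - Suc j)))"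
      using step[of "n - Suc j" s] Suc.prems by auto
    have "Suc (n - Suc j) = n - j" using Suc.prems by simp
    then have "wp ps c s T (\<lambda>s1. wp ps (While b c) s1 (j * Suc T + 1) (I n))"
      using w Suc.IH Suc.prems by (auto intro: wp_mono)
    from wp_While_step[OF b this] show ?case by (simp add: add.commute add.left_commute)
  qed
  from this[of n] show ?thesis using assms(1) by simp
qed

section \<open>Towers of twos as bounds\<close>

definition tow :: "nat \<Rightarrow> nat \<Rightarrow> nat" where
  "tow r N = ((\<lambda>x. 2 ^ x) ^^ r) N"

lemma tow_0 [simp]: "tow 0 N = N" by (simp add: tow_def)
lemma tow_Suc: "tow (Suc r) N = 2 ^ tow r N" by (simp add: tow_def)
lemma tow_add: "tow r (tow q N) = tow (r + q) N" by (simp add: tow_def funpow_add)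

lemma tow_mono: "N \<le> M \<Longrightarrow> tow r N \<le> tow r M"
  by (induction r) (auto simp: tow_Suc)

lemma tow_Suc_gt: "tow r N < tow (Suc r) N"
  by (simp add: tow_Suc less_exp)

lemma tow_mono_left: "r \<le> q \<Longrightarrow> tow r N \<le> tow q N"
  by (rule lift_Suc_mono_le[of "\<lambda>r. tow r N"]) (use tow_Suc_gt less_imp_le in auto)

lemma tow_ge: "r \<le> tow r N"
proof (induction r)
  case (Suc r)
  then show ?case using tow_Suc_gt[of r N] by linarith
qed simp

lemma double_le_power: "a + a \<le> (2::nat) ^ a"
proof (induction a)
  case (Suc a)
  then show ?case using less_exp[of a] by (cases a) auto
qed simp

lemma square_le_power: "a * a \<le> (2::nat) ^ 2 ^ a"
proof -
  have "a * a \<le> 2 ^ a * 2 ^ a" by (intro mult_mono) (auto simp: less_imp_le)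
  also have "\<dots> = 2 ^ (a + a)" by (simp add: power_add)
  also have "\<dots> \<le> 2 ^ 2 ^ a" using double_le_power by (intro power_increasing) auto
  finally show ?thesis .
qed

text \<open>Nothing finer than the height of a tower is recorded. Such bounds are closed under sum,
  product and composition, and the tower is computable even where the bounded function is only known
  to exist.\<close>

definition elb :: "(nat \<Rightarrow> nat) \<Rightarrow> bool" where
  "elb g \<longleftrightarrow> (\<exists>r. \<forall>N. g N \<le> tow r N)"

lemma elb_id: "elb (\<lambda>N. N)"
  unfolding elb_def by (rule exI[of _ 0]) simp

text \<open>A tower of height \<open>c\<close> is at least \<open>c\<close> for every top, including
  \<open>N = 0\<close>.\<close>

lemma elb_const: "elb (\<lambda>N. c)"
  unfolding elb_def using tow_ge by blast

lemma elb_le: "elb g \<Longrightarrow> (\<And>N. h N \<le> g N) \<Longrightarrow> elb h"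
  unfolding elb_def by (meson le_trans)

lemma elb_common:
  assumes "elb g" "elb h"
  obtains r where "\<And>N. g N \<le> tow r N" "\<And>N. h N \<le> tow r N"
proof -
  obtain p q where pq: "\<And>N. g N \<le> tow p N" "\<And>N. h N \<le> tow q N"
    using assms unfolding elb_def by blast
  show ?thesis
    by (rule that[of "max p q"]) (meson pq le_trans tow_mono_left max.cobounded1 max.cobounded2)+
qed

text \<open>One more exponential absorbs a sum; for a product two suffice.\<close>

lemma elb_add: assumes "elb g" "elb h" shows "elb (\<lambda>N. g N + h N)"
proof -
  obtain r where r: "\<And>N. g N \<le> tow r N" "\<And>N. h N \<le> tow r N"
    using elb_common[OF assms] by blast
  have "g N + h N \<le> tow (Suc r) N" for N
    using add_mono[OF r] double_le_power le_trans unfolding tow_Suc by blast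
  then show ?thesis unfolding elb_def by blast
qed

lemma elb_mult: assumes "elb g" "elb h" shows "elb (\<lambda>N. g N * h N)"
proof -
  obtain r where r: "\<And>N. g N \<le> tow r N" "\<And>N. h N \<le> tow r N"
    using elb_common[OF assms] by blast
  have "g N * h N \<le> tow (Suc (Suc r)) N" for N
    using mult_le_mono[OF r] square_le_power le_trans unfolding tow_Suc by blast
  then show ?thesis unfolding elb_def by blast
qed

lemma elb_comp: assumes "elb g" "elb h" shows "elb (\<lambda>N. g (h N))"
proof -
  obtain p q where pq: "\<And>N. g N \<le> tow p N" "\<And>N. h N \<le> tow q N"
    using assms unfolding elb_def by blast
  have "g (h N) \<le> tow (p + q) N" for N
    using pq le_trans tow_mono tow_add by metis
  then show ?thesis unfolding elb_def by blast
qed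

lemma elb_Suc: "elb g \<Longrightarrow> elb (\<lambda>N. Suc (g N))"
  using elb_add[OF _ elb_const[of 1]] by simp

lemma elb_tow: "elb (tow r)"
  unfolding elb_def by blast

lemmas elb_intros = elb_id elb_const elb_add elb_mult elb_Suc

text \<open>
  A function of finitely many variables is a function of an environment \<open>v\<close>, in which a binder
  shifts the variables as de Bruijn indices. The program \<open>C \<rho> m\<close> reads variable \<open>j\<close> from
  cell 0 of array \<open>\<rho> j\<close>, writes the result to cell 0 of array \<open>m\<close> and uses only arrays from
  \<open>m\<close> on, so that it can be used as a subroutine. \<open>N\<close> bounds the variables.
\<close>

definition realizes ::
  "(nat \<Rightarrow> nat) \<Rightarrow> ((nat \<Rightarrow> nat) \<Rightarrow> nat \<Rightarrow> com) \<Rightarrow> ((nat \<Rightarrow> nat) \<Rightarrow> nat) \<Rightarrow> bool" where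
  "realizes T C F \<longleftrightarrow> elb T \<and> (\<forall>v N. (\<forall>j. v j \<le> N) \<longrightarrow> F v \<le> T N) \<and>
     (\<forall>\<rho> m ps s N. (\<forall>j. \<rho> j < m) \<longrightarrow> (\<forall>j. s (\<rho> j) 0 \<le> N) \<longrightarrow>
       wp ps (C \<rho> m) s (T N) (\<lambda>s'. s' m 0 = F (\<lambda>j. s (\<rho> j) 0) \<and> (\<forall>A<m. s' A = s A)))"

text \<open>The counterpart of Kalmar's elementary functions: closed under bounded sums and powers
  of two, with values and running times below a tower of fixed height.\<close>

definition elem :: "((nat \<Rightarrow> nat) \<Rightarrow> nat) \<Rightarrow> bool" where
  "elem F \<longleftrightarrow> (\<exists>T C. realizes T C F)"

lemma realizes_elb: "realizes T C F \<Longrightarrow> elb T"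
  unfolding realizes_def by blast

lemma realizes_le: "realizes T C F \<Longrightarrow> \<forall>j. v j \<le> N \<Longrightarrow> F v \<le> T N"
  unfolding realizes_def by blast

lemma realizes_wp:
  assumes "realizes T C F" and "\<And>j. \<rho> j < m" and "\<And>j. s (\<rho> j) 0 \<le> N"
    and Q: "\<And>s'. s' m 0 = F (\<lambda>j. s (\<rho> j) 0) \<Longrightarrow> (\<And>A. A < m \<Longrightarrow> s' A = s A) \<Longrightarrow> Q s'"
  shows "wp ps (C \<rho> m) s (T N) Q"
proof (rule wp_mono[OF _ order_refl])
  show "wp ps (C \<rho> m) s (T N) (\<lambda>s'. s' m 0 = F (\<lambda>j. s (\<rho> j) 0) \<and> (\<forall>A<m. s' A = s A))"
    using assms(1,2,3) unfolding realizes_def by blast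
  show "Q s'" if "s' m 0 = F (\<lambda>j. s (\<rho> j) 0) \<and> (\<forall>A<m. s' A = s A)" for s'
    using Q that by blast
qed

text \<open>Time and values may have different bounds here; their sum is the single \<open>T\<close>
  of \<open>realizes\<close>. Having one bound for both is convenient because the values of an inner
  program bound the variables of the next one.\<close>

lemma elemI:
  assumes "elb T" "elb U" and le: "\<And>v N. \<forall>j. v j \<le> N \<Longrightarrow> F v \<le> U N"
    and wp: "\<And>\<rho> m ps s N. (\<And>j. \<rho> j < m) \<Longrightarrow> (\<And>j. s (\<rho> j) 0 \<le> N) \<Longrightarrow>
      wp ps (C \<rho> m) s (T N) (\<lambda>s'. s' m 0 = F (\<lambda>j. s (\<rho> j) 0) \<and> (\<forall>A<m. s' A = s A))"
  shows "elem F"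
proof -
  have "realizes (\<lambda>N. T N + U N) C F"
    unfolding realizes_def
  proof (intro conjI allI impI)
    show "elb (\<lambda>N. T N + U N)" by (intro elb_add assms)
    show "F v \<le> T N + U N" if "\<forall>j. v j \<le> N" for v N
      using le[of v N] that by simp
    show "wp ps (C \<rho> m) s (T N + U N) (\<lambda>s'. s' m 0 = F (\<lambda>j. s (\<rho> j) 0) \<and> (\<forall>A<m. s' A = s A))"
      if "\<forall>j. \<rho> j < m" "\<forall>j. s (\<rho> j) 0 \<le> N" for \<rho> m ps s N
      by (rule wp_mono[OF wp]) (use that in auto)
  qed
  then show ?thesis unfolding elem_def by blast
qed

lemma elem_const: "elem (\<lambda>v. k)"
  by (rule elemI[where C = "\<lambda>\<rho> m. Assign m (Const 0) (Const k)" and T = "\<lambda>_. 1" and U = "\<lambda>_. k"])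
    (auto intro!: elb_intros wp_Assign[unfolded One_nat_def])

lemma elem_var: "elem (\<lambda>v. v j)"
  by (rule elemI[where C = "\<lambda>\<rho> m. Assign m (Const 0) (Cell (\<rho> j) (Const 0))"
        and T = "\<lambda>_. 1" and U = "\<lambda>N. N"])
    (auto intro!: elb_intros wp_Assign[unfolded One_nat_def])

text \<open>A substitution of variables costs no code: it is absorbed by the map from variables to
  arrays.\<close>

lemma elem_rename:
  assumes "elem F" shows "elem (\<lambda>v. F (\<lambda>j. v (\<sigma> j)))"
proof -
  obtain T C where R: "realizes T C F"
    using assms unfolding elem_def by blast
  show ?thesis
  proof (rule elemI[OF realizes_elb[OF R] realizes_elb[OF R]])
    fix \<rho> m ps N and s :: store assume r: "\<And>j::nat. \<rho> j < (m::nat)" "\<And>j. s (\<rho> j) 0 \<le> (N::nat)"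
    show "wp ps (C (\<lambda>j. \<rho> (\<sigma> j)) m) s (T N)
      (\<lambda>s'. s' m 0 = F (\<lambda>j. s (\<rho> (\<sigma> j)) 0) \<and> (\<forall>A<m. s' A = s A))"
      by (rule realizes_wp[OF R]) (use r in auto)
  qed (use realizes_le[OF R] in auto)
qed

text \<open>The value of \<open>F\<close> waits in array \<open>m\<close> while the program for
  \<open>G\<close> runs from array \<open>Suc m\<close> on and cannot touch it.\<close>

lemma elem_binop:
  assumes "elem F" "elem G" and bop: "\<And>s a b. aval s (f a b) = op (aval s a) (aval s b)"
    and le: "\<And>x y. op x y \<le> x + (y::nat)"
  shows "elem (\<lambda>v. op (F v) (G v))"
proof -
  obtain T C where F: "realizes T C F"
    using assms(1) unfolding elem_def by blast
  obtain U D where G: "realizes U D G"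
    using assms(2) unfolding elem_def by blast
  show ?thesis
  proof (rule elemI)
    show "elb (\<lambda>N. T N + (U N + 1))" "elb (\<lambda>N. T N + U N)" by (intro elb_intros realizes_elb[OF F] realizes_elb[OF G])+
    show "op (F v) (G v) \<le> T N + U N" if "\<forall>j. v j \<le> N" for v N
      using realizes_le[OF F, OF that] realizes_le[OF G, OF that] le le_trans add_mono by meson
    fix \<rho> m ps N and s :: store assume r: "\<And>j::nat. \<rho> j < (m::nat)" "\<And>j. s (\<rho> j) 0 \<le> (N::nat)"
    show "wp ps (Seq (C \<rho> m) (Seq (D \<rho> (Suc m))
        (Assign m (Const 0) (f (Cell m (Const 0)) (Cell (Suc m) (Const 0)))))) s (T N + (U N + 1))
      (\<lambda>s'. s' m 0 = op (F (\<lambda>j. s (\<rho> j) 0)) (G (\<lambda>j. s (\<rho> j) 0)) \<and> (\<forall>A<m. s' A = s A))"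
      apply (rule wp_Seq, rule realizes_wp[OF F])
        apply (use r in auto)[2]
      apply (rule wp_Seq, rule realizes_wp[OF G])
        apply (use r in \<open>auto simp: less_Suc_eq\<close>)[2]
      apply (rule wp_Assign)
      using r by (simp add: bop)
  qed
qed

lemma elem_add: "elem F \<Longrightarrow> elem G \<Longrightarrow> elem (\<lambda>v. F v + G v)"
  by (rule elem_binop[where f = Plus]) auto

lemma elem_diff: "elem F \<Longrightarrow> elem G \<Longrightarrow> elem (\<lambda>v. F v - G v)"
  by (rule elem_binop[where f = Minus]) auto

lemma elem_iter:
  assumes "elem B" "elem A" "elem (\<lambda>v. G (\<lambda>j. v (Suc (Suc j))) (v 0) (v (Suc 0)))"
    and "elb H"
    and bnd: "\<And>v N i. \<forall>j. v j \<le> N \<Longrightarrow> i \<le> B v \<Longrightarrow> rec_nat (A v) (G v) i \<le> H N"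
  shows "elem (\<lambda>v. rec_nat (A v) (G v) (B v))"
proof -
  obtain TB CB where B: "realizes TB CB B"
    using assms(1) unfolding elem_def by blast
  obtain TA CA where A: "realizes TA CA A"
    using assms(2) unfolding elem_def by blast
  obtain TG CG where G: "realizes TG CG (\<lambda>v. G (\<lambda>j. v (Suc (Suc j))) (v 0) (v (Suc 0)))"
    using assms(3) unfolding elem_def by blast
  \<comment> \<open>\<open>M N\<close> bounds all that the body reads: the environment by
    \<open>N\<close>, the counter by \<open>TB N\<close>, the accumulator by
    \<open>H N\<close>.\<close>
  define M where "M N = N + TB N + H N" for N
  \<comment> \<open>Array \<open>m\<close> holds the number of iterations, \<open>m + 1\<close> the
    accumulator, \<open>m + 2\<close> the counter and \<open>m + 3\<close> the value of the step.
    For the step, the counter is variable 0 and the accumulator variable 1.\<close>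
  define body where "body \<rho> m = Seq (CG (case_nat (m + 2) (case_nat (m + 1) \<rho>)) (m + 3))
    (Seq (Assign (m + 1) (Const 0) (Cell (m + 3) (Const 0)))
      (Assign (m + 2) (Const 0) (Plus (Cell (m + 2) (Const 0)) (Const 1))))" for \<rho> m
  define prog where "prog \<rho> m = Seq (CB \<rho> m) (Seq (CA \<rho> (m + 1)) (Seq (Assign (m + 2) (Const 0) (Const 0))
    (Seq (While (Less (Cell (m + 2) (Const 0)) (Cell m (Const 0))) (body \<rho> m))
      (Assign m (Const 0) (Cell (m + 1) (Const 0))))))" for \<rho> m
  define T where "T N = TB N + (TA N + (1 + ((TB N * Suc (TG (M N) + (1 + 1)) + 1) + 1)))" for N
  show ?thesis
  proof (rule elemI)
    have M: "elb M" unfolding M_def by (intro elb_intros realizes_elb[OF B] assms)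
    show "elb T" unfolding T_def by (intro elb_intros realizes_elb[OF B] realizes_elb[OF A] elb_comp[OF realizes_elb[OF G] M])
    show "elb H" by fact
    show "rec_nat (A v) (G v) (B v) \<le> H N" if "\<forall>j. v j \<le> N" for v N
      using bnd[OF that order_refl] .
    fix \<rho> m ps N and s :: store assume r: "\<And>j::nat. \<rho> j < (m::nat)" "\<And>j. s (\<rho> j) 0 \<le> (N::nat)"
    define v where "v = (\<lambda>j. s (\<rho> j) 0)"
    have v: "\<forall>j. v j \<le> N" unfolding v_def using r by blast
    define n where "n = B v"
    have n: "n \<le> TB N" unfolding n_def by (rule realizes_le[OF B, OF v])
    define I where "I i s' \<longleftrightarrow> s' (m + 2) 0 = i \<and> s' m 0 = n \<and> s' (m + 1) 0 = rec_nat (A v) (G v) i \<and>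
      (\<forall>A<m. s' A = s A)" for i s'
    have loop: "wp ps (While (Less (Cell (m + 2) (Const 0)) (Cell m (Const 0))) (body \<rho> m)) s'
        (TB N * Suc (TG (M N) + (1 + 1)) + 1) (I n)" if "I 0 s'" for s'
    proof (rule wp_mono[OF wp_While_count[where n = n and I = I, OF that]])
      fix i s' assume i: "i < n" and I: "I i s'"
      have "wp ps (body \<rho> m) s' (TG (M N) + (1 + 1)) (I (Suc i))"
        unfolding body_def
      proof (rule wp_Seq, rule realizes_wp[OF G])
        show "case_nat (m + 2) (case_nat (m + 1) \<rho>) j < m + 3" for j
          using r(1) by (auto split: nat.split intro: less_trans[OF r(1)])
        show "s' (case_nat (m + 2) (case_nat (m + 1) \<rho>) j) 0 \<le> M N" for j
          using I i n bnd[OF v, of i] r unfolding I_def M_def n_def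
          by (auto split: nat.split intro: trans_le_add1 trans_le_add2)
      next
        fix s2
        assume *: "s2 (m + 3) 0 = G (\<lambda>j. s' (case_nat (m + 2) (case_nat (m + 1) \<rho>) (Suc (Suc j))) 0)
            (s' (case_nat (m + 2) (case_nat (m + 1) \<rho>) 0) 0)
            (s' (case_nat (m + 2) (case_nat (m + 1) \<rho>) (Suc 0)) 0)"
          and **: "\<And>A. A < m + 3 \<Longrightarrow> s2 A = s' A"
        have "(\<lambda>j. s' (\<rho> j) 0) = v" using I r unfolding v_def I_def by simp
        then have "s2 (m + 3) 0 = G v i (rec_nat (A v) (G v) i)"
          using * I unfolding I_def by simp
        then show "wp ps (Seq (Assign (m + 1) (Const 0) (Cell (m + 3) (Const 0)))
          (Assign (m + 2) (Const 0) (Plus (Cell (m + 2) (Const 0)) (Const 1)))) s2 (1 + 1) (I (Suc i))"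
          by (intro wp_Seq wp_Assign) (use ** I in \<open>auto simp: I_def\<close>)
      qed
      then show "bval ps s' (Less (Cell (m + 2) (Const 0)) (Cell m (Const 0))) \<and>
          wp ps (body \<rho> m) s' (TG (M N) + (1 + 1)) (I (Suc i))"
        using I i unfolding I_def by simp
    next
      show "n * Suc (TG (M N) + (1 + 1)) + 1 \<le> TB N * Suc (TG (M N) + (1 + 1)) + 1"
        using n by (intro add_right_mono mult_right_mono) auto
    qed (auto simp: I_def)
    show "wp ps (prog \<rho> m) s (T N)
      (\<lambda>s'. s' m 0 = rec_nat (A (\<lambda>j. s (\<rho> j) 0)) (G (\<lambda>j. s (\<rho> j) 0)) (B (\<lambda>j. s (\<rho> j) 0)) \<and> (\<forall>A<m. s' A = s A))"
      unfolding prog_def T_def v_def[symmetric]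
      apply (rule wp_Seq, rule realizes_wp[OF B])
        apply (use r in auto)[2]
      apply (rule wp_Seq, rule realizes_wp[OF A])
        apply (use r in \<open>auto simp: less_Suc_eq\<close>)[2]
      apply (rule wp_Seq, rule wp_Assign, rule wp_Seq, rule wp_mono[OF loop order_refl])
      using r by (auto simp: I_def n_def v_def intro!: wp_Assign[unfolded One_nat_def])
  qed
qed

lemma sum_as_rec: "(\<Sum>i<n. f i) = rec_nat 0 (\<lambda>i a. a + f i) (n::nat)"
  by (induction n) auto

lemma elem_sum:
  assumes "elem B" "elem (\<lambda>v. F (\<lambda>j. v (Suc j)) (v 0))"
  shows "elem (\<lambda>v. \<Sum>i<B v. F v i)"
proof -
  obtain TB CB where B: "realizes TB CB B"
    using assms(1) unfolding elem_def by blast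
  obtain TF CF where F: "realizes TF CF (\<lambda>v. F (\<lambda>j. v (Suc j)) (v 0))"
    using assms(2) unfolding elem_def by blast
  define H where "H N = TB N * TF (N + TB N)" for N
  have "elem (\<lambda>v. rec_nat 0 (\<lambda>i a. a + F v i) (B v))"
  proof (rule elem_iter[OF assms(1) elem_const])
    \<comment> \<open>In the recursion the accumulator occupies variable 1, so the free variables of
      \<open>F\<close> move up by one more place, while the summation index stays variable
      0.\<close>
    have "elem (\<lambda>v. F (\<lambda>j. v (case_nat 0 (\<lambda>j. Suc (Suc j)) (Suc j))) (v (case_nat 0 (\<lambda>j. Suc (Suc j)) 0)))"
      by (rule elem_rename[OF assms(2), where \<sigma> = "case_nat 0 (\<lambda>j. Suc (Suc j))"])
    then show "elem (\<lambda>v. v (Suc 0) + F (\<lambda>j. v (Suc (Suc j))) (v 0))"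
      by (intro elem_add elem_var) simp
    show "elb H" unfolding H_def by (intro elb_intros realizes_elb[OF B] elb_comp[OF realizes_elb[OF F]])
    fix v N i assume v: "\<forall>j. v j \<le> (N::nat)" and i: "i \<le> B v"
    have "F v k \<le> TF (N + TB N)" if "k < i" for k
    proof -
      have "\<forall>j. case_nat k v j \<le> N + TB N"
        using that i realizes_le[OF B, OF v] v by (auto split: nat.split intro: trans_le_add1)
      from realizes_le[OF F, OF this] show ?thesis by simp
    qed
    then have "(\<Sum>k<i. F v k) \<le> i * TF (N + TB N)"
      using sum_bounded_above[of "{..<i}" "F v" "TF (N + TB N)"] by simp
    also have "\<dots> \<le> H N" unfolding H_def using i realizes_le[OF B, OF v] by (intro mult_right_mono) auto
    finally show "rec_nat 0 (\<lambda>i a. a + F v i) i \<le> H N" by (simp add: sum_as_rec)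
  qed
  then show ?thesis by (simp add: sum_as_rec)
qed

lemma elem_pow2: assumes "elem F" shows "elem (\<lambda>v. 2 ^ F v)"
proof -
  obtain T C where T: "realizes T C F"
    using assms unfolding elem_def by blast
  have rec: "rec_nat (1::nat) (\<lambda>i a. a + a) n = 2 ^ n" for n by (induction n) auto
  have "elem (\<lambda>v. rec_nat 1 (\<lambda>i a. a + a) (F v))"
  proof (rule elem_iter[OF assms elem_const])
    show "elb (\<lambda>N. tow 1 (T N))" by (rule elb_comp[OF elb_tow realizes_elb[OF T]])
    show "rec_nat 1 (\<lambda>i a. a + a) i \<le> tow 1 (T N)" if "\<forall>j. v j \<le> N" "i \<le> F v" for v N i
    proof -
      have "i \<le> T N" using realizes_le[OF T, OF that(1)] that(2) by simp
      then show ?thesis unfolding rec using tow_Suc[of 0] by simp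
    qed
  qed (intro elem_add elem_var)
  then show ?thesis unfolding rec .
qed

section \<open>Decidable predicates and bounded search\<close>

definition elemP :: "((nat \<Rightarrow> nat) \<Rightarrow> bool) \<Rightarrow> bool" where
  "elemP P \<longleftrightarrow> elem (\<lambda>v. if P v then 1 else 0)"

lemma elem_mult: assumes "elem F" "elem G" shows "elem (\<lambda>v. F v * G v)"
proof -
  have "elem (\<lambda>v. \<Sum>i<F v. G v)"
    by (rule elem_sum[OF assms(1)], rule elem_rename[OF assms(2), of Suc])
  then show ?thesis by simp
qed

lemma elem_Suc: "elem F \<Longrightarrow> elem (\<lambda>v. Suc (F v))"
  using elem_add[OF _ elem_const[of 1]] by simp

lemma elem_if: assumes "elemP P" "elem F" "elem G" shows "elem (\<lambda>v. if P v then F v else G v)"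
proof -
  have "(\<lambda>v. if P v then F v else G v) = (\<lambda>v. (if P v then 1 else 0) * F v + (1 - (if P v then 1 else 0)) * G v)"
    by auto
  then show ?thesis
    using assms unfolding elemP_def by (auto intro!: elem_add elem_mult elem_diff elem_const)
qed

lemma elemP_less: assumes "elem F" "elem G" shows "elemP (\<lambda>v. F v < G v)"
proof -
  \<comment> \<open>Under truncated subtraction \<open>1 - (1 - x)\<close> is the sign of
    \<open>x\<close>.\<close>
  have "(\<lambda>v. if F v < G v then 1 else 0) = (\<lambda>v. 1 - (1 - (G v - F v)))" by auto
  then show ?thesis using assms unfolding elemP_def by (auto intro!: elem_diff elem_const)
qed

lemma elemP_not: assumes "elemP P" shows "elemP (\<lambda>v. \<not> P v)"
proof -
  have "(\<lambda>v. if \<not> P v then 1 else 0) = (\<lambda>v. 1 - (if P v then 1 else (0::nat)))" by auto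
  then show ?thesis using assms unfolding elemP_def by (auto intro!: elem_diff elem_const)
qed

lemma elemP_conj: assumes "elemP P" "elemP R" shows "elemP (\<lambda>v. P v \<and> R v)"
proof -
  have "(\<lambda>v. if P v \<and> R v then 1 else 0) = (\<lambda>v. (if P v then 1 else (0::nat)) * (if R v then 1 else 0))" by auto
  then show ?thesis using assms unfolding elemP_def by (auto intro!: elem_mult)
qed

lemma elemP_disj: assumes "elemP P" "elemP R" shows "elemP (\<lambda>v. P v \<or> R v)"
  using elemP_not[OF elemP_conj[OF elemP_not[OF assms(1)] elemP_not[OF assms(2)]]] by simp

lemma elemP_eq: assumes "elem F" "elem G" shows "elemP (\<lambda>v. F v = G v)"
proof -
  have "elemP (\<lambda>v. \<not> F v < G v \<and> \<not> G v < F v)"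
    by (intro elemP_conj elemP_not elemP_less assms)
  moreover have "(\<lambda>v. \<not> F v < G v \<and> \<not> G v < F v) = (\<lambda>v. F v = G v)" by (rule ext) auto
  ultimately show ?thesis by (rule back_subst)
qed

lemma elemP_ex:
  assumes "elem B" "elemP (\<lambda>v. P (\<lambda>j. v (Suc j)) (v 0))"
  shows "elemP (\<lambda>v. \<exists>i<B v. P v i)"
proof -
  \<comment> \<open>The sum of the indicators counts the witnesses.\<close>
  have "(\<exists>i<B v. P v i) \<longleftrightarrow> 0 < (\<Sum>i<B v. if P v i then 1 else (0::nat))" for v
  proof -
    have "(\<Sum>i<B v. if P v i then 1 else (0::nat)) = card {i\<in>{..<B v}. P v i}"
      by (simp add: sum.If_cases Int_def)
    then show ?thesis by (auto simp: card_gt_0_iff)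
  qed
  then have "(\<lambda>v. \<exists>i<B v. P v i) = (\<lambda>v. 0 < (\<Sum>i<B v. if P v i then 1 else (0::nat)))"
    by (rule ext)
  moreover have "elemP \<dots>"
    by (intro elemP_less elem_const elem_sum assms elem_if)
  ultimately show ?thesis by simp
qed

text \<open>Turns a graph into a function: in the sum over all candidates only the right one
  contributes its value. This provides inverse functions, such as the decoding of pairs.\<close>

lemma elem_unique:
  assumes "elem B" "elemP (\<lambda>v. P (\<lambda>j. v (Suc j)) (v 0))"
    and eq: "\<And>v y. y < B v \<and> P v y \<longleftrightarrow> y = F v"
  shows "elem F"
proof -
  have "F v = (\<Sum>y<B v. if P v y then y else 0)" for v
  proof -
    have "(\<Sum>y<B v. if P v y then y else 0) = (\<Sum>y<B v. if y = F v then y else 0)"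
      using eq by (intro sum.cong) auto
    also have "\<dots> = F v" using eq[of "F v" v] by (auto simp: sum.delta)
    finally show ?thesis by simp
  qed
  then have "F = (\<lambda>v. \<Sum>y<B v. if P v y then y else 0)" by blast
  moreover have "elem \<dots>"
    by (intro elem_sum elem_if assms elem_var elem_const)
  ultimately show ?thesis by simp
qed

section \<open>Types and states as numbers\<close>

text \<open>Replaces the division by 2 in \<open>triangle\<close> by a sum, for which there is a
  closure rule.\<close>

lemma triangle_sum: "triangle n = (\<Sum>i<Suc n. i)"
  by (induction n) auto

lemma elem_prod_encode: "elem F \<Longrightarrow> elem G \<Longrightarrow> elem (\<lambda>v. prod_encode (F v, G v))"
  unfolding prod_encode_def triangle_sum prod.case
  by (intro elem_add elem_sum elem_Suc elem_var)

text \<open>Both components of a pair are at most its code, so a search below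
  \<open>Suc (F v)\<close> finds them.\<close>

lemma elem_fst_decode:
  assumes "elem F" shows "elem (\<lambda>v. fst (prod_decode (F v)))"
proof (rule elem_unique)
  show "elem (\<lambda>v. Suc (F v))" by (intro elem_Suc assms)
  have "elem (\<lambda>v. F (\<lambda>j. v (Suc j)))" by (rule elem_rename[OF assms])
  then show "elemP (\<lambda>v. \<exists>b<Suc (F (\<lambda>j. v (Suc j))). prod_encode (v 0, b) = F (\<lambda>j. v (Suc j)))"
    using elem_rename[OF assms, of "\<lambda>j. Suc (Suc j)"]
    by (intro elemP_ex elemP_eq elem_prod_encode elem_Suc elem_var)
  show "y < Suc (F v) \<and> (\<exists>b<Suc (F v). prod_encode (y, b) = F v) \<longleftrightarrow> y = fst (prod_decode (F v))" for v y
  proof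
    assume "y = fst (prod_decode (F v))"
    then have "prod_encode (y, snd (prod_decode (F v))) = F v" by simp
    then show "y < Suc (F v) \<and> (\<exists>b<Suc (F v). prod_encode (y, b) = F v)"
      using le_prod_encode_1[of y "snd (prod_decode (F v))"] le_prod_encode_2[of "snd (prod_decode (F v))" y]
      by (intro conjI exI[of _ "snd (prod_decode (F v))"]) auto
  next
    assume "y < Suc (F v) \<and> (\<exists>b<Suc (F v). prod_encode (y, b) = F v)"
    then obtain b where "prod_encode (y, b) = F v" by blast
    from this[symmetric] show "y = fst (prod_decode (F v))" by simp
  qed
qed

lemma elem_snd_decode:
  assumes "elem F" shows "elem (\<lambda>v. snd (prod_decode (F v)))"
proof (rule elem_unique)
  show "elem (\<lambda>v. Suc (F v))" by (intro elem_Suc assms)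
  have "elem (\<lambda>v. F (\<lambda>j. v (Suc j)))" by (rule elem_rename[OF assms])
  then show "elemP (\<lambda>v. prod_encode (fst (prod_decode (F (\<lambda>j. v (Suc j)))), v 0) = F (\<lambda>j. v (Suc j)))"
    by (intro elemP_eq elem_prod_encode elem_fst_decode elem_var)
  show "y < Suc (F v) \<and> prod_encode (fst (prod_decode (F v)), y) = F v \<longleftrightarrow> y = snd (prod_decode (F v))" for v y
  proof
    assume y: "y = snd (prod_decode (F v))"
    then have "prod_encode (fst (prod_decode (F v)), y) = F v" by simp
    then show "y < Suc (F v) \<and> prod_encode (fst (prod_decode (F v)), y) = F v"
      using le_prod_encode_2[of y "fst (prod_decode (F v))"] by simp
  next
    assume "y < Suc (F v) \<and> prod_encode (fst (prod_decode (F v)), y) = F v"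
    then have "prod_decode (F v) = (fst (prod_decode (F v)), y)" by (metis prod_encode_inverse)
    then show "y = snd (prod_decode (F v))" by (metis snd_conv)
  qed
qed

text \<open>Bit \<open>x\<close> of \<open>s\<close> is set iff the quotient of \<open>s\<close> by
  \<open>2 ^ x\<close> is odd; \<open>q + q + 1\<close> is this quotient and \<open>r\<close> the
  remainder. In this form the bit test needs bounded search only.\<close>

lemma mem_set_decode_iff:
  "x \<in> set_decode s \<longleftrightarrow> (\<exists>q<Suc s. \<exists>r<2 ^ x. s = (q + q + 1) * 2 ^ x + r)"
proof
  assume "x \<in> set_decode s"
  then have "odd (s div 2 ^ x)" by (simp add: set_decode_def)
  then obtain q where q: "s div 2 ^ x = 2 * q + 1" by (elim oddE)
  have "q \<le> s div 2 ^ x" using q by simp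
  then have "q < Suc s" using div_le_dividend[of s "2 ^ x"] by linarith
  moreover have "s = (q + q + 1) * 2 ^ x + s mod 2 ^ x"
    using q div_mult_mod_eq[of s "2 ^ x"] by (simp add: mult_2)
  moreover have "s mod 2 ^ x < 2 ^ x" by simp
  ultimately show "\<exists>q<Suc s. \<exists>r<2 ^ x. s = (q + q + 1) * 2 ^ x + r" by blast
next
  assume "\<exists>q<Suc s. \<exists>r<2 ^ x. s = (q + q + 1) * 2 ^ x + r"
  then obtain q r where r: "r < 2 ^ x" and s: "s = (q + q + 1) * 2 ^ x + r" by blast
  have "s div 2 ^ x = q + q + 1" unfolding s by (subst div_mult_self3) (use r in auto)
  then show "x \<in> set_decode s" by (simp add: set_decode_def)
qed

text \<open>Turns a quantifier over the members of a bit set into a bounded one.\<close>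

lemma mem_set_decode_less: "x \<in> set_decode s \<Longrightarrow> x < s"
proof -
  assume "x \<in> set_decode s"
  then have "s div 2 ^ x \<noteq> 0" by (intro notI) (simp add: set_decode_def)
  then have "2 ^ x \<le> s" by (simp add: div_eq_0_iff)
  then show "x < s" using less_exp[of x] by linarith
qed

lemma elemP_member:
  assumes "elem F" "elem G" shows "elemP (\<lambda>v. F v \<in> set_decode (G v))"
  unfolding mem_set_decode_iff
  using elem_rename[OF assms(1), of Suc] elem_rename[OF assms(1), of "\<lambda>j. Suc (Suc j)"]
    elem_rename[OF assms(2), of "\<lambda>j. Suc (Suc j)"] assms
  by (intro elemP_ex elemP_eq elem_add elem_mult elem_pow2 elem_Suc elem_const elem_var)

lemma elemP_bex:
  assumes "elem F" "elemP (\<lambda>v. P (\<lambda>j. v (Suc j)) (v 0))"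
  shows "elemP (\<lambda>v. \<exists>t\<in>set_decode (F v). P v t)"
proof -
  have "elemP (\<lambda>v. \<exists>t<F v. t \<in> set_decode (F v) \<and> P v t)"
    using elem_rename[OF assms(1), of Suc] assms
    by (intro elemP_ex elemP_conj elemP_member elem_var)
  moreover have "(\<lambda>v. \<exists>t<F v. t \<in> set_decode (F v) \<and> P v t) = (\<lambda>v. \<exists>t\<in>set_decode (F v). P v t)"
    using mem_set_decode_less by (intro ext) blast
  ultimately show ?thesis by (rule back_subst)
qed

lemma elem_set_encode_Collect:
  assumes "elem B" "elemP (\<lambda>v. P (\<lambda>j. v (Suc j)) (v 0))"
  shows "elem (\<lambda>v. set_encode {y. y < B v \<and> P v y})"
proof -
  have "elem (\<lambda>v. \<Sum>y<B v. if P v y then 2 ^ y else 0)"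
    by (intro elem_sum elem_if elem_pow2 elem_var elem_const assms)
  moreover have "(\<Sum>y<B v. if P v y then 2 ^ y else 0) = set_encode {y. y < B v \<and> P v y}" for v
    by (simp add: set_encode_def sum.If_cases Int_def)
  ultimately show ?thesis by simp
qed

text \<open>
  The type of a tuple of at most three points: \<open>a\<close>, \<open>b\<close>, \<open>c\<close> are the unary labels of
  its entries, 0 for a missing entry (labels are renamed to positive numbers), and \<open>p\<close>, \<open>q\<close>,
  \<open>r\<close> are the bit sets of the binary labels, in either direction, between the first and the
  second, the first and the third, and the second and the third entry.
\<close>

definition enc :: "nat \<Rightarrow> nat \<Rightarrow> nat \<Rightarrow> nat \<Rightarrow> nat \<Rightarrow> nat \<Rightarrow> nat" where
  "enc a b c p q r = prod_encode (a, prod_encode (b, prod_encode (c, prod_encode (p, prod_encode (q, r)))))"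

definition rest :: "nat \<Rightarrow> nat" where "rest t = snd (prod_decode t)"
definition c1 :: "nat \<Rightarrow> nat" where "c1 t = fst (prod_decode t)"
definition c2 :: "nat \<Rightarrow> nat" where "c2 t = c1 (rest t)"
definition c3 :: "nat \<Rightarrow> nat" where "c3 t = c2 (rest t)"
definition c4 :: "nat \<Rightarrow> nat" where "c4 t = c3 (rest t)"
definition c5 :: "nat \<Rightarrow> nat" where "c5 t = c4 (rest t)"
definition c6 :: "nat \<Rightarrow> nat" where "c6 t = rest (rest (rest (rest (rest t))))"

lemma comps_enc [simp]:
  "c1 (enc a b c p q r) = a" "c2 (enc a b c p q r) = b" "c3 (enc a b c p q r) = c"
  "c4 (enc a b c p q r) = p" "c5 (enc a b c p q r) = q" "c6 (enc a b c p q r) = r"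
  by (simp_all add: enc_def c1_def c2_def c3_def c4_def c5_def c6_def rest_def)

lemma elem_enc:
  "elem a \<Longrightarrow> elem b \<Longrightarrow> elem c \<Longrightarrow> elem p \<Longrightarrow> elem q \<Longrightarrow> elem r \<Longrightarrow>
   elem (\<lambda>v. enc (a v) (b v) (c v) (p v) (q v) (r v))"
  unfolding enc_def by (intro elem_prod_encode)

lemma elem_comps:
  assumes "elem F"
  shows "elem (\<lambda>v. c1 (F v))" "elem (\<lambda>v. c2 (F v))" "elem (\<lambda>v. c3 (F v))"
    "elem (\<lambda>v. c4 (F v))" "elem (\<lambda>v. c5 (F v))" "elem (\<lambda>v. c6 (F v))"
  unfolding c6_def c5_def c4_def c3_def c2_def c1_def rest_def
  by (intro elem_fst_decode elem_snd_decode assms)+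

lemma prod_encode_mono: "a \<le> a' \<Longrightarrow> b \<le> b' \<Longrightarrow> prod_encode (a, b) \<le> prod_encode (a', b')"
proof -
  assume "a \<le> a'" "b \<le> b'"
  then have "triangle (a + b) \<le> triangle (a' + b')"
    unfolding triangle_sum by (intro sum_mono2) auto
  then show ?thesis using \<open>a \<le> a'\<close> by (simp add: prod_encode_def)
qed

lemma enc_mono:
  "a \<le> a' \<Longrightarrow> b \<le> b' \<Longrightarrow> c \<le> c' \<Longrightarrow> p \<le> p' \<Longrightarrow> q \<le> q' \<Longrightarrow> r \<le> r' \<Longrightarrow>
   enc a b c p q r \<le> enc a' b' c' p' q' r'"
  unfolding enc_def by (intro prod_encode_mono)

text \<open>With labels at most \<open>m\<close>, both the labels and the codes of sets of labels
  are at most \<open>2 ^ Suc m\<close>. So every type is at most the type with all components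
  \<open>K\<close>, and a state is a bit set of such types.\<close>

definition num_states :: "nat \<Rightarrow> nat" where
  "num_states m = (let K = 2 ^ Suc m in 2 ^ Suc (enc K K K K K K))"

lemma set_encode_less: "A \<subseteq> {..<M} \<Longrightarrow> set_encode A < 2 ^ M"
proof -
  assume A: "A \<subseteq> {..<M}"
  have "set_encode A \<le> set_encode {..<M}"
    unfolding set_encode_def using A by (intro sum_mono2) auto
  also have "\<dots> < 2 ^ M"
    unfolding set_encode_def by (induction M) auto
  finally show ?thesis .
qed

lemma elem_num_states: "elem F \<Longrightarrow> elem (\<lambda>v. num_states (F v))"
  unfolding num_states_def Let_def by (intro elem_pow2 elem_Suc elem_enc)

section \<open>Effect of the operations on types\<close>

definition rename_label :: "nat \<Rightarrow> nat \<Rightarrow> nat \<Rightarrow> nat" where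
  "rename_label x y l = (if l = x then y else l)"

definition ins :: "nat \<Rightarrow> nat \<Rightarrow> nat" where
  "ins k p = set_encode (insert k (set_decode p))"

definition rename_set :: "nat \<Rightarrow> nat \<Rightarrow> nat \<Rightarrow> nat" where
  "rename_set x y p = set_encode (rename_label x y ` set_decode p)"

lemma elem_rename_label:
  "elem x \<Longrightarrow> elem y \<Longrightarrow> elem l \<Longrightarrow> elem (\<lambda>v. rename_label (x v) (y v) (l v))"
  unfolding rename_label_def by (intro elem_if elemP_eq)

lemma elem_ins: assumes "elem k" "elem p" shows "elem (\<lambda>v. ins (k v) (p v))"
proof -
  \<comment> \<open>The members of \<open>set_decode (p v)\<close> are smaller than
    \<open>p v\<close>, so \<open>Suc (k v + p v)\<close> exceeds all members of the new
    set.\<close>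
  have "elem (\<lambda>v. set_encode {y. y < Suc (k v + p v) \<and> (y = k v \<or> y \<in> set_decode (p v))})"
    using elem_rename[OF assms(1), of Suc] elem_rename[OF assms(2), of Suc] assms
    by (intro elem_set_encode_Collect elemP_disj elemP_eq elemP_member elem_Suc elem_add elem_var)
  moreover have "{y. y < Suc (k v + p v) \<and> (y = k v \<or> y \<in> set_decode (p v))} = insert (k v) (set_decode (p v))" for v
    by (auto dest: mem_set_decode_less)
  ultimately show ?thesis unfolding ins_def by simp
qed

lemma elem_rename_set:
  assumes "elem x" "elem y" "elem p" shows "elem (\<lambda>v. rename_set (x v) (y v) (p v))"
proof -
  have "elem (\<lambda>v. set_encode {k. k < Suc (y v + p v) \<and> (\<exists>l\<in>set_decode (p v). k = rename_label (x v) (y v) l)})"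
    using elem_rename[OF assms(1), of "\<lambda>j. Suc (Suc j)"] elem_rename[OF assms(2), of "\<lambda>j. Suc (Suc j)"]
      elem_rename[OF assms(3), of Suc] assms
    by (intro elem_set_encode_Collect elemP_bex elemP_eq elem_rename_label elem_Suc elem_add elem_var)
  moreover have "{k. k < Suc (y v + p v) \<and> (\<exists>l\<in>set_decode (p v). k = rename_label (x v) (y v) l)} =
      rename_label (x v) (y v) ` set_decode (p v)" for v
    by (auto dest: mem_set_decode_less simp: rename_label_def)
  ultimately show ?thesis unfolding rename_set_def by simp
qed

text \<open>\<open>u\<close> has at most two entries and \<open>w\<close> has one; no further test
  is needed, since entries are filled from the left.\<close>

definition joinable :: "nat \<Rightarrow> nat \<Rightarrow> bool" where
  "joinable u w \<longleftrightarrow> c3 u = 0 \<and> c2 w = 0"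

text \<open>The zeros in the last three places are empty sets: two points from different sides of a
  union have not been in a common structure before, so their pair carries no label yet.\<close>

definition join :: "nat \<Rightarrow> nat \<Rightarrow> nat" where
  "join u w = (if c2 u = 0 then enc (c1 u) (c1 w) 0 0 0 0 else enc (c1 u) (c2 u) (c1 w) (c4 u) 0 0)"

text \<open>Both orders are tested because \<open>p\<close> collects the labels of both directions.
  A missing entry has label 0 and never matches, as renamed labels are positive.\<close>

definition mark :: "nat \<Rightarrow> nat \<Rightarrow> nat \<Rightarrow> nat \<Rightarrow> nat \<Rightarrow> nat \<Rightarrow> nat" where
  "mark x y z l l' p = (if l = x \<and> l' = y \<or> l = y \<and> l' = x then ins z p else p)"

definition mark_type :: "nat \<Rightarrow> nat \<Rightarrow> nat \<Rightarrow> nat \<Rightarrow> nat" where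
  "mark_type x y z u = enc (c1 u) (c2 u) (c3 u) (mark x y z (c1 u) (c2 u) (c4 u))
     (mark x y z (c1 u) (c3 u) (c5 u)) (mark x y z (c2 u) (c3 u) (c6 u))"

text \<open>The three cases are the three choices of the point that is not in the labelled pair. The
  orientation of the added triples is irrelevant.\<close>

definition covered :: "nat \<Rightarrow> nat \<Rightarrow> nat \<Rightarrow> bool" where
  "covered i k u \<longleftrightarrow> c3 u = i \<and> k \<in> set_decode (c4 u) \<or> c2 u = i \<and> k \<in> set_decode (c5 u) \<or>
     c1 u = i \<and> k \<in> set_decode (c6 u)"

definition rename_unary :: "nat \<Rightarrow> nat \<Rightarrow> nat \<Rightarrow> nat" where
  "rename_unary x y u = enc (rename_label x y (c1 u)) (rename_label x y (c2 u)) (rename_label x y (c3 u))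
     (c4 u) (c5 u) (c6 u)"

definition rename_binary :: "nat \<Rightarrow> nat \<Rightarrow> nat \<Rightarrow> nat" where
  "rename_binary x y u = enc (c1 u) (c2 u) (c3 u)
     (rename_set x y (c4 u)) (rename_set x y (c5 u)) (rename_set x y (c6 u))"

text \<open>
  Here \<open>oc\<close> is the opcode of the operation. The additional opcode 0 leads to the state
  \<open>{0}\<close>, which is encoded as 1, from the states without triples, and to the empty state from all
  others. In the union a type of a point is recognized by the missing second entry. The states
  contain only types below \<open>S\<close>, so that the restriction in \<open>delta\<close> is harmless.
\<close>

definition trans_mem :: "nat \<Rightarrow> nat \<Rightarrow> nat \<Rightarrow> nat \<Rightarrow> nat \<Rightarrow> nat \<Rightarrow> nat \<Rightarrow> bool" where
  "trans_mem oc x y z s s' t \<longleftrightarrow>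
     oc = 0 \<and> t = 0 \<and> \<not> (\<exists>u\<in>set_decode s. c3 u \<noteq> 0) \<or>
     oc = 1 \<and> t = enc x 0 0 0 0 0 \<or>
     oc = 2 \<and> (t \<in> set_decode s \<or> t \<in> set_decode s' \<or>
       (\<exists>u\<in>set_decode s. \<exists>w\<in>set_decode s'. (joinable u w \<and> t = join u w) \<or> (joinable w u \<and> t = join w u))) \<or>
     oc = 3 \<and> (\<exists>u\<in>set_decode s. t = mark_type x y z u) \<or>
     (oc = 4 \<or> oc = 5) \<and> t \<in> set_decode s \<and> \<not> covered x y t \<or>
     oc = 6 \<and> (\<exists>u\<in>set_decode s. t = rename_unary x y u) \<or>
     oc = 7 \<and> (\<exists>u\<in>set_decode s. t = rename_binary x y u)"

definition delta :: "nat \<Rightarrow> nat \<Rightarrow> nat \<Rightarrow> nat \<Rightarrow> nat \<Rightarrow> nat \<Rightarrow> nat \<Rightarrow> nat" where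
  "delta oc x y z s s' S = set_encode {t. t < S \<and> trans_mem oc x y z s s' t}"

text \<open>The parameters of the operation and the number of states are variables as well, so that
  a single program serves all widths.\<close>

lemma elem_delta: "elem (\<lambda>v. delta (v 0) (v 1) (v 2) (v 3) (v 4) (v 5) (v 6))"
  unfolding delta_def trans_mem_def joinable_def join_def mark_type_def mark_def covered_def
    rename_unary_def rename_binary_def
  by (intro elem_set_encode_Collect elemP_disj elemP_conj elemP_eq elemP_not elemP_bex elemP_member
      elem_var elem_const elem_enc elem_if elem_comps elem_ins elem_rename_label elem_rename_set)

section \<open>Uncovered triples\<close>

text \<open>For a well-formed expression \<open>ulab\<close> is a function on the created points,
  and this is that function, with arbitrary values elsewhere.\<close>

primrec ulabel :: "'p cw_expr \<Rightarrow> 'p \<Rightarrow> nat" where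
  "ulabel (Create q i) p = i"
| "ulabel (Disjoint_Union e1 e2) p = (if p \<in> points (cw_eval e1) then ulabel e1 p else ulabel e2 p)"
| "ulabel (Label_Pairs i j k e) p = ulabel e p"
| "ulabel (Add_Triples i k e) p = ulabel e p"
| "ulabel (Add_Triples_Rev i k e) p = ulabel e p"
| "ulabel (Relabel_Points i j e) p = (if ulabel e p = i then j else ulabel e p)"
| "ulabel (Relabel_Pairs i j e) p = ulabel e p"

text \<open>The two directions are merged: covering the three points in either orientation makes
  them non-collinear.\<close>

definition plabels :: "'p cw_expr \<Rightarrow> 'p \<Rightarrow> 'p \<Rightarrow> nat set" where
  "plabels e a b = {k. ((a, b), k) \<in> blab (cw_eval e) \<or> ((b, a), k) \<in> blab (cw_eval e)}"

lemma finite_points: "finite (points (cw_eval e))"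
  by (induction e) (auto simp: Let_def)

lemma ulab_iff:
  "cw_wf e \<Longrightarrow> (p, i) \<in> ulab (cw_eval e) \<longleftrightarrow> p \<in> points (cw_eval e) \<and> ulabel e p = i"
proof (induction e arbitrary: i)
  case (Relabel_Points x y e)
  then show ?case by (auto simp: Let_def relabel_def image_iff Bex_def split: if_splits)
qed (auto simp: Let_def)

lemma ulabel_mem: "cw_wf e \<Longrightarrow> p \<in> points (cw_eval e) \<Longrightarrow> ulabel e p \<in> unary_labels e"
  by (induction e) (auto simp: Let_def)

lemma blab_subset:
  "cw_wf e \<Longrightarrow> ((a, b), k) \<in> blab (cw_eval e) \<Longrightarrow>
   a \<in> points (cw_eval e) \<and> b \<in> points (cw_eval e) \<and> k \<in> binary_labels e"
proof (induction e arbitrary: k)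
  case (Relabel_Pairs x y e)
  from Relabel_Pairs.prems(2) obtain l where "((a, b), l) \<in> blab (cw_eval e)" "k = (if l = x then y else l)"
    by (auto simp: Let_def relabel_def)
  with Relabel_Pairs show ?case by (auto simp: Let_def)
qed (auto simp: Let_def ulab_iff)

lemma plabels_subset: "cw_wf e \<Longrightarrow> plabels e a b \<subseteq> binary_labels e"
  unfolding plabels_def by (auto dest: blab_subset)

lemma finite_binary_labels: "finite (binary_labels e)"
  by (induction e) auto

lemma finite_unary_labels: "finite (unary_labels e)"
  by (induction e) auto

lemma plabels_outside:
  "cw_wf e \<Longrightarrow> a \<notin> points (cw_eval e) \<or> b \<notin> points (cw_eval e) \<Longrightarrow> plabels e a b = {}"
  unfolding plabels_def by (auto dest: blab_subset)

section \<open>Points, pairs and triples that are not yet covered\<close>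

type_synonym 'p otuple = "'p option \<times> 'p option \<times> 'p option"

text \<open>Extends a point or a pair of one side by a point of the other side. A triple that meets
  both sides has two points on one of them, so every such triple arises in this way.\<close>

definition join_tuples :: "'p otuple set \<Rightarrow> 'p otuple set \<Rightarrow> 'p otuple set" where
  "join_tuples A B = {if y = None then (x, z, None) else (x, y, z) | x y z.
     (x, y, None) \<in> A \<and> (z, None, None) \<in> B}"

definition tuple_covered :: "nat \<Rightarrow> nat \<Rightarrow> 'p cw_expr \<Rightarrow> 'p otuple \<Rightarrow> bool" where
  "tuple_covered i k e t \<longleftrightarrow> (\<exists>a b c. t = (Some a, Some b, Some c) \<and>
     (ulabel e c = i \<and> k \<in> plabels e a b \<or> ulabel e b = i \<and> k \<in> plabels e a c \<or>
      ulabel e a = i \<and> k \<in> plabels e b c))"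

text \<open>
  Single points, pairs and uncovered triples. Every pair occurs in both orders, but a triple need
  not occur in all of its orders.
\<close>

primrec tuples :: "'p cw_expr \<Rightarrow> 'p set \<Rightarrow> 'p otuple set" where
  "tuples (Create p i) Q = (if p \<in> Q then {(Some p, None, None)} else {})"
| "tuples (Disjoint_Union e1 e2) Q = tuples e1 Q \<union> tuples e2 Q \<union>
     join_tuples (tuples e1 Q) (tuples e2 Q) \<union> join_tuples (tuples e2 Q) (tuples e1 Q)"
| "tuples (Label_Pairs i j k e) Q = tuples e Q"
| "tuples (Add_Triples i k e) Q = {t \<in> tuples e Q. \<not> tuple_covered i k e t}"
| "tuples (Add_Triples_Rev i k e) Q = {t \<in> tuples e Q. \<not> tuple_covered i k e t}"
| "tuples (Relabel_Points i j e) Q = tuples e Q"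
| "tuples (Relabel_Pairs i j e) Q = tuples e Q"

definition distinct_tuple :: "'p set \<Rightarrow> 'p otuple \<Rightarrow> bool" where
  "distinct_tuple X t \<longleftrightarrow> (\<exists>a\<in>X. t = (Some a, None, None) \<or> (\<exists>b\<in>X. a \<noteq> b \<and>
     (t = (Some a, Some b, None) \<or> (\<exists>c\<in>X. a \<noteq> c \<and> b \<noteq> c \<and> t = (Some a, Some b, Some c)))))"

lemma distinct_tuple_mono: "distinct_tuple X t \<Longrightarrow> X \<subseteq> Y \<Longrightarrow> distinct_tuple Y t"
  unfolding distinct_tuple_def by blast

lemma distinct_tuple_join:
  assumes "\<And>t. t \<in> A \<Longrightarrow> distinct_tuple X t" "\<And>t. t \<in> B \<Longrightarrow> distinct_tuple Y t" "X \<inter> Y = {}"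
    and "t \<in> join_tuples A B"
  shows "distinct_tuple (X \<union> Y) t"
proof -
  obtain x y z where t: "t = (if y = None then (x, z, None) else (x, y, z))"
    and "(x, y, None) \<in> A" "(z, None, None) \<in> B"
    using assms(4) unfolding join_tuples_def by blast
  then have "distinct_tuple X (x, y, None)" "distinct_tuple Y (z, None, None)"
    using assms by blast+
  then show ?thesis using assms(3) unfolding t distinct_tuple_def by (auto split: if_splits)
qed

lemma tuples_distinct:
  "cw_wf e \<Longrightarrow> t \<in> tuples e Q \<Longrightarrow> distinct_tuple (Q \<inter> points (cw_eval e)) t"
proof (induction e arbitrary: t)
  case (Create p i)
  then show ?case by (auto simp: distinct_tuple_def split: if_splits)
next
  case (Disjoint_Union e1 e2)
  let ?X = "Q \<inter> points (cw_eval e1)" and ?Y = "Q \<inter> points (cw_eval e2)"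
  have disj: "?X \<inter> ?Y = {}" "?Y \<inter> ?X = {}" using Disjoint_Union.prems by auto
  have t1: "\<And>t. t \<in> tuples e1 Q \<Longrightarrow> distinct_tuple ?X t" and t2: "\<And>t. t \<in> tuples e2 Q \<Longrightarrow> distinct_tuple ?Y t"
    using Disjoint_Union by auto
  have eq: "Q \<inter> points (cw_eval (Disjoint_Union e1 e2)) = ?X \<union> ?Y" by (auto simp: Let_def)
  consider "t \<in> tuples e1 Q" | "t \<in> tuples e2 Q" | "t \<in> join_tuples (tuples e1 Q) (tuples e2 Q)"
    | "t \<in> join_tuples (tuples e2 Q) (tuples e1 Q)"
    using Disjoint_Union.prems(2) by auto
  then have "distinct_tuple (?X \<union> ?Y) t"
  proof cases
    case 1
    then show ?thesis by (rule distinct_tuple_mono[OF t1]) simp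
  next
    case 2
    then show ?thesis by (rule distinct_tuple_mono[OF t2]) simp
  next
    case 3
    from distinct_tuple_join[OF t1 t2 disj(1) 3] show ?thesis .
  next
    case 4
    from distinct_tuple_join[OF t2 t1 disj(2) 4] show ?thesis by (simp add: Un_commute)
  qed
  then show ?case unfolding eq .
qed (auto simp: Let_def)

text \<open>Lets the two parts of a subset of a union be chosen independently of each other.\<close>

lemma tuples_cong:
  "Q \<inter> points (cw_eval e) = Q' \<inter> points (cw_eval e) \<Longrightarrow> tuples e Q = tuples e Q'"
proof (induction e)
  case (Disjoint_Union e1 e2)
  have "tuples e1 Q = tuples e1 Q'" "tuples e2 Q = tuples e2 Q'"
    using Disjoint_Union.prems by (auto simp: Let_def intro!: Disjoint_Union.IH)
  then show ?case by simp
qed (auto simp: Let_def)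

text \<open>Needed for decoding a state, since \<open>set_encode\<close> is faithful on finite sets
  only.\<close>

lemma finite_tuples: "finite (tuples e Q)"
proof (induction e)
  case (Disjoint_Union e1 e2)
  have "finite (join_tuples A B)" if "finite A" "finite B" for A B :: "'a otuple set"
  proof (rule finite_subset)
    show "join_tuples A B \<subseteq> (\<lambda>((x, y, _), (z, _)). if y = None then (x, z, None) else (x, y, z)) ` (A \<times> B)"
      unfolding join_tuples_def by force
  qed (use that in auto)
  then show ?case using Disjoint_Union by simp
qed auto

lemma single_mem_tuples:
  "cw_wf e \<Longrightarrow> (Some a, None, None) \<in> tuples e Q \<longleftrightarrow> a \<in> Q \<inter> points (cw_eval e)"
proof (induction e)
  case (Disjoint_Union e1 e2)
  have "(Some a, None, None) \<notin> join_tuples (tuples d Q) (tuples d' Q)"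
    if "cw_wf d'" for d d' :: "'a cw_expr"
  proof
    assume "(Some a, None, None) \<in> join_tuples (tuples d Q) (tuples d' Q)"
    then have "(None, None, None) \<in> tuples d' Q" unfolding join_tuples_def by (auto split: if_splits)
    from tuples_distinct[OF that this] show False by (simp add: distinct_tuple_def)
  qed
  then show ?case using Disjoint_Union by (auto simp: Let_def)
qed (auto simp: Let_def tuple_covered_def)

lemma pair_mem_join_tuples:
  "(Some a, Some b, None) \<in> join_tuples A B \<longleftrightarrow> (Some a, None, None) \<in> A \<and> (Some b, None, None) \<in> B \<or>
    (Some a, Some b, None) \<in> A \<and> (None, None, None) \<in> B"
  unfolding join_tuples_def by (auto split: if_splits)

lemma empty_notin_tuples: "cw_wf e \<Longrightarrow> (None, x, y) \<notin> tuples e Q"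
  using tuples_distinct[of e "(None, x, y)" Q] by (auto simp: distinct_tuple_def)

text \<open>Only triples are ever removed, and a union joins in both directions; so all pairs are
  present, in both orders.\<close>

lemma pair_mem_tuples:
  "cw_wf e \<Longrightarrow> (Some a, Some b, None) \<in> tuples e Q \<longleftrightarrow> a \<noteq> b \<and> {a, b} \<subseteq> Q \<inter> points (cw_eval e)"
proof (induction e)
  case (Disjoint_Union e1 e2)
  then show ?case
    by (auto simp: Let_def pair_mem_join_tuples single_mem_tuples empty_notin_tuples)
qed (auto simp: Let_def tuple_covered_def)

lemma triple_mem_join_tuples:
  "(Some a, Some b, Some c) \<in> join_tuples A B \<longleftrightarrow> (Some a, Some b, None) \<in> A \<and> (Some c, None, None) \<in> B"
  unfolding join_tuples_def by (auto split: if_splits)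

definition triple_sets :: "'p cw_expr \<Rightarrow> 'p set set" where
  "triple_sets e = (\<lambda>(a, b, c). {a, b, c}) ` triples (cw_eval e)"

definition new_triple_sets :: "nat \<Rightarrow> nat \<Rightarrow> 'p cw_expr \<Rightarrow> 'p set set" where
  "new_triple_sets i k e = (\<lambda>(a, b, c). {a, b, c}) ` selected i k (cw_eval e)"

text \<open>On unordered triples the cyclic closures of \<open>(a, b, c)\<close> and
  \<open>(b, a, c)\<close> collapse to the same single set.\<close>

lemma triple_sets_Add:
  "triple_sets (Add_Triples i k e) = triple_sets e \<union> new_triple_sets i k e"
  "triple_sets (Add_Triples_Rev i k e) = triple_sets e \<union> new_triple_sets i k e"
proof -
  let ?f = "\<lambda>(a, b, c). {a, b, c}"
  have "?f ` (case x of (a, b, c) \<Rightarrow> cyc a b c) = {?f x}"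
    "?f ` (case x of (a, b, c) \<Rightarrow> cyc b a c) = {?f x}" for x :: "'a \<times> 'a \<times> 'a"
    by (cases x; simp add: cyc_def insert_commute)+
  then show "triple_sets (Add_Triples i k e) = triple_sets e \<union> new_triple_sets i k e"
    "triple_sets (Add_Triples_Rev i k e) = triple_sets e \<union> new_triple_sets i k e"
    unfolding triple_sets_def new_triple_sets_def
    by (simp_all add: Let_def image_Un image_UN UNION_singleton_eq_range)
qed

text \<open>The selected triple may be any ordering of the three points. Up to the direction of the
  pair, only the choice of the third point matters, which gives the three cases of
  \<open>tuple_covered\<close>.\<close>

lemma new_triple_sets_iff:
  assumes "cw_wf e" "a \<noteq> b" "b \<noteq> c" "a \<noteq> c" "{a, b, c} \<subseteq> points (cw_eval e)"
  shows "{a, b, c} \<in> new_triple_sets i k e \<longleftrightarrow> tuple_covered i k e (Some a, Some b, Some c)"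
proof
  assume "{a, b, c} \<in> new_triple_sets i k e"
  then obtain x y z where "(x, y, z) \<in> selected i k (cw_eval e)" and eq: "{a, b, c} = {x, y, z}"
    unfolding new_triple_sets_def by auto
  then have xyz: "x \<noteq> y" "y \<noteq> z" "x \<noteq> z" "ulabel e z = i" "k \<in> plabels e x y"
    using assms(1) unfolding selected_def plabels_def by (auto simp: ulab_iff)
  have sym: "k \<in> plabels e y x" using xyz(5) unfolding plabels_def by blast
  have "z = a \<or> z = b \<or> z = c" using eq by blast
  moreover have "x \<in> {a, b, c}" "y \<in> {a, b, c}" using eq by blast+
  ultimately show "tuple_covered i k e (Some a, Some b, Some c)"
    using xyz sym assms(2-4) unfolding tuple_covered_def by auto
next
  assume cov: "tuple_covered i k e (Some a, Some b, Some c)"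
  have *: "{x, y, z} \<in> new_triple_sets i k e"
    if "x \<noteq> y" "y \<noteq> z" "x \<noteq> z" "z \<in> points (cw_eval e)" "ulabel e z = i" "k \<in> plabels e x y" for x y z
  proof -
    have "(x, y, z) \<in> selected i k (cw_eval e) \<or> (y, x, z) \<in> selected i k (cw_eval e)"
      using that assms(1) unfolding selected_def plabels_def by (auto simp: ulab_iff)
    moreover have "{x, y, z} = {y, x, z}" by auto
    ultimately show ?thesis unfolding new_triple_sets_def by (force simp: image_iff)
  qed
  have perm: "{a, c, b} = {a, b, c}" "{b, c, a} = {a, b, c}" by auto
  show "{a, b, c} \<in> new_triple_sets i k e"
    using cov *[of a b c] *[of a c b] *[of b c a] assms(2-5) unfolding tuple_covered_def perm by auto
qed

lemma triples_subset:
  "cw_wf e \<Longrightarrow> (a, b, c) \<in> triples (cw_eval e) \<Longrightarrow> {a, b, c} \<subseteq> points (cw_eval e)"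
proof (induction e)
  case (Add_Triples i k e)
  then show ?case
    by (auto simp: Let_def cyc_def selected_def ulab_iff dest: blab_subset[rotated])
next
  case (Add_Triples_Rev i k e)
  then show ?case
    by (auto simp: Let_def cyc_def selected_def ulab_iff dest: blab_subset[rotated])
qed (auto simp: Let_def)

lemma triple_sets_subset: "cw_wf e \<Longrightarrow> X \<in> triple_sets e \<Longrightarrow> X \<subseteq> points (cw_eval e) \<and> X \<noteq> {}"
  unfolding triple_sets_def by (auto dest: triples_subset)

lemma card_3_distinct: "card {a, b, c} = 3 \<longleftrightarrow> a \<noteq> b \<and> b \<noteq> c \<and> a \<noteq> c"
  by (auto simp: card_insert_if)

definition uncovered :: "'p cw_expr \<Rightarrow> 'p set \<Rightarrow> 'p set set" where
  "uncovered e Q = {{a, b, c} | a b c. (Some a, Some b, Some c) \<in> tuples e Q}"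

text \<open>A triple may be stored in several orders. Whether it is covered depends on its set of
  points only, so all these orders disappear together.\<close>

lemma uncovered_Add:
  assumes "cw_wf e" and t: "tuples e' Q = {t \<in> tuples e Q. \<not> tuple_covered i k e t}"
  shows "uncovered e' Q = uncovered e Q - new_triple_sets i k e"
proof -
  have *: "{a, b, c} \<in> new_triple_sets i k e \<longleftrightarrow> tuple_covered i k e (Some a, Some b, Some c)"
    if "(Some a, Some b, Some c) \<in> tuples e Q" for a b c
    using tuples_distinct[OF assms(1) that]
    by (intro new_triple_sets_iff assms) (auto simp: distinct_tuple_def)
  show ?thesis
    unfolding uncovered_def t using * by blast
qed

lemma uncovered_Union:
  assumes "cw_wf (Disjoint_Union e1 e2)"
  shows "uncovered (Disjoint_Union e1 e2) Q = uncovered e1 Q \<union> uncovered e2 Q \<union>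
    {{a, b, c} | a b c. a \<noteq> b \<and> {a, b, c} \<subseteq> Q \<and>
      ({a, b} \<subseteq> points (cw_eval e1) \<and> c \<in> points (cw_eval e2) \<or>
       {a, b} \<subseteq> points (cw_eval e2) \<and> c \<in> points (cw_eval e1))}"
  using assms unfolding uncovered_def
  by (simp add: triple_mem_join_tuples single_mem_tuples pair_mem_tuples) blast

lemma card_3_split:
  assumes "card X = 3" "X \<subseteq> A \<union> B" "A \<inter> B = {}" "\<not> X \<subseteq> A" "\<not> X \<subseteq> B"
  shows "\<exists>a b c. X = {a, b, c} \<and> a \<noteq> b \<and> ({a, b} \<subseteq> A \<and> c \<in> B \<or> {a, b} \<subseteq> B \<and> c \<in> A)"
proof -
  obtain a b c where X: "X = {a, b, c}" and ne: "a \<noteq> b" "b \<noteq> c" "a \<noteq> c"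
    using assms(1) by (auto simp: card_3_iff)
  have "X = {a, c, b}" "X = {b, c, a}" using X by auto
  with assms(2-) ne show ?thesis unfolding X
    by (smt (verit, best) insert_subset empty_subsetI insert_commute Un_iff)
qed

text \<open>Correctness of the recursion for \<open>tuples\<close>: what it retains are exactly the
  triples added in neither orientation so far. In a union, the triples inside one side are
  inherited, and those meeting both sides cannot have been added yet.\<close>

lemma uncovered_eq:
  "cw_wf e \<Longrightarrow> uncovered e Q = {X. card X = 3 \<and> X \<subseteq> Q \<inter> points (cw_eval e)} - triple_sets e"
proof (induction e)
  case (Create p i)
  have c1: "card X \<le> 1" if "X \<subseteq> Q \<inter> {p}" for X
    using card_mono[of "{p}" X] that by auto
  have "card X \<noteq> 3" if "X \<subseteq> Q \<inter> {p}" for X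
    using that[THEN c1] by simp
  then show ?case by (auto simp: uncovered_def)
next
  case (Disjoint_Union e1 e2)
  let ?A = "points (cw_eval e1)" and ?B = "points (cw_eval e2)"
  have wf: "cw_wf e1" "cw_wf e2" and disj: "?A \<inter> ?B = {}" using Disjoint_Union.prems by auto
  note IH = Disjoint_Union.IH(1)[OF wf(1)] Disjoint_Union.IH(2)[OF wf(2)]
  note sub = triple_sets_subset[OF wf(1)] triple_sets_subset[OF wf(2)]
  have ts: "triple_sets (Disjoint_Union e1 e2) = triple_sets e1 \<union> triple_sets e2"
    unfolding triple_sets_def by (auto simp: Let_def)
  have pts: "points (cw_eval (Disjoint_Union e1 e2)) = ?A \<union> ?B" by (simp add: Let_def)
  show ?case unfolding uncovered_Union[OF Disjoint_Union.prems] IH ts pts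
  proof (intro equalityI subsetI, goal_cases)
    case (1 X)
    then consider "X \<in> {X. card X = 3 \<and> X \<subseteq> Q \<inter> ?A} - triple_sets e1"
      | "X \<in> {X. card X = 3 \<and> X \<subseteq> Q \<inter> ?B} - triple_sets e2"
      | a b c where "X = {a, b, c}" "a \<noteq> b" "{a, b, c} \<subseteq> Q"
        "{a, b} \<subseteq> ?A \<and> c \<in> ?B \<or> {a, b} \<subseteq> ?B \<and> c \<in> ?A"
      by blast
    then show ?case
    proof cases
      case 1
      then have "X \<noteq> {}" by auto
      \<comment> \<open>The triples added on the other side are nonempty sets of points of that
        side, which is disjoint from \<open>X\<close>.\<close>
      then have "X \<notin> triple_sets e2" using sub(2)[of X] 1 disj by blast
      then show ?thesis using 1 by blast
    next
      case 2
      then have "X \<noteq> {}" by auto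
      then have "X \<notin> triple_sets e1" using sub(1)[of X] 2 disj by blast
      then show ?thesis using 2 by blast
    next
      case 3
      then have "X \<notin> triple_sets e1" "X \<notin> triple_sets e2"
        using sub[of X] disj by blast+
      moreover have "b \<noteq> c" "a \<noteq> c" using 3(4) disj by auto
      ultimately show ?thesis using 3 card_3_distinct by auto
    qed
  next
    case (2 X)
    then have X: "card X = 3" "X \<subseteq> Q" "X \<subseteq> ?A \<union> ?B" "X \<notin> triple_sets e1" "X \<notin> triple_sets e2" by auto
    show ?case
    proof (cases "X \<subseteq> ?A \<or> X \<subseteq> ?B")
      case True
      then show ?thesis using X by blast
    next
      case False
      with card_3_split[OF X(1,3) disj] X(2) show ?thesis by blast
    qed
  qed
next
  case (Label_Pairs i j k e)
  then show ?case by (simp add: uncovered_def triple_sets_def Let_def)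
next
  case (Add_Triples i k e)
  have "uncovered (Add_Triples i k e) Q = uncovered e Q - new_triple_sets i k e"
    using Add_Triples.prems by (intro uncovered_Add) auto
  with Add_Triples show ?case by (auto simp: triple_sets_Add Let_def)
next
  case (Add_Triples_Rev i k e)
  have "uncovered (Add_Triples_Rev i k e) Q = uncovered e Q - new_triple_sets i k e"
    using Add_Triples_Rev.prems by (intro uncovered_Add) auto
  with Add_Triples_Rev show ?case by (auto simp: triple_sets_Add Let_def)
next
  case (Relabel_Points i j e)
  then show ?case by (simp add: uncovered_def triple_sets_def Let_def)
next
  case (Relabel_Pairs i j e)
  then show ?case by (simp add: uncovered_def triple_sets_def Let_def)
qed

text \<open>\<open>?D\<close> is twice the signed area of the triangle. It vanishes iff the points
  are collinear, and exchanging \<open>a\<close> and \<open>b\<close> changes its sign.\<close>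

lemma collinear_iff_ccw:
  fixes a b c :: point
  shows "collinear {a, b, c} \<longleftrightarrow> \<not> ccw a b c \<and> \<not> ccw b a c"
proof -
  let ?D = "(b $ 1 - a $ 1) * (c $ 2 - a $ 2) - (b $ 2 - a $ 2) * (c $ 1 - a $ 1)"
  have "collinear {a, b, c} \<longleftrightarrow> collinear {0, b - a, c - a}"
  proof -
    have "{a, b, c} = {b, a, c}" by auto
    then show ?thesis using collinear_3[of b a c] by simp
  qed
  also have "\<dots> \<longleftrightarrow> ?D = 0"
  proof
    assume "collinear {0, b - a, c - a}"
    then consider "b = a" | "c = a" | r where "c - a = r *\<^sub>R (b - a)"
      unfolding collinear_lemma by auto
    then show "?D = 0"
    proof cases
      case 3
      then have "c $ 1 - a $ 1 = r * (b $ 1 - a $ 1)" "c $ 2 - a $ 2 = r * (b $ 2 - a $ 2)"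
        by (metis vector_minus_component vector_scaleR_component real_scaleR_def)+
      then show ?thesis by simp
    qed auto
  next
    assume D: "?D = 0"
    show "collinear {0, b - a, c - a}"
    proof (cases "b = a")
      case False
      then have ne: "b $ 1 - a $ 1 \<noteq> 0 \<or> b $ 2 - a $ 2 \<noteq> 0" by (auto simp: vec_eq_iff forall_2)
      have aux: "w = z / x * y" if "x \<noteq> 0" "x * w = y * z" for w x y z :: real
        using that by (simp add: field_simps)
      \<comment> \<open>The scalar is the quotient of the coordinates of \<open>c - a\<close> and
        \<open>b - a\<close> in a direction where \<open>b - a\<close> does not vanish;
        \<open>?D = 0\<close> makes it right in the other direction.\<close>
      from ne have "\<exists>r. c - a = r *\<^sub>R (b - a)"
      proof
        assume n: "b $ 1 - a $ 1 \<noteq> 0"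
        have "c $ 2 - a $ 2 = (c $ 1 - a $ 1) / (b $ 1 - a $ 1) * (b $ 2 - a $ 2)"
          using D n by (intro aux) (simp_all add: mult.commute)
        then have "c - a = ((c $ 1 - a $ 1) / (b $ 1 - a $ 1)) *\<^sub>R (b - a)"
          using n by (simp add: vec_eq_iff forall_2)
        then show ?thesis ..
      next
        assume n: "b $ 2 - a $ 2 \<noteq> 0"
        have "c $ 1 - a $ 1 = (c $ 2 - a $ 2) / (b $ 2 - a $ 2) * (b $ 1 - a $ 1)"
          using D n by (intro aux) (simp_all add: mult.commute)
        then have "c - a = ((c $ 2 - a $ 2) / (b $ 2 - a $ 2)) *\<^sub>R (b - a)"
          using n by (simp add: vec_eq_iff forall_2)
        then show ?thesis ..
      qed
      then show ?thesis unfolding collinear_lemma by blast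
    qed (simp add: collinear_lemma)
  qed
  also have "\<dots> \<longleftrightarrow> \<not> ccw a b c \<and> \<not> ccw b a c"
  proof -
    have "ccw b a c \<longleftrightarrow> ?D < 0" unfolding ccw_def by (simp add: algebra_simps)
    then show ?thesis unfolding ccw_def by linarith
  qed
  finally show ?thesis .
qed

text \<open>Here the hypothesis on the value enters: a non-collinear triple occurs in the order type
  in one of its two orientations, so the triples that stay uncovered are the collinear ones.\<close>

lemma general_position_iff_uncovered:
  assumes "cw_wf e" "cw_value e = (P, order_type P)" "Q \<subseteq> P"
  shows "general_position Q \<longleftrightarrow> uncovered e Q = {}"
proof -
  have pts: "points (cw_eval e) = P" and trs: "triples (cw_eval e) = order_type P"
    using assms(2) by (auto simp: cw_value_def)
  have mem: "{a, b, c} \<in> triple_sets e \<longleftrightarrow> \<not> collinear {a, b, c}"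
    if "{a, b, c} \<subseteq> P" "a \<noteq> b" "b \<noteq> c" "a \<noteq> c" for a b c
  proof
    assume "{a, b, c} \<in> triple_sets e"
    then obtain x y z where "{a, b, c} = {x, y, z}" "ccw x y z"
      unfolding triple_sets_def trs order_type_def by auto
    then show "\<not> collinear {a, b, c}" using collinear_iff_ccw[of x y z] by simp
  next
    assume "\<not> collinear {a, b, c}"
    then have "(a, b, c) \<in> triples (cw_eval e) \<or> (b, a, c) \<in> triples (cw_eval e)"
      using that unfolding trs order_type_def collinear_iff_ccw by auto
    moreover have "{a, b, c} = {b, a, c}" by auto
    ultimately show "{a, b, c} \<in> triple_sets e" unfolding triple_sets_def by (force simp: image_iff)
  qed
  have "uncovered e Q = {X. card X = 3 \<and> X \<subseteq> Q} - triple_sets e"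
    unfolding uncovered_eq[OF assms(1)] pts using assms(3) by auto
  also have "\<dots> = {} \<longleftrightarrow> (\<forall>a b c. {a, b, c} \<subseteq> Q \<and> a \<noteq> b \<and> b \<noteq> c \<and> a \<noteq> c \<longrightarrow> {a, b, c} \<in> triple_sets e)"
    by (auto simp: card_3_iff)
  also have "\<dots> \<longleftrightarrow> general_position Q"
    unfolding general_position_def using mem assms(3) by (auto simp: subset_iff)
  finally show ?thesis by blast
qed

section \<open>States of subsets\<close>

text \<open>\<open>g\<close> is the renaming found by the first pass. Positivity frees 0 for missing
  entries, and the bound \<open>m\<close> makes the number of types depend on the number of labels
  only. Unary and binary labels share one numbering, which is harmless because they are stored in
  different components of a type.\<close>

locale compact_labels =
  fixes g :: "nat \<Rightarrow> nat" and m :: nat and L :: "nat set"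
  assumes inj: "inj_on g L" and pos: "l \<in> L \<Longrightarrow> 0 < g l" and le: "l \<in> L \<Longrightarrow> g l \<le> m"
begin

abbreviation S :: nat where "S \<equiv> num_states m"

definition olab :: "'p cw_expr \<Rightarrow> 'p option \<Rightarrow> nat" where
  "olab e x = (case x of None \<Rightarrow> 0 | Some p \<Rightarrow> g (ulabel e p))"

definition oset :: "'p cw_expr \<Rightarrow> 'p option \<Rightarrow> 'p option \<Rightarrow> nat" where
  "oset e x y = (case (x, y) of (Some a, Some b) \<Rightarrow> set_encode (g ` plabels e a b) | _ \<Rightarrow> 0)"

definition ty :: "'p cw_expr \<Rightarrow> 'p otuple \<Rightarrow> nat" where
  "ty e t = (case t of (x, y, z) \<Rightarrow>
     enc (olab e x) (olab e y) (olab e z) (oset e x y) (oset e x z) (oset e y z))"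

definition state :: "'p cw_expr \<Rightarrow> 'p set \<Rightarrow> nat" where
  "state e Q = set_encode (ty e ` tuples e Q)"

definition valid :: "'p cw_expr \<Rightarrow> bool" where
  "valid e \<longleftrightarrow> cw_wf e \<and> unary_labels e \<union> binary_labels e \<subseteq> L"

lemma olab_simps [simp]: "olab e None = 0" "olab e (Some p) = g (ulabel e p)"
  by (simp_all add: olab_def)

lemma oset_simps [simp]: "oset e None y = 0" "oset e x None = 0"
  "oset e (Some a) (Some b) = set_encode (g ` plabels e a b)"
  by (simp_all add: oset_def split: option.split)

lemma ty_simp [simp]:
  "ty e (x, y, z) = enc (olab e x) (olab e y) (olab e z) (oset e x y) (oset e x z) (oset e y z)"
  by (simp add: ty_def)

lemma inj_iff: "l \<in> L \<Longrightarrow> l' \<in> L \<Longrightarrow> g l = g l' \<longleftrightarrow> l = l'"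
  using inj by (auto dest: inj_onD)

lemma ulabel_L: "valid e \<Longrightarrow> p \<in> points (cw_eval e) \<Longrightarrow> ulabel e p \<in> L"
  unfolding valid_def by (blast dest: ulabel_mem)

lemma plabels_L: "valid e \<Longrightarrow> plabels e a b \<subseteq> L"
  unfolding valid_def by (elim conjE, rule order_trans[OF plabels_subset]) auto

lemma finite_plabels: "valid e \<Longrightarrow> finite (plabels e a b)"
  unfolding valid_def by (elim conjE, rule finite_subset[OF plabels_subset finite_binary_labels])

lemma mem_g_image: "k \<in> L \<Longrightarrow> valid e \<Longrightarrow> g k \<in> g ` plabels e a b \<longleftrightarrow> k \<in> plabels e a b"
  by (rule inj_on_image_mem_iff[OF inj _ plabels_L])

lemma valid_distinct: "valid e \<Longrightarrow> t \<in> tuples e Q \<Longrightarrow> distinct_tuple (Q \<inter> points (cw_eval e)) t"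
  unfolding valid_def by (elim conjE, rule tuples_distinct)

lemma oset_le:
  assumes "valid e" shows "oset e x y < 2 ^ Suc m"
proof (cases "\<exists>a b. x = Some a \<and> y = Some b")
  case True
  then obtain a b where "x = Some a" "y = Some b" by blast
  moreover have "g ` plabels e a b \<subseteq> {..<Suc m}"
    using plabels_L[OF assms, of a b] le by (auto simp: less_Suc_eq_le)
  from set_encode_less[OF this] calculation show ?thesis by (simp only: oset_simps)
next
  case False
  then have "oset e x y = 0" by (cases x; cases y) auto
  then show ?thesis by simp
qed

lemma ty_le:
  assumes "valid e" "t \<in> tuples e Q"
  shows "ty e t \<le> enc (2 ^ Suc m) (2 ^ Suc m) (2 ^ Suc m) (2 ^ Suc m) (2 ^ Suc m) (2 ^ Suc m)"
proof -
  have lab: "g (ulabel e x) \<le> 2 ^ Suc m" if "x \<in> points (cw_eval e)" for x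
    using le[OF ulabel_L[OF assms(1) that]] less_exp[of "Suc m"] by linarith
  obtain x y z where t: "t = (x, y, z)" by (cases t)
  have "olab e x \<le> 2 ^ Suc m" "olab e y \<le> 2 ^ Suc m" "olab e z \<le> 2 ^ Suc m"
    using valid_distinct[OF assms] lab unfolding t distinct_tuple_def
    by (auto simp del: power_Suc)
  then show ?thesis
    unfolding t ty_simp by (intro enc_mono less_imp_le[OF oset_le[OF assms(1)]])
qed

lemma ty_less:
  assumes "valid e" "t \<in> tuples e Q" shows "ty e t < S"
  unfolding num_states_def Let_def
  by (rule less_trans[OF le_imp_less_Suc[OF ty_le[OF assms]] less_exp])

lemma set_decode_state: "set_decode (state e Q) = ty e ` tuples e Q"
  unfolding state_def by (intro set_encode_inverse finite_imageI finite_tuples)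

lemma state_less:
  assumes "valid e" shows "state e Q < S"
  unfolding num_states_def Let_def state_def
  by (intro set_encode_less image_subsetI lessThan_iff[THEN iffD2] le_imp_less_Suc ty_le[OF assms])

lemma delta_eq_state:
  assumes "valid e" and "\<And>t. trans_mem oc x y z s s' t \<longleftrightarrow> t \<in> ty e ` tuples e Q"
  shows "delta oc x y z s s' S = state e Q"
  unfolding delta_def state_def using assms ty_less by (intro arg_cong[of _ _ set_encode]) auto

text \<open>For operations that keep the tuples and only change their types, by a function
  \<open>h\<close> of the old type.\<close>

lemma delta_image:
  assumes "valid e'" and "tuples e' Q = tuples e Q"
    and "\<And>t. t \<in> tuples e Q \<Longrightarrow> ty e' t = h (ty e t)"
    and "\<And>t. trans_mem oc x y z (state e Q) s' t \<longleftrightarrow> (\<exists>u\<in>set_decode (state e Q). t = h u)"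
  shows "delta oc x y z (state e Q) s' S = state e' Q"
  using assms by (intro delta_eq_state) (auto simp: set_decode_state image_iff)

section \<open>One transition of the automaton for each operation\<close>

lemma delta_Create:
  assumes "valid (Create p i)" "p \<in> Q"
  shows "delta 1 (g i) y z s s' S = state (Create p i) Q"
  using assms by (intro delta_eq_state) (auto simp: trans_mem_def)

text \<open>A present entry never has label 0, so the number of entries of a tuple can be read off
  its type.\<close>

lemma g_ulabel_zero: "valid e \<Longrightarrow> p \<in> points (cw_eval e) \<Longrightarrow> (g (ulabel e p) = 0) = False"
  using pos[OF ulabel_L] by simp

lemma third_zero_iff:
  "valid e \<Longrightarrow> (x, y, z) \<in> tuples e Q \<Longrightarrow> c3 (ty e (x, y, z)) = 0 \<longleftrightarrow> z = None"
  using valid_distinct[of e "(x, y, z)" Q]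
  by (auto simp: distinct_tuple_def g_ulabel_zero)

lemma second_zero_iff:
  "valid e \<Longrightarrow> (x, y, z) \<in> tuples e Q \<Longrightarrow> c2 (ty e (x, y, z)) = 0 \<longleftrightarrow> y = None \<and> z = None"
  using valid_distinct[of e "(x, y, z)" Q]
  by (auto simp: distinct_tuple_def g_ulabel_zero)

text \<open>\<open>cross\<close> justifies the empty label sets that \<open>join\<close> inserts;
  \<open>1\<close> and \<open>2\<close> say that a union does not change the types inside its
  sides.\<close>

lemma join_types:
  assumes "valid e1" "valid e2"
    and 1: "\<And>x y z. (x, y, z) \<in> tuples e1 Q \<Longrightarrow> ty e (x, y, z) = ty e1 (x, y, z)"
    and 2: "\<And>x y z. (x, y, z) \<in> tuples e2 Q \<Longrightarrow> ty e (x, y, z) = ty e2 (x, y, z)"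
    and cross: "\<And>a b. a \<in> points (cw_eval e1) \<Longrightarrow> b \<in> points (cw_eval e2) \<Longrightarrow> plabels e a b = {}"
  shows "ty e ` join_tuples (tuples e1 Q) (tuples e2 Q) =
    {join u w | u w. u \<in> ty e1 ` tuples e1 Q \<and> w \<in> ty e2 ` tuples e2 Q \<and> joinable u w}"
proof -
  have key: "join (ty e1 (x, y, None)) (ty e2 (z, None, None)) =
      ty e (if y = None then (x, z, None) else (x, y, z))"
    if t: "(x, y, None) \<in> tuples e1 Q" "(z, None, None) \<in> tuples e2 Q" for x y z
  proof -
    have d: "distinct_tuple (Q \<inter> points (cw_eval e1)) (x, y, None)"
      "distinct_tuple (Q \<inter> points (cw_eval e2)) (z, None, None)"
      using valid_distinct assms(1,2) t by blast+
    have y: "c2 (ty e1 (x, y, None)) = 0 \<longleftrightarrow> y = None" using second_zero_iff[OF assms(1) t(1)] by simp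
    have l: "olab e x = olab e1 x" "olab e y = olab e1 y" "oset e x y = oset e1 x y" "olab e z = olab e2 z"
      using 1[OF t(1)] 2[OF t(2)] unfolding ty_simp by (metis comps_enc)+
    have "oset e x z = 0" "oset e y z = 0"
      using d cross unfolding distinct_tuple_def by auto
    then show ?thesis using y l unfolding join_def by auto
  qed
  show ?thesis
  proof (intro equalityI subsetI)
    fix t assume "t \<in> ty e ` join_tuples (tuples e1 Q) (tuples e2 Q)"
    then obtain x y z where t: "t = ty e (if y = None then (x, z, None) else (x, y, z))"
      and xyz: "(x, y, None) \<in> tuples e1 Q" "(z, None, None) \<in> tuples e2 Q"
      unfolding join_tuples_def by blast
    then have "t = join (ty e1 (x, y, None)) (ty e2 (z, None, None))" using key by simp
    moreover have "joinable (ty e1 (x, y, None)) (ty e2 (z, None, None))" by (simp add: joinable_def)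
    ultimately show "t \<in> {join u w | u w. u \<in> ty e1 ` tuples e1 Q \<and> w \<in> ty e2 ` tuples e2 Q \<and> joinable u w}"
      using xyz by blast
  next
    fix t assume "t \<in> {join u w | u w. u \<in> ty e1 ` tuples e1 Q \<and> w \<in> ty e2 ` tuples e2 Q \<and> joinable u w}"
    then obtain x y z x' y' z' where t: "t = join (ty e1 (x, y, z)) (ty e2 (x', y', z'))"
      and mem: "(x, y, z) \<in> tuples e1 Q" "(x', y', z') \<in> tuples e2 Q"
      and j: "joinable (ty e1 (x, y, z)) (ty e2 (x', y', z'))"
      by auto
    have none: "z = None" "y' = None" "z' = None"
      using j third_zero_iff[OF assms(1) mem(1)] second_zero_iff[OF assms(2) mem(2)]
      unfolding joinable_def by auto
    have "t = ty e (if y = None then (x, x', None) else (x, y, x'))"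
      using t mem key unfolding none by simp
    moreover have "(if y = None then (x, x', None) else (x, y, x')) \<in> join_tuples (tuples e1 Q) (tuples e2 Q)"
      using mem unfolding none join_tuples_def by blast
    ultimately show "t \<in> ty e ` join_tuples (tuples e1 Q) (tuples e2 Q)" by blast
  qed
qed

lemma trans_mem_Union:
  "trans_mem 2 x y z s s' t \<longleftrightarrow> t \<in> set_decode s \<union> set_decode s' \<union>
     {join u w | u w. u \<in> set_decode s \<and> w \<in> set_decode s' \<and> joinable u w} \<union>
     {join u w | u w. u \<in> set_decode s' \<and> w \<in> set_decode s \<and> joinable u w}"
proof -
  have "trans_mem 2 x y z s s' t \<longleftrightarrow> t \<in> set_decode s \<or> t \<in> set_decode s' \<or>
    (\<exists>u\<in>set_decode s. \<exists>w\<in>set_decode s'. (joinable u w \<and> t = join u w) \<or> (joinable w u \<and> t = join w u))"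
    by (simp add: trans_mem_def)
  then show ?thesis by blast
qed

lemma delta_Union:
  assumes "valid (Disjoint_Union e1 e2)"
  shows "delta 2 x y z (state e1 Q) (state e2 Q) S = state (Disjoint_Union e1 e2) Q"
proof (rule delta_eq_state[OF assms])
  let ?e = "Disjoint_Union e1 e2"
  have v: "valid e1" "valid e2" using assms by (auto simp: valid_def)
  have wf: "cw_wf e1" "cw_wf e2" using v by (auto simp: valid_def)
  have disj: "points (cw_eval e1) \<inter> points (cw_eval e2) = {}" using assms by (simp add: valid_def)
  have pl: "plabels ?e a b = plabels e1 a b \<union> plabels e2 a b" for a b
    by (auto simp: plabels_def Let_def)
  have p1: "plabels ?e a b = plabels e1 a b" if "a \<in> points (cw_eval e1)" for a b
    using plabels_outside[OF wf(2), of a b] that disj unfolding pl by auto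
  have p2: "plabels ?e a b = plabels e2 a b" if "a \<in> points (cw_eval e2)" for a b
    using plabels_outside[OF wf(1), of a b] that disj unfolding pl by auto
  have cross: "plabels ?e a b = {}" if "a \<in> points (cw_eval e1)" "b \<in> points (cw_eval e2)" for a b
    using plabels_outside[OF wf(1), of a b] that disj unfolding p1[OF that(1)] by auto
  have cross': "plabels ?e a b = {}" if "a \<in> points (cw_eval e2)" "b \<in> points (cw_eval e1)" for a b
    using plabels_outside[OF wf(2), of a b] that disj unfolding p2[OF that(1)] by auto
  have u2: "ulabel ?e a = ulabel e2 a" if "a \<in> points (cw_eval e2)" for a
    using that disj by auto
  have t1: "ty ?e (x, y, z) = ty e1 (x, y, z)" if "(x, y, z) \<in> tuples e1 Q" for x y z
    using valid_distinct[OF v(1) that] p1 unfolding distinct_tuple_def by auto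
  have t2: "ty ?e (x, y, z) = ty e2 (x, y, z)" if "(x, y, z) \<in> tuples e2 Q" for x y z
    using valid_distinct[OF v(2) that] p2 u2 unfolding distinct_tuple_def
    by (auto simp del: ulabel.simps)
  have i1: "ty ?e ` tuples e1 Q = ty e1 ` tuples e1 Q" and i2: "ty ?e ` tuples e2 Q = ty e2 ` tuples e2 Q"
    by (rule image_cong[OF refl]; clarify; rule t1 t2; assumption)+
  have j1: "ty ?e ` join_tuples (tuples e1 Q) (tuples e2 Q) =
      {join u w | u w. u \<in> ty e1 ` tuples e1 Q \<and> w \<in> ty e2 ` tuples e2 Q \<and> joinable u w}"
    by (rule join_types[OF v]) (erule t1, erule t2, erule cross, assumption)
  have j2: "ty ?e ` join_tuples (tuples e2 Q) (tuples e1 Q) =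
      {join u w | u w. u \<in> ty e2 ` tuples e2 Q \<and> w \<in> ty e1 ` tuples e1 Q \<and> joinable u w}"
    by (rule join_types[OF v(2,1)]) (erule t2, erule t1, erule cross', assumption)
  show "trans_mem 2 x y z (state e1 Q) (state e2 Q) t \<longleftrightarrow> t \<in> ty ?e ` tuples ?e Q" for t
    unfolding tuples.simps image_Un i1 i2 j1 j2 trans_mem_Union set_decode_state ..
qed

lemma set_decode_image: "valid e \<Longrightarrow> set_decode (set_encode (g ` plabels e a b)) = g ` plabels e a b"
  by (intro set_encode_inverse finite_imageI finite_plabels)

lemma delta_Label_Pairs:
  assumes "valid (Label_Pairs i j k e)"
  shows "delta 3 (g i) (g j) (g k) (state e Q) s' S = state (Label_Pairs i j k e) Q"
proof (rule delta_image[OF assms])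
  let ?e = "Label_Pairs i j k e"
  have v: "valid e" and ij: "i \<in> L" "j \<in> L" "k \<in> L" using assms by (auto simp: valid_def)
  have wf: "cw_wf e" using v by (auto simp: valid_def)
  have mark: "mark (g i) (g j) (g k) (olab e x) (olab e y) (oset e x y) = oset ?e x y"
    if "\<And>a. x = Some a \<Longrightarrow> a \<in> points (cw_eval e)" "\<And>a. y = Some a \<Longrightarrow> a \<in> points (cw_eval e)" for x y
  proof (cases "\<exists>a b. x = Some a \<and> y = Some b")
    case True
    then obtain a b where xy: "x = Some a" "y = Some b" by blast
    then have ab: "a \<in> points (cw_eval e)" "b \<in> points (cw_eval e)" using that by auto
    let ?c = "ulabel e a = i \<and> ulabel e b = j \<or> ulabel e a = j \<and> ulabel e b = i"
    have "plabels ?e a b = (if ?c then insert k (plabels e a b) else plabels e a b)"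
      using ab by (auto simp: plabels_def Let_def ulab_iff[OF wf])
    moreover have "g (ulabel e a) = g i \<and> g (ulabel e b) = g j \<or> g (ulabel e a) = g j \<and> g (ulabel e b) = g i \<longleftrightarrow> ?c"
      using ab ij by (simp add: inj_iff ulabel_L[OF v])
    ultimately show ?thesis
      unfolding xy mark_def olab_simps oset_simps ins_def set_decode_image[OF v] by simp
  next
    case False
    \<comment> \<open>A missing entry has label 0 while \<open>g i\<close> and \<open>g j\<close>
      are positive, so \<open>mark\<close> leaves the empty set alone.\<close>
    then have "oset ?e x y = 0" "oset e x y = 0" "olab e x = 0 \<or> olab e y = 0"
      by (cases x; cases y; auto)+
    then show ?thesis using pos ij unfolding mark_def by force
  qed
  show "ty ?e t = mark_type (g i) (g j) (g k) (ty e t)" if "t \<in> tuples e Q" for t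
  proof -
    obtain x y z where t: "t = (x, y, z)" by (cases t)
    have "a \<in> points (cw_eval e)" if "x = Some a \<or> y = Some a \<or> z = Some a" for a
      using valid_distinct[OF v \<open>t \<in> tuples e Q\<close>] that unfolding t distinct_tuple_def by auto
    then have "mark (g i) (g j) (g k) (olab e x) (olab e y) (oset e x y) = oset ?e x y"
      "mark (g i) (g j) (g k) (olab e x) (olab e z) (oset e x z) = oset ?e x z"
      "mark (g i) (g j) (g k) (olab e y) (olab e z) (oset e y z) = oset ?e y z"
      by (intro mark; blast)+
    moreover have "olab ?e w = olab e w" for w by (cases w) auto
    ultimately show ?thesis unfolding t mark_type_def ty_simp comps_enc by simp
  qed
qed (auto simp: trans_mem_def)

lemma delta_Relabel_Points:
  assumes "valid (Relabel_Points i j e)"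
  shows "delta 6 (g i) (g j) z (state e Q) s' S = state (Relabel_Points i j e) Q"
proof (rule delta_image[OF assms])
  let ?e = "Relabel_Points i j e"
  have v: "valid e" and ij: "i \<in> L" "j \<in> L" using assms by (auto simp: valid_def)
  have "plabels ?e a b = plabels e a b" for a b by (simp add: plabels_def Let_def)
  then have s: "oset ?e x y = oset e x y" for x y by (cases x; cases y; simp)
  have l: "olab ?e x = rename_label (g i) (g j) (olab e x)" if "\<And>a. x = Some a \<Longrightarrow> a \<in> points (cw_eval e)" for x
    using that pos[OF ij(1)] by (cases x) (auto simp: rename_label_def inj_iff ij ulabel_L[OF v])
  show "ty ?e t = rename_unary (g i) (g j) (ty e t)" if "t \<in> tuples e Q" for t
  proof -
    obtain x y z where t: "t = (x, y, z)" by (cases t)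
    have "a \<in> points (cw_eval e)" if "x = Some a \<or> y = Some a \<or> z = Some a" for a
      using valid_distinct[OF v \<open>t \<in> tuples e Q\<close>] that unfolding t distinct_tuple_def by auto
    then have "olab ?e x = rename_label (g i) (g j) (olab e x)" "olab ?e y = rename_label (g i) (g j) (olab e y)"
      "olab ?e z = rename_label (g i) (g j) (olab e z)"
      by (intro l; blast)+
    then show ?thesis unfolding t rename_unary_def ty_simp comps_enc s by simp
  qed
qed (auto simp: trans_mem_def)

lemma delta_Relabel_Pairs:
  assumes "valid (Relabel_Pairs i j e)"
  shows "delta 7 (g i) (g j) z (state e Q) s' S = state (Relabel_Pairs i j e) Q"
proof (rule delta_image[OF assms])
  let ?e = "Relabel_Pairs i j e"
  have v: "valid e" and ij: "i \<in> L" "j \<in> L" using assms by (auto simp: valid_def)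
  have pl: "plabels ?e a b = (\<lambda>k. if k = i then j else k) ` plabels e a b" for a b
  proof -
    have "(t, l) \<in> relabel i j X \<longleftrightarrow> (\<exists>k. (t, k) \<in> X \<and> l = (if k = i then j else k))"
      for t :: "'a \<times> 'a" and l X
      by (force simp: relabel_def)
    then show ?thesis unfolding plabels_def by (auto simp: Let_def)
  qed
  \<comment> \<open>Renaming commutes with \<open>g\<close> because \<open>g\<close> is injective on
    the labels in use.\<close>
  have "g ` plabels ?e a b = rename_label (g i) (g j) ` g ` plabels e a b" for a b
    unfolding pl image_image rename_label_def
    using plabels_L[OF v, of a b] ij by (intro image_cong) (auto simp: inj_iff)
  then have s: "oset ?e x y = rename_set (g i) (g j) (oset e x y)" for x y
    by (cases x; cases y; simp add: rename_set_def set_decode_image[OF v])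
  have "olab ?e x = olab e x" for x by (cases x) auto
  then show "ty ?e t = rename_binary (g i) (g j) (ty e t)" for t
    by (cases t) (simp add: rename_binary_def s)
qed (auto simp: trans_mem_def)

lemma covered_iff:
  assumes "valid e" "t \<in> tuples e Q" "i \<in> L" "k \<in> L"
  shows "covered (g i) (g k) (ty e t) \<longleftrightarrow> tuple_covered i k e t"
proof -
  have *: "g l = g i \<longleftrightarrow> l = i" if "l \<in> L" for l using that assms(3) inj_iff by blast
  have "g i \<noteq> 0" using pos[OF assms(3)] by simp
  with valid_distinct[OF assms(1,2)] show ?thesis
    unfolding distinct_tuple_def covered_def tuple_covered_def
    by (auto simp: * ulabel_L[OF assms(1)] set_decode_image[OF assms(1)] mem_g_image[OF assms(4,1)])
qed

text \<open>Types are unchanged, and whether a tuple survives is determined by its type, so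
  filtering tuples and filtering types agree.\<close>

lemma delta_Add:
  assumes "valid e" "valid e'" "i \<in> L" "k \<in> L" "oc = 4 \<or> oc = 5"
    and t: "tuples e' Q = {t \<in> tuples e Q. \<not> tuple_covered i k e t}" "\<And>t. ty e' t = ty e t"
  shows "delta oc (g i) (g k) z (state e Q) s' S = state e' Q"
proof (rule delta_eq_state[OF assms(2)])
  have eq: "ty e' = ty e" using t(2) by blast
  have "trans_mem oc (g i) (g k) z (state e Q) s' t \<longleftrightarrow> t \<in> ty e ` tuples e Q \<and> \<not> covered (g i) (g k) t" for t
    using assms(5) unfolding trans_mem_def set_decode_state by auto
  moreover have "t \<in> ty e ` tuples e Q \<and> \<not> covered (g i) (g k) t \<longleftrightarrow> t \<in> ty e' ` tuples e' Q" for t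
  proof -
    have "t \<in> ty e' ` tuples e' Q \<longleftrightarrow> (\<exists>u\<in>tuples e Q. \<not> tuple_covered i k e u \<and> t = ty e u)"
      unfolding t(1) eq by blast
    also have "\<dots> \<longleftrightarrow> (\<exists>u\<in>tuples e Q. \<not> covered (g i) (g k) (ty e u) \<and> t = ty e u)"
      by (intro bex_cong refl) (simp only: covered_iff[OF assms(1) _ assms(3,4)])
    also have "\<dots> \<longleftrightarrow> t \<in> ty e ` tuples e Q \<and> \<not> covered (g i) (g k) t" by blast
    finally show ?thesis by (rule sym)
  qed
  ultimately show "trans_mem oc (g i) (g k) z (state e Q) s' t \<longleftrightarrow> t \<in> ty e' ` tuples e' Q" for t
    by simp
qed

lemma delta_Add_Triples:
  assumes "valid (Add_Triples i k e)"
  shows "delta 4 (g i) (g k) z (state e Q) s' S = state (Add_Triples i k e) Q"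
proof (rule delta_Add)
  have "plabels (Add_Triples i k e) a b = plabels e a b" for a b by (simp add: plabels_def Let_def)
  then have "oset (Add_Triples i k e) x y = oset e x y" for x y by (cases x; cases y; simp)
  moreover have "olab (Add_Triples i k e) x = olab e x" for x by (cases x) auto
  ultimately show "ty (Add_Triples i k e) t = ty e t" for t by (cases t) simp
qed (use assms in \<open>auto simp: valid_def\<close>)

lemma delta_Add_Triples_Rev:
  assumes "valid (Add_Triples_Rev i k e)"
  shows "delta 5 (g i) (g k) z (state e Q) s' S = state (Add_Triples_Rev i k e) Q"
proof (rule delta_Add)
  have "plabels (Add_Triples_Rev i k e) a b = plabels e a b" for a b by (simp add: plabels_def Let_def)
  then have "oset (Add_Triples_Rev i k e) x y = oset e x y" for x y by (cases x; cases y; simp)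
  moreover have "olab (Add_Triples_Rev i k e) x = olab e x" for x by (cases x) auto
  ultimately show "ty (Add_Triples_Rev i k e) t = ty e t" for t by (cases t) simp
qed (use assms in \<open>auto simp: valid_def\<close>)

text \<open>A nonzero third entry betrays a triple. The values 1 and 0 are the codes of
  \<open>{0}\<close> and of the empty set.\<close>

lemma delta_accept:
  assumes "valid e"
  shows "delta 0 x y z (state e Q) s' S = (if uncovered e Q = {} then 1 else 0)"
proof -
  have "(\<exists>u\<in>set_decode (state e Q). c3 u \<noteq> 0) \<longleftrightarrow> uncovered e Q \<noteq> {}"
  proof
    assume "\<exists>u\<in>set_decode (state e Q). c3 u \<noteq> 0"
    then obtain x y z where t: "(x, y, z) \<in> tuples e Q" "c3 (ty e (x, y, z)) \<noteq> 0"
      unfolding set_decode_state by auto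
    then have "z \<noteq> None" using third_zero_iff[OF assms t(1)] by (simp del: ty_simp)
    with valid_distinct[OF assms t(1)] t(1) show "uncovered e Q \<noteq> {}"
      unfolding distinct_tuple_def uncovered_def by auto
  next
    assume "uncovered e Q \<noteq> {}"
    then obtain a b c where "(Some a, Some b, Some c) \<in> tuples e Q" unfolding uncovered_def by blast
    moreover from third_zero_iff[OF assms this] have "c3 (ty e (Some a, Some b, Some c)) \<noteq> 0"
      by (simp del: ty_simp)
    ultimately show "\<exists>u\<in>set_decode (state e Q). c3 u \<noteq> 0"
      unfolding set_decode_state by blast
  qed
  moreover have "0 < S" by (simp add: num_states_def Let_def)
  ultimately have "{t. t < S \<and> trans_mem 0 x y z (state e Q) s' t} = (if uncovered e Q = {} then {0} else {})"
    by (auto simp: trans_mem_def)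
  then show ?thesis unfolding delta_def by (simp add: set_encode_def)
qed

section \<open>Attainable pairs of a state and a cardinality\<close>

definition rel :: "'p cw_expr \<Rightarrow> (nat \<times> nat) set" where
  "rel e = {(state e Q, card Q) | Q. Q \<subseteq> points (cw_eval e)}"

lemma rel_less: "valid e \<Longrightarrow> (s, n) \<in> rel e \<Longrightarrow> s < S"
  unfolding rel_def using state_less by auto

text \<open>The empty set has the empty state, with code 0. The remaining arguments of
  \<open>delta\<close> are free, so that the lemma fits whatever the machine finds in the
  corresponding cells.\<close>

lemma rel_Create:
  assumes "valid (Create p i)"
  shows "rel (Create p i) = {(0, 0), (delta 1 (g i) y z s s' S, 1)}"
proof -
  have "rel (Create p i) = {(state (Create p i) Q, card Q) | Q. Q = {} \<or> Q = {p}}"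
    unfolding rel_def cw_eval.simps lstruct.simps by (simp add: subset_singleton_iff)
  also have "\<dots> = {(state (Create p i) {}, card {}), (state (Create p i) {p}, card {p})}" by auto
  also have "state (Create p i) {} = 0" by (simp add: state_def set_encode_def)
  also have "state (Create p i) {p} = delta 1 (g i) y z s s' S"
    using delta_Create[OF assms, of "{p}"] by simp
  finally show ?thesis by simp
qed

text \<open>A subset of a disjoint union splits uniquely into subsets of the sides; the
  cardinalities add up, and the states of the parts determine the state of the whole.\<close>

lemma rel_Union:
  assumes "valid (Disjoint_Union e1 e2)"
  shows "rel (Disjoint_Union e1 e2) =
    {(delta 2 x y z s1 s2 S, n1 + n2) | s1 n1 s2 n2. (s1, n1) \<in> rel e1 \<and> (s2, n2) \<in> rel e2}"
proof -
  let ?A = "points (cw_eval e1)" and ?B = "points (cw_eval e2)"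
  have disj: "?A \<inter> ?B = {}" using assms by (simp add: valid_def)
  have pts: "points (cw_eval (Disjoint_Union e1 e2)) = ?A \<union> ?B" by (simp add: Let_def)
  have key: "state (Disjoint_Union e1 e2) (Q1 \<union> Q2) = delta 2 x y z (state e1 Q1) (state e2 Q2) S"
    "card (Q1 \<union> Q2) = card Q1 + card Q2" if "Q1 \<subseteq> ?A" "Q2 \<subseteq> ?B" for Q1 Q2
  proof -
    have "state e1 (Q1 \<union> Q2) = state e1 Q1" "state e2 (Q1 \<union> Q2) = state e2 Q2"
      unfolding state_def using that disj
      by (intro arg_cong[of _ _ "\<lambda>X. set_encode (ty _ ` X)"] tuples_cong; blast)+
    then show "state (Disjoint_Union e1 e2) (Q1 \<union> Q2) = delta 2 x y z (state e1 Q1) (state e2 Q2) S"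
      using delta_Union[OF assms, of x y z "Q1 \<union> Q2"] by simp
    show "card (Q1 \<union> Q2) = card Q1 + card Q2"
      using that disj finite_points finite_subset by (intro card_Un_disjoint) blast+
  qed
  show ?thesis
  proof (intro equalityI subsetI)
    fix r assume "r \<in> rel (Disjoint_Union e1 e2)"
    then obtain Q where Q: "r = (state (Disjoint_Union e1 e2) Q, card Q)" "Q \<subseteq> ?A \<union> ?B"
      unfolding rel_def pts by blast
    have "Q = (Q \<inter> ?A) \<union> (Q \<inter> ?B)" using Q(2) by blast
    then have "r = (delta 2 x y z (state e1 (Q \<inter> ?A)) (state e2 (Q \<inter> ?B)) S, card (Q \<inter> ?A) + card (Q \<inter> ?B))"
      using Q(1) key[of "Q \<inter> ?A" "Q \<inter> ?B"] by simp
    then show "r \<in> {(delta 2 x y z s1 s2 S, n1 + n2) | s1 n1 s2 n2. (s1, n1) \<in> rel e1 \<and> (s2, n2) \<in> rel e2}"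
      unfolding rel_def by blast
  next
    fix r assume "r \<in> {(delta 2 x y z s1 s2 S, n1 + n2) | s1 n1 s2 n2. (s1, n1) \<in> rel e1 \<and> (s2, n2) \<in> rel e2}"
    then obtain Q1 Q2 where Q: "Q1 \<subseteq> ?A" "Q2 \<subseteq> ?B"
      and r: "r = (delta 2 x y z (state e1 Q1) (state e2 Q2) S, card Q1 + card Q2)"
      unfolding rel_def by blast
    then have "r = (state (Disjoint_Union e1 e2) (Q1 \<union> Q2), card (Q1 \<union> Q2))" using key by simp
    then show "r \<in> rel (Disjoint_Union e1 e2)" unfolding rel_def pts using Q by blast
  qed
qed

lemma rel_unary:
  assumes "points (cw_eval e') = points (cw_eval e)"
    and "\<And>Q. delta oc x y z (state e Q) s' S = state e' Q"
  shows "rel e' = {(delta oc x y z s s' S, n) | s n. (s, n) \<in> rel e}"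
  unfolding rel_def assms(1) assms(2)[symmetric] by blast

end

section \<open>Reading the input\<close>

primrec instrs :: "('p \<Rightarrow> nat) \<Rightarrow> 'p cw_expr \<Rightarrow> nat list list" where
  "instrs h (Create p i) = [[1, h p, i]]"
| "instrs h (Disjoint_Union e1 e2) = instrs h e1 @ instrs h e2 @ [[2]]"
| "instrs h (Label_Pairs i j k e) = instrs h e @ [[3, i, j, k]]"
| "instrs h (Add_Triples i k e) = instrs h e @ [[4, i, k]]"
| "instrs h (Add_Triples_Rev i k e) = instrs h e @ [[5, i, k]]"
| "instrs h (Relabel_Points i j e) = instrs h e @ [[6, i, j]]"
| "instrs h (Relabel_Pairs i j e) = instrs h e @ [[7, i, j]]"

lemma encode_expr_instrs: "encode_expr (map_cw_expr h e) = concat (instrs h e)"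
  by (induction e) auto

definition is_instr :: "nat list \<Rightarrow> bool" where
  "is_instr w \<longleftrightarrow> (\<exists>p i. w = [1, p, i]) \<or> w = [2] \<or> (\<exists>i j k. w = [3, i, j, k]) \<or>
     (\<exists>oc i j. oc \<in> {4, 5, 6, 7} \<and> w = [oc, i, j])"

text \<open>All instructions are padded to three labels, by repeating one of their own or, for the
  union, by 0. So both passes can treat all instructions alike.\<close>

fun arg1 :: "nat list \<Rightarrow> nat" where
  "arg1 w = (if w ! 0 = 1 then w ! 2 else if w ! 0 = 2 then 0 else w ! 1)"
fun arg2 :: "nat list \<Rightarrow> nat" where
  "arg2 w = (if w ! 0 = 1 then w ! 2 else if w ! 0 = 2 then 0 else w ! 2)"
fun arg3 :: "nat list \<Rightarrow> nat" where
  "arg3 w = (if w ! 0 = 1 then w ! 2 else if w ! 0 = 2 then 0 else if w ! 0 = 3 then w ! 3 else w ! 2)"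

lemma is_instr_instrs: "w \<in> set (instrs h e) \<Longrightarrow> is_instr w"
  by (induction e) (auto simp: is_instr_def)

definition arg_set :: "nat list list \<Rightarrow> nat set" where
  "arg_set ws = (\<Union>w\<in>set ws. {arg1 w, arg2 w, arg3 w})"

lemma arg_set_append: "arg_set (ws @ vs) = arg_set ws \<union> arg_set vs"
  and arg_set_single: "arg_set [w] = {arg1 w, arg2 w, arg3 w}"
  by (auto simp only: arg_set_def set_append UN_Un list.set UN_insert UN_empty)

text \<open>The padding of the union may register the additional label 0. This is why the final
  bound is taken at \<open>Suc d\<close>.\<close>

lemma arg_set_instrs:
  "unary_labels e \<union> binary_labels e \<subseteq> arg_set (instrs h e) \<and>
   arg_set (instrs h e) \<subseteq> insert 0 (unary_labels e \<union> binary_labels e)"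
  by (induction e) (simp_all add: arg_set_append arg_set_single; blast)+

text \<open>Each instruction has at least one word, so the number of rounds of both passes is linear
  in the input size.\<close>

lemma length_le_concat: "(\<And>w. w \<in> set ws \<Longrightarrow> is_instr w) \<Longrightarrow> length ws \<le> length (concat ws)"
proof (induction ws)
  case (Cons w ws)
  have "1 \<le> length w" using Cons.prems[of w] by (auto simp: is_instr_def)
  moreover have "length ws \<le> length (concat ws)" using Cons by simp
  ultimately show ?case by simp
qed simp

text \<open>
  Arrays of the program: 2 position in the code, 3 opcode, 4 to 6 arguments, 7 renaming of the labels,
  8 number of labels, 9 number \<open>S\<close> of states, 10 top of the stack of tables, 11 the stack,
  12 the table under construction, 13 and 14 states, 15 \<open>k\<close>, 16 a cardinality. Subroutines use
  the arrays from 20 on.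
\<close>

notation Seq (infixr ";;" 60)

abbreviation V :: "nat \<Rightarrow> aexp" where "V A \<equiv> Cell A (Const 0)"
abbreviation Set :: "nat \<Rightarrow> aexp \<Rightarrow> com" where "Set A a \<equiv> Assign A (Const 0) a"

definition fetch :: com where
  "fetch =
     Set 3 (Cell 1 (V 2)) ;;
     Cond (Equal (V 3) (Const 1))
       (Set 4 (Cell 1 (Plus (V 2) (Const 2))) ;; Set 5 (V 4) ;; Set 6 (V 4) ;; Set 2 (Plus (V 2) (Const 3)))
     (Cond (Equal (V 3) (Const 2))
       (Set 4 (Const 0) ;; Set 5 (Const 0) ;; Set 6 (Const 0) ;; Set 2 (Plus (V 2) (Const 1)))
     (Cond (Equal (V 3) (Const 3))
       (Set 4 (Cell 1 (Plus (V 2) (Const 1))) ;; Set 5 (Cell 1 (Plus (V 2) (Const 2))) ;;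
        Set 6 (Cell 1 (Plus (V 2) (Const 3))) ;; Set 2 (Plus (V 2) (Const 4)))
       (Set 4 (Cell 1 (Plus (V 2) (Const 1))) ;; Set 5 (Cell 1 (Plus (V 2) (Const 2))) ;;
        Set 6 (V 5) ;; Set 2 (Plus (V 2) (Const 3)))))"

section \<open>Straight-line programs, executed by simplification\<close>

primrec loop_free :: "com \<Rightarrow> bool" where
  "loop_free Skip \<longleftrightarrow> True"
| "loop_free (Assign A a b) \<longleftrightarrow> True"
| "loop_free (Seq c d) \<longleftrightarrow> loop_free c \<and> loop_free d"
| "loop_free (Cond b c d) \<longleftrightarrow> loop_free c \<and> loop_free d"
| "loop_free (While b c) \<longleftrightarrow> False"

primrec cost :: "com \<Rightarrow> nat" where
  "cost Skip = 1"
| "cost (Assign A a b) = 1"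
| "cost (Seq c d) = cost c + cost d"
| "cost (Cond b c d) = 1 + max (cost c) (cost d)"
| "cost (While b c) = 0"

primrec run :: "point list \<Rightarrow> com \<Rightarrow> store \<Rightarrow> store" where
  "run ps Skip s = s"
| "run ps (Assign A a b) s = s(A := (s A)(aval s a := aval s b))"
| "run ps (Seq c d) s = run ps d (run ps c s)"
| "run ps (Cond b c d) s = (if bval ps s b then run ps c s else run ps d s)"
| "run ps (While b c) s = s"

lemma wp_run: "loop_free c \<Longrightarrow> cost c \<le> T \<Longrightarrow> Q (run ps c s) \<Longrightarrow> wp ps c s T Q"
proof (induction c arbitrary: s T Q)
  case Skip
  then show ?case by (intro wp_mono[OF wp_Skip[of Q]]) simp_all
next
  case (Assign A a b)
  from Assign.prems(3) have "Q (s(A := (s A)(aval s a := aval s b)))" by (simp only: run.simps)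
  from wp_Assign[of Q, OF this] show ?case by (rule wp_mono) (use Assign.prems(2) in simp_all)
next
  case (Seq c d)
  have "wp ps (c ;; d) s (cost c + cost d) Q"
    by (rule wp_Seq, rule Seq.IH(1), use Seq.prems in simp, simp, rule Seq.IH(2)) (use Seq.prems in simp_all)
  then show ?case by (rule wp_mono) (use Seq.prems in simp_all)
next
  case (Cond b c d)
  have "wp ps (Cond b c d) s (1 + max (cost c) (cost d)) Q"
    by (rule wp_Cond; rule Cond.IH) (use Cond.prems in \<open>simp_all\<close>)
  then show ?case by (rule wp_mono) (use Cond.prems in simp_all)
qed simp

lemma wp_fetch:
  assumes "is_instr w" and w: "\<And>i. i < length w \<Longrightarrow> s 1 (s 2 0 + i) = w ! i"
    and Q: "\<And>s'. s' 2 0 = s 2 0 + length w \<Longrightarrow> s' 3 0 = w ! 0 \<Longrightarrow> s' 4 0 = arg1 w \<Longrightarrow>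
      s' 5 0 = arg2 w \<Longrightarrow> s' 6 0 = arg3 w \<Longrightarrow> (\<And>A. A \<notin> {2, 3, 4, 5, 6} \<Longrightarrow> s' A = s A) \<Longrightarrow> Q s'"
  shows "wp ps fetch s 8 Q"
proof (rule wp_run)
  show "loop_free fetch" "cost fetch \<le> 8" by (simp_all add: fetch_def)
  show "Q (run ps fetch s)"
    using assms(1) unfolding is_instr_def
  proof (elim disjE exE conjE)
    fix p i assume "w = [1, p, i]"
    then show ?thesis using w[of 0] w[of 1] w[of 2] by (intro Q) (simp_all add: fetch_def)
  next
    assume "w = [2]"
    then show ?thesis using w[of 0] by (intro Q) (simp_all add: fetch_def)
  next
    fix i j k assume "w = [3, i, j, k]"
    then show ?thesis using w[of 0] w[of 1] w[of 2] w[of 3] by (intro Q) (simp_all add: fetch_def)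
  next
    fix oc i j assume "oc \<in> {4, 5, 6, 7::nat}" "w = [oc, i, j]"
    then show ?thesis using w[of 0] w[of 1] w[of 2] by (intro Q) (auto simp: fetch_def)
  qed
qed

text \<open>Array 7 is addressed by the label itself, so that a lookup takes constant time however
  large the label is. A zero cell means that the label is new, which is why numbers start from
  1.\<close>

definition register :: "nat \<Rightarrow> com" where
  "register A = Cond (Equal (Cell 7 (V A)) (Const 0))
     (Set 8 (Plus (V 8) (Const 1)) ;; Assign 7 (V A) (V 8)) Skip"

definition numbering :: "nat set \<Rightarrow> (nat \<Rightarrow> nat) \<Rightarrow> nat \<Rightarrow> bool" where
  "numbering X g m \<longleftrightarrow> finite X \<and> m = card X \<and> inj_on g X \<and> (\<forall>l. g l \<le> m \<and> (g l = 0 \<longleftrightarrow> l \<notin> X))"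

lemma numbering_zero: "numbering X g m \<Longrightarrow> g l = 0 \<longleftrightarrow> l \<notin> X"
  and numbering_le: "numbering X g m \<Longrightarrow> g l \<le> m"
  unfolding numbering_def by blast+

lemma numbering_insert:
  assumes "numbering X g m" "l \<notin> X"
  shows "numbering (insert l X) (g(l := Suc m)) (Suc m)"
proof -
  have ne: "g k \<noteq> Suc m" for k using numbering_le[OF assms(1), of k] by simp
  have "inj_on (g(l := Suc m)) X"
    using assms unfolding numbering_def by (auto simp: inj_on_def)
  moreover have "(g(l := Suc m)) l \<notin> (g(l := Suc m)) ` (X - {l})"
    using ne[symmetric] by auto
  ultimately have "inj_on (g(l := Suc m)) (insert l X)" by (simp only: inj_on_insert) simp
  moreover have "\<forall>k. (g(l := Suc m)) k \<le> Suc m \<and> ((g(l := Suc m)) k = 0 \<longleftrightarrow> k \<notin> insert l X)"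
    using numbering_le[OF assms(1)] numbering_zero[OF assms(1)] by (simp add: le_SucI)
  ultimately show ?thesis using assms unfolding numbering_def by simp
qed

lemma wp_register:
  assumes "numbering X (s 7) (s 8 0)" "A \<noteq> 7" "A \<noteq> 8"
    and Q: "\<And>s'. numbering (insert (s A 0) X) (s' 7) (s' 8 0) \<Longrightarrow> (\<And>B. B \<noteq> 7 \<Longrightarrow> B \<noteq> 8 \<Longrightarrow> s' B = s B) \<Longrightarrow> Q s'"
  shows "wp ps (register A) s 3 Q"
proof (rule wp_run)
  show "loop_free (register A)" "cost (register A) \<le> 3" by (simp_all add: register_def)
  show "Q (run ps (register A) s)"
  proof (rule Q)
    show "numbering (insert (s A 0) X) (run ps (register A) s 7) (run ps (register A) s 8 0)"
    proof (cases "s A 0 \<in> X")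
      case True
      then have "s 7 (s A 0) \<noteq> 0" using numbering_zero[OF assms(1)] by simp
      then show ?thesis using True assms by (simp add: register_def insert_absorb)
    next
      case False
      then have "s 7 (s A 0) = 0" using numbering_zero[OF assms(1)] by simp
      then show ?thesis using numbering_insert[OF assms(1) False] assms(2,3) by (simp add: register_def)
    qed
    show "run ps (register A) s B = s B" if "B \<noteq> 7" "B \<noteq> 8" for B
      using that by (simp add: register_def)
  qed
qed

text \<open>By the second conjunct the loop test, position against number of words, tells whether
  instructions remain.\<close>

definition code_at :: "nat list list \<Rightarrow> store \<Rightarrow> bool" where
  "code_at ws s \<longleftrightarrow> (\<forall>i<length (concat ws). s 1 (s 2 0 + i) = concat ws ! i) \<and>
     s 2 0 + length (concat ws) = s 0 0"

lemma code_at_Cons: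
  assumes "code_at (w # ws) s"
  shows "i < length w \<Longrightarrow> s 1 (s 2 0 + i) = w ! i"
    and "s' 0 = s 0 \<Longrightarrow> s' 1 = s 1 \<Longrightarrow> s' 2 0 = s 2 0 + length w \<Longrightarrow> code_at ws s'"
    and "is_instr w \<Longrightarrow> s 2 0 < s 0 0"
proof -
  have *: "s 1 (s 2 0 + i) = (w @ concat ws) ! i" if "i < length w + length (concat ws)" for i
    using assms that by (simp add: code_at_def)
  show "i < length w \<Longrightarrow> s 1 (s 2 0 + i) = w ! i" using *[of i] by (simp add: nth_append)
  show "code_at ws s'" if "s' 0 = s 0" "s' 1 = s 1" "s' 2 0 = s 2 0 + length w"
    using assms that *[of "length w + _"] by (auto simp: code_at_def add.assoc nth_append)
  show "is_instr w \<Longrightarrow> s 2 0 < s 0 0" using assms by (auto simp: code_at_def is_instr_def)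
qed

definition pass1 :: com where
  "pass1 = While (Less (V 2) (V 0)) (fetch ;; register 4 ;; register 5 ;; register 6)"

text \<open>A round costs 1 for the test, 8 for \<open>fetch\<close> and 3 for each of three
  registrations, together 18.\<close>

lemma wp_pass1:
  assumes "\<And>w. w \<in> set ws \<Longrightarrow> is_instr w" "code_at ws s" "numbering X (s 7) (s 8 0)"
    and Q: "\<And>s'. numbering (X \<union> arg_set ws) (s' 7) (s' 8 0) \<Longrightarrow>
      (\<And>A. A \<notin> {2, 3, 4, 5, 6, 7, 8} \<Longrightarrow> s' A = s A) \<Longrightarrow> Q s'"
  shows "wp ps pass1 s (18 * length ws + 1) Q"
  using assms
proof (induction ws arbitrary: s X)
  case Nil
  then have "\<not> s 2 0 < s 0 0" by (simp add: code_at_def)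
  moreover have "Q s" using Nil by (intro Nil.prems(4)) (simp_all add: arg_set_def)
  ultimately show ?case unfolding pass1_def by (auto intro!: wp_While_end[unfolded One_nat_def])
next
  case (Cons w ws)
  have w: "is_instr w" using Cons.prems(1) by simp
  note code = code_at_Cons[OF Cons.prems(2)]
  have "wp ps (fetch ;; register 4 ;; register 5 ;; register 6) s (8 + (3 + (3 + 3)))
    (\<lambda>s'. wp ps pass1 s' (18 * length ws + 1) Q)"
  proof (rule wp_Seq, rule wp_fetch[OF w code(1)])
    fix s1 assume s1: "s1 2 0 = s 2 0 + length w" "s1 4 0 = arg1 w" "s1 5 0 = arg2 w" "s1 6 0 = arg3 w"
      "\<And>A. A \<notin> {2, 3, 4, 5, 6} \<Longrightarrow> s1 A = s A"
    show "wp ps (register 4 ;; register 5 ;; register 6) s1 (3 + (3 + 3))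
      (\<lambda>s'. wp ps pass1 s' (18 * length ws + 1) Q)"
    proof (rule wp_Seq, rule wp_register)
      show "numbering X (s1 7) (s1 8 0)" using s1(5) Cons.prems(3) by simp
      fix s2 assume s2: "numbering (insert (s1 4 0) X) (s2 7) (s2 8 0)"
        "\<And>B. B \<noteq> 7 \<Longrightarrow> B \<noteq> 8 \<Longrightarrow> s2 B = s1 B"
      show "wp ps (register 5 ;; register 6) s2 (3 + 3) (\<lambda>s'. wp ps pass1 s' (18 * length ws + 1) Q)"
      proof (rule wp_Seq, rule wp_register[OF s2(1)])
        fix s3 assume s3: "numbering (insert (s2 5 0) (insert (s1 4 0) X)) (s3 7) (s3 8 0)"
          "\<And>B. B \<noteq> 7 \<Longrightarrow> B \<noteq> 8 \<Longrightarrow> s3 B = s2 B"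
        show "wp ps (register 6) s3 3 (\<lambda>s'. wp ps pass1 s' (18 * length ws + 1) Q)"
        proof (rule wp_register[OF s3(1)])
          fix s4 assume s4: "numbering (insert (s3 6 0) (insert (s2 5 0) (insert (s1 4 0) X))) (s4 7) (s4 8 0)"
            "\<And>B. B \<noteq> 7 \<Longrightarrow> B \<noteq> 8 \<Longrightarrow> s4 B = s3 B"
          show "wp ps pass1 s4 (18 * length ws + 1) Q"
          proof (rule Cons.IH[OF _ _ s4(1)])
            show "code_at ws s4" by (rule code(2)) (use s1 s2 s3 s4 in auto)
            have *: "insert (s3 6 0) (insert (s2 5 0) (insert (s1 4 0) X)) \<union> arg_set ws = X \<union> arg_set (w # ws)"
              using s1 s2(2) s3(2) by (auto simp: arg_set_def simp del: arg1.simps arg2.simps arg3.simps)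
            fix s' assume s': "numbering (insert (s3 6 0) (insert (s2 5 0) (insert (s1 4 0) X)) \<union> arg_set ws) (s' 7) (s' 8 0)"
              "\<And>A. A \<notin> {2, 3, 4, 5, 6, 7, 8} \<Longrightarrow> s' A = s4 A"
            show "Q s'"
              by (rule Cons.prems(4)) (use s' s1 s2 s3 s4 in \<open>auto simp: *[symmetric]\<close>)
          qed (use Cons.prems(1) in auto)
        qed simp_all
      qed simp_all
    qed simp_all
  qed
  then have "wp ps pass1 s (1 + (8 + (3 + (3 + 3))) + (18 * length ws + 1)) Q"
    unfolding pass1_def using code(3)[OF w] by (intro wp_While_step) simp_all
  then show ?case by simp
qed

section \<open>Combining tables\<close>

text \<open>Entries exceed the maximal cardinalities by 1, so the sum of two entries is one too
  large; hence the subtraction of 1. Entries 0 mark unreachable states and are skipped.\<close>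

definition inner :: "com \<Rightarrow> com" where
  "inner cd =
     Cond (BAnd (Less (Const 0) (Cell 11 (Plus (Minus (V 10) (V 9)) (V 13))))
                (Less (Const 0) (Cell 11 (Plus (V 10) (V 14)))))
       (cd ;;
        Set 16 (Minus (Plus (Cell 11 (Plus (Minus (V 10) (V 9)) (V 13))) (Cell 11 (Plus (V 10) (V 14)))) (Const 1)) ;;
        Cond (Less (Cell 12 (V 20)) (V 16)) (Assign 12 (V 20) (V 16)) Skip)
       Skip"

definition incr :: "nat \<Rightarrow> com" where "incr A = Set A (Plus (V A) (Const 1))"

definition inner_loop :: "com \<Rightarrow> com" where
  "inner_loop cd = While (Less (V 14) (V 9)) (inner cd ;; incr 14)"

definition outer_loop :: "com \<Rightarrow> com" where
  "outer_loop cd = While (Less (V 13) (V 9)) (Set 14 (Const 0) ;; inner_loop cd ;; incr 13)"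

text \<open>The new table replaces the first operand. Clearing the second operand and array 12
  restores the zero cells required by \<open>stack_rel\<close>.\<close>

definition copy_loop :: com where
  "copy_loop = While (Less (V 13) (V 9))
     (Assign 11 (Plus (Minus (V 10) (V 9)) (V 13)) (Cell 12 (V 13)) ;;
      Assign 11 (Plus (V 10) (V 13)) (Const 0) ;;
      Assign 12 (V 13) (Const 0) ;; incr 13)"

definition combine :: "com \<Rightarrow> com" where
  "combine cd = Set 10 (Minus (V 10) (V 9)) ;; Set 13 (Const 0) ;; outer_loop cd ;;
     Set 13 (Const 0) ;; copy_loop"

text \<open>The 1 is the entry of state 0 in the table of the empty set, which has cardinality 0;
  the other entries of this table are 0 already.\<close>

definition unary :: "com \<Rightarrow> com" where
  "unary cd = Assign 11 (V 10) (Const 1) ;; Set 10 (Plus (V 10) (V 9)) ;; combine cd"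

text \<open>The entries 1 and 2 stand for cardinalities 0 and 1. The 2 is written last, so it
  prevails if both states coincide.\<close>

definition create :: "com \<Rightarrow> com" where
  "create cd = Set 13 (Const 0) ;; Set 14 (Const 0) ;; cd ;; Assign 11 (V 10) (Const 1) ;;
     Assign 11 (Plus (V 10) (V 20)) (Const 2) ;; Set 10 (Plus (V 10) (V 9))"

definition pass2 :: "com \<Rightarrow> com" where
  "pass2 cd = While (Less (V 2) (V 0))
     (fetch ;; Set 4 (Cell 7 (V 4)) ;; Set 5 (Cell 7 (V 5)) ;; Set 6 (Cell 7 (V 6)) ;;
      Cond (Equal (V 3) (Const 1)) (create cd)
        (Cond (Equal (V 3) (Const 2)) (combine cd) (unary cd)))"

text \<open>The arrays in which \<open>delta\<close> finds its arguments: opcode, three labels, two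
  states and the number of states.\<close>

definition dreg :: "nat \<Rightarrow> nat" where
  "dreg j = (if j = 0 then 3 else if j = 1 then 4 else if j = 2 then 5 else if j = 3 then 6
     else if j = 4 then 13 else if j = 5 then 14 else 9)"

text \<open>
  An entry of a table is 0 for unreachable states and exceeds the maximal cardinality by 1 for
  the others; both are expressed by the following equivalence.
\<close>

definition table_rel :: "(nat \<times> nat) set \<Rightarrow> (nat \<Rightarrow> nat) \<Rightarrow> nat \<Rightarrow> bool" where
  "table_rel X T S \<longleftrightarrow> (\<forall>\<sigma><S. \<forall>v. v < T \<sigma> \<longleftrightarrow> (\<exists>n. (\<sigma>, n) \<in> X \<and> v \<le> n)) \<and> (\<forall>(\<sigma>, n)\<in>X. \<sigma> < S)"

text \<open>Table \<open>j\<close> starts at cell \<open>S * j\<close>. Since everything above the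
  top and all of array 12 is zero, no table has to be cleared before it is filled.\<close>

definition stack_rel :: "(nat \<times> nat) set list \<Rightarrow> nat \<Rightarrow> store \<Rightarrow> bool" where
  "stack_rel Xs S s \<longleftrightarrow> s 9 0 = S \<and> s 10 0 = S * length Xs \<and>
     (\<forall>j<length Xs. table_rel (Xs ! j) (\<lambda>\<sigma>. s 11 (S * j + \<sigma>)) S) \<and>
     (\<forall>i\<ge>S * length Xs. s 11 i = 0) \<and> (\<forall>i. s 12 i = 0)"

section \<open>Correctness of the table operations\<close>

locale dp_machine = compact_labels +
  fixes Td :: "nat \<Rightarrow> nat" and Cd :: "(nat \<Rightarrow> nat) \<Rightarrow> nat \<Rightarrow> com" and ps :: "point list"
  assumes Cd: "realizes Td Cd (\<lambda>v. delta (v 0) (v 1) (v 2) (v 3) (v 4) (v 5) (v 6))"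
    and g_le: "g l \<le> m"
begin

definition cd :: com where "cd = Cd dreg 20"

text \<open>\<open>m + S + 7\<close> bounds all arguments of \<open>delta\<close>: labels by
  \<open>m\<close>, states by \<open>S\<close>, opcodes by 7.\<close>

definition tdelta :: nat where "tdelta = Td (m + S + 7)"

definition ops_ok :: "store \<Rightarrow> bool" where
  "ops_ok s \<longleftrightarrow> s 3 0 \<le> 7 \<and> s 4 0 \<le> m \<and> s 5 0 \<le> m \<and> s 6 0 \<le> m \<and> s 9 0 = S"

lemma wp_cd:
  assumes "ops_ok s" "s 13 0 \<le> S" "s 14 0 \<le> S"
    and "\<And>s'. s' 20 0 = delta (s 3 0) (s 4 0) (s 5 0) (s 6 0) (s 13 0) (s 14 0) S \<Longrightarrow>
      (\<And>A. A < 20 \<Longrightarrow> s' A = s A) \<Longrightarrow> Q s'"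
  shows "wp ps cd s tdelta Q"
  unfolding cd_def tdelta_def
proof (rule realizes_wp[OF Cd])
  show "dreg j < 20" for j by (simp add: dreg_def)
  show "s (dreg j) 0 \<le> m + S + 7" for j using assms(1-3) by (auto simp: dreg_def ops_ok_def)
  show "Q s'" if "s' 20 0 = delta (s (dreg 0) 0) (s (dreg 1) 0) (s (dreg 2) 0) (s (dreg 3) 0)
      (s (dreg 4) 0) (s (dreg 5) 0) (s (dreg 6) 0)" "\<And>A. A < 20 \<Longrightarrow> s' A = s A" for s'
    using that assms(1) by (intro assms(4)) (simp_all add: dreg_def ops_ok_def)
qed

definition same :: "store \<Rightarrow> store \<Rightarrow> bool" where
  "same s0 s \<longleftrightarrow> (\<forall>A<20. A \<notin> {12, 13, 14, 16} \<longrightarrow> s A = s0 A)"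

definition dl :: "store \<Rightarrow> nat \<Rightarrow> nat \<Rightarrow> nat" where
  "dl s a b = delta (s 3 0) (s 4 0) (s 5 0) (s 6 0) a b S"

definition t1 :: "store \<Rightarrow> nat \<Rightarrow> nat" where "t1 s a = s 11 (s 10 0 - s 9 0 + a)"
definition t2 :: "store \<Rightarrow> nat \<Rightarrow> nat" where "t2 s b = s 11 (s 10 0 + b)"

text \<open>Array 12 holds the maxima over the pairs \<open>P\<close> treated so far. Quantifying
  over all smaller \<open>v\<close> avoids the maximum of a possibly empty set.\<close>

definition maxima :: "store \<Rightarrow> (nat \<times> nat) set \<Rightarrow> store \<Rightarrow> bool" where
  "maxima s0 P s \<longleftrightarrow> (\<forall>\<sigma> v. v < s 12 \<sigma> \<longleftrightarrow>
     (\<exists>(a, b)\<in>P. dl s0 a b = \<sigma> \<and> 0 < t1 s0 a \<and> 0 < t2 s0 b \<and> v < t1 s0 a + t2 s0 b - 1))"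

lemma sameD: "same s0 s \<Longrightarrow> s 3 = s0 3 \<and> s 4 = s0 4 \<and> s 5 = s0 5 \<and> s 6 = s0 6 \<and> s 9 = s0 9 \<and>
    s 10 = s0 10 \<and> s 11 = s0 11"
  unfolding same_def by simp

lemma wp_inner:
  assumes "ops_ok s0" "same s0 s" "s 13 0 = a" "s 14 0 = b" "a < S" "b < S" "maxima s0 P s"
  shows "wp ps (inner cd) s (tdelta + 4)
    (\<lambda>s'. same s0 s' \<and> s' 13 0 = a \<and> s' 14 0 = b \<and> maxima s0 (insert (a, b) P) s')"
proof -
  note eq = sameD[OF assms(2)]
  have ops: "ops_ok s" using assms(1) eq by (simp add: ops_ok_def)
  let ?b = "BAnd (Less (Const 0) (Cell 11 (Plus (Minus (V 10) (V 9)) (V 13))))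
                (Less (Const 0) (Cell 11 (Plus (V 10) (V 14))))"
  have b: "bval ps s ?b \<longleftrightarrow> 0 < t1 s0 a \<and> 0 < t2 s0 b"
    using eq assms(3,4) by (simp add: t1_def t2_def)
  have "wp ps (inner cd) s (1 + (tdelta + (1 + 2)))
    (\<lambda>s'. same s0 s' \<and> s' 13 0 = a \<and> s' 14 0 = b \<and> maxima s0 (insert (a, b) P) s')"
    unfolding inner_def
  proof (rule wp_Cond)
    assume "bval ps s ?b"
    then have pos: "0 < t1 s0 a" "0 < t2 s0 b" using b by simp_all
    show "wp ps (cd ;; Set 16 (Minus (Plus (Cell 11 (Plus (Minus (V 10) (V 9)) (V 13))) (Cell 11 (Plus (V 10) (V 14)))) (Const 1)) ;;
        Cond (Less (Cell 12 (V 20)) (V 16)) (Assign 12 (V 20) (V 16)) Skip) s (tdelta + (1 + 2))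
      (\<lambda>s'. same s0 s' \<and> s' 13 0 = a \<and> s' 14 0 = b \<and> maxima s0 (insert (a, b) P) s')"
    proof (rule wp_Seq, rule wp_cd[OF ops])
      fix s1 assume s1: "s1 20 0 = delta (s 3 0) (s 4 0) (s 5 0) (s 6 0) (s 13 0) (s 14 0) S"
        "\<And>A. A < 20 \<Longrightarrow> s1 A = s A"
      let ?u = "t1 s0 a + t2 s0 b - 1"
      have d: "s1 20 0 = dl s0 a b" using s1 eq assms(3,4) by (simp add: dl_def)
      have r: "s1 12 = s 12" "s1 11 = s0 11" "s1 10 = s0 10" "s1 9 = s0 9" "s1 13 0 = a" "s1 14 0 = b"
        using s1 eq assms(3,4) by simp_all
      show "wp ps (Set 16 (Minus (Plus (Cell 11 (Plus (Minus (V 10) (V 9)) (V 13))) (Cell 11 (Plus (V 10) (V 14)))) (Const 1)) ;;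
        Cond (Less (Cell 12 (V 20)) (V 16)) (Assign 12 (V 20) (V 16)) Skip) s1 (1 + 2)
        (\<lambda>s'. same s0 s' \<and> s' 13 0 = a \<and> s' 14 0 = b \<and> maxima s0 (insert (a, b) P) s')"
        (is "wp ps ?c s1 _ _")
      proof (rule wp_run)
        \<comment> \<open>Only the cell of the new state changes, to the maximum of its old value
          and the candidate \<open>?u\<close>.\<close>
        have run12: "run ps ?c s1 12 = (s 12)(dl s0 a b := max (s 12 (dl s0 a b)) ?u)"
          using d r by (auto simp: t1_def t2_def max_def fun_eq_iff)
        have run: "run ps ?c s1 A = s A" if "A < 20" "A \<noteq> 12" "A \<noteq> 16" for A
          using that s1(2) by simp
        have "maxima s0 (insert (a, b) P) (run ps ?c s1)"
          using assms(7) pos unfolding maxima_def run12 by (auto simp: less_max_iff_disj)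
        moreover have "same s0 (run ps ?c s1)"
          using assms(2) run unfolding same_def by auto
        ultimately show "same s0 (run ps ?c s1) \<and> run ps ?c s1 13 0 = a \<and> run ps ?c s1 14 0 = b \<and>
            maxima s0 (insert (a, b) P) (run ps ?c s1)"
          using run[of 13] run[of 14] assms(3,4) by simp
      qed simp_all
    qed (use assms in simp_all)
  next
    assume "\<not> bval ps s ?b"
    then have "maxima s0 (insert (a, b) P) s" using assms(7) b unfolding maxima_def by auto
    then show "wp ps Skip s (tdelta + (1 + 2))
      (\<lambda>s'. same s0 s' \<and> s' 13 0 = a \<and> s' 14 0 = b \<and> maxima s0 (insert (a, b) P) s')"
      using assms by (intro wp_run) simp_all
  qed
  then show ?thesis by (rule wp_mono) simp_all
qed

definition tinner :: nat where "tinner = S * Suc (tdelta + 4 + 1) + 1"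

lemma wp_inner_loop:
  assumes "ops_ok s0" "same s0 s" "s 13 0 = a" "s 14 0 = 0" "a < S" "maxima s0 ({..<a} \<times> {..<S}) s"
  shows "wp ps (inner_loop cd) s tinner
    (\<lambda>s'. same s0 s' \<and> s' 13 0 = a \<and> maxima s0 ({..<Suc a} \<times> {..<S}) s')"
proof -
  \<comment> \<open>Rows below \<open>a\<close> are complete, and row \<open>a\<close> is complete
    up to column \<open>b\<close>.\<close>
  define I where "I b s' \<longleftrightarrow> same s0 s' \<and> s' 13 0 = a \<and> s' 14 0 = b \<and>
    maxima s0 ({..<a} \<times> {..<S} \<union> {a} \<times> {..<b}) s'" for b s'
  have S: "s' 9 0 = S" if "same s0 s'" for s'
    using sameD[OF that] assms(1) by (simp add: ops_ok_def)
  have "wp ps (inner_loop cd) s (S * Suc (tdelta + 4 + 1) + 1) (I S)"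
    unfolding inner_loop_def
  proof (rule wp_While_count)
    show "I 0 s" using assms by (simp add: I_def)
    fix b s' assume b: "b < S" and I: "I b s'"
    have "wp ps (inner cd ;; incr 14) s' (tdelta + 4 + 1) (I (Suc b))"
    proof (rule wp_Seq, rule wp_mono[OF wp_inner order_refl])
      show "ops_ok s0" "same s0 s'" "s' 13 0 = a" "s' 14 0 = b" "a < S" "b < S"
        "maxima s0 ({..<a} \<times> {..<S} \<union> {a} \<times> {..<b}) s'"
        using assms I b by (simp_all add: I_def)
      fix s1 assume s1: "same s0 s1 \<and> s1 13 0 = a \<and> s1 14 0 = b \<and>
        maxima s0 (insert (a, b) ({..<a} \<times> {..<S} \<union> {a} \<times> {..<b})) s1"
      have "insert (a, b) ({..<a} \<times> {..<S} \<union> {a} \<times> {..<b}) = {..<a} \<times> {..<S} \<union> {a} \<times> {..<Suc b}"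
        by auto
      then show "wp ps (incr 14) s1 1 (I (Suc b))"
        using s1 by (intro wp_run) (simp_all add: incr_def I_def same_def maxima_def)
    qed
    then show "bval ps s' (Less (V 14) (V 9)) \<and> wp ps (inner cd ;; incr 14) s' (tdelta + 4 + 1) (I (Suc b))"
      using b I S[of s'] by (simp add: I_def)
  next
    show "\<not> bval ps s' (Less (V 14) (V 9))" if "I S s'" for s'
      using that S[of s'] by (simp add: I_def)
  qed
  then show ?thesis
  proof (rule wp_mono)
    have "{..<a} \<times> {..<S} \<union> {a} \<times> {..<S} = {..<Suc a} \<times> {..<S}" by auto
    then show "same s0 s' \<and> s' 13 0 = a \<and> maxima s0 ({..<Suc a} \<times> {..<S}) s'" if "I S s'" for s'
      using that by (simp add: I_def)
  qed (simp add: tinner_def)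
qed

definition touter :: nat where "touter = S * Suc (1 + (tinner + 1)) + 1"

lemma wp_outer_loop:
  assumes "ops_ok s0" "same s0 s" "s 13 0 = 0" "\<And>i. s 12 i = 0"
  shows "wp ps (outer_loop cd) s touter (\<lambda>s'. same s0 s' \<and> maxima s0 ({..<S} \<times> {..<S}) s')"
proof -
  define I where "I a s' \<longleftrightarrow> same s0 s' \<and> s' 13 0 = a \<and> maxima s0 ({..<a} \<times> {..<S}) s'" for a s'
  have S: "s' 9 0 = S" if "same s0 s'" for s'
    using sameD[OF that] assms(1) by (simp add: ops_ok_def)
  have "wp ps (outer_loop cd) s (S * Suc (1 + (tinner + 1)) + 1) (I S)"
    unfolding outer_loop_def
  proof (rule wp_While_count)
    show "I 0 s" using assms by (simp add: I_def maxima_def)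
    fix a s' assume a: "a < S" and I: "I a s'"
    have "wp ps (Set 14 (Const 0) ;; inner_loop cd ;; incr 13) s' (1 + (tinner + 1)) (I (Suc a))"
    proof (rule wp_Seq, rule wp_Assign, rule wp_Seq, rule wp_mono[OF wp_inner_loop order_refl])
      show "ops_ok s0" "a < S" by fact+
      let ?s = "s'(14 := (s' 14)(aval s' (Const 0) := aval s' (Const 0)))"
      show "same s0 ?s" "?s 13 0 = a" "?s 14 0 = 0" "maxima s0 ({..<a} \<times> {..<S}) ?s"
        using I by (simp_all add: I_def same_def maxima_def)
      show "wp ps (incr 13) s1 1 (I (Suc a))"
        if "same s0 s1 \<and> s1 13 0 = a \<and> maxima s0 ({..<Suc a} \<times> {..<S}) s1" for s1
        using that by (intro wp_run) (simp_all add: incr_def I_def same_def maxima_def)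
    qed
    then show "bval ps s' (Less (V 13) (V 9)) \<and>
        wp ps (Set 14 (Const 0) ;; inner_loop cd ;; incr 13) s' (1 + (tinner + 1)) (I (Suc a))"
      using a I S[of s'] by (simp add: I_def)
  next
    show "\<not> bval ps s' (Less (V 13) (V 9))" if "I S s'" for s'
      using that S[of s'] by (simp add: I_def)
  qed
  then show ?thesis by (rule wp_mono) (simp_all add: touter_def I_def)
qed

definition tcopy :: nat where "tcopy = S * Suc 4 + 1"

lemma wp_copy_loop:
  assumes "s 9 0 = S" "S \<le> s 10 0" "s 13 0 = 0"
  shows "wp ps copy_loop s tcopy (\<lambda>s'.
    (\<forall>A<20. A \<notin> {11, 12, 13} \<longrightarrow> s' A = s A) \<and>
    (\<forall>i. s' 12 i = (if i < S then 0 else s 12 i)) \<and>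
    (\<forall>i. s' 11 i = (if s 10 0 - S \<le> i \<and> i < s 10 0 then s 12 (i - (s 10 0 - S))
      else if s 10 0 \<le> i \<and> i < s 10 0 + S then 0 else s 11 i)))"
proof -
  define B where "B = s 10 0 - S"
  have B: "s 10 0 = B + S" using assms(2) by (simp add: B_def)
  define I where "I a s' \<longleftrightarrow> s' 13 0 = a \<and> (\<forall>A<20. A \<notin> {11, 12, 13} \<longrightarrow> s' A = s A) \<and>
    (\<forall>i. s' 12 i = (if i < a then 0 else s 12 i)) \<and>
    (\<forall>i. s' 11 i = (if B \<le> i \<and> i < B + a then s 12 (i - B)
      else if B + S \<le> i \<and> i < B + S + a then 0 else s 11 i))" for a s'
  have "wp ps copy_loop s (S * Suc 4 + 1) (I S)"
    unfolding copy_loop_def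
  proof (rule wp_While_count)
    show "I 0 s" using assms by (simp add: I_def)
    fix a s' assume a: "a < S" and I: "I a s'"
    have r: "s' 13 0 = a" "s' 9 0 = S" "s' 10 0 = B + S" using I assms B by (simp_all add: I_def)
    let ?c = "Assign 11 (Plus (Minus (V 10) (V 9)) (V 13)) (Cell 12 (V 13)) ;;
      Assign 11 (Plus (V 10) (V 13)) (Const 0) ;;
      Assign 12 (V 13) (Const 0) ;; incr 13"
    have "wp ps ?c s' 4 (I (Suc a))"
    proof (rule wp_run)
      have 11: "run ps ?c s' 11 = (s' 11)(B + a := s' 12 a, B + S + a := 0)"
        using r by (simp add: incr_def)
      have 12: "run ps ?c s' 12 = (s' 12)(a := 0)" using r by (simp add: incr_def)
      have 13: "run ps ?c s' 13 0 = Suc a" using r by (simp add: incr_def)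
      have o: "run ps ?c s' A = s' A" if "A \<notin> {11, 12, 13}" for A using that by (simp add: incr_def)
      have I12: "s' 12 i = (if i < a then 0 else s 12 i)"
        and I11: "s' 11 i = (if B \<le> i \<and> i < B + a then s 12 (i - B)
          else if B + S \<le> i \<and> i < B + S + a then 0 else s 11 i)"
        and Io: "A < 20 \<Longrightarrow> A \<notin> {11, 12, 13} \<Longrightarrow> s' A = s A" for i A
        using I unfolding I_def by blast+
      show "I (Suc a) (run ps ?c s')"
        unfolding I_def
      proof (intro conjI allI impI)
        show "run ps ?c s' 13 0 = Suc a" by (rule 13)
        show "run ps ?c s' A = s A" if "A < 20" "A \<notin> {11, 12, 13}" for A
          using o[OF that(2)] Io[OF that] by simp
        show "run ps ?c s' 12 i = (if i < Suc a then 0 else s 12 i)" for i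
          unfolding 12 using I12[of i] by (simp add: less_Suc_eq)
        show "run ps ?c s' 11 i = (if B \<le> i \<and> i < B + Suc a then s 12 (i - B)
          else if B + S \<le> i \<and> i < B + S + Suc a then 0 else s 11 i)" for i
          unfolding 11 using I11[of i] I12[of a] a by (auto simp: less_Suc_eq)
      qed
    qed (simp_all add: incr_def)
    then show "bval ps s' (Less (V 13) (V 9)) \<and> wp ps ?c s' 4 (I (Suc a))"
      using a r by simp
  next
    show "\<not> bval ps s' (Less (V 13) (V 9))" if "I S s'" for s'
    proof -
      have "s' 9 = s 9" using that unfolding I_def by simp
      then show ?thesis using that assms(1) by (simp add: I_def)
    qed
  qed
  then show ?thesis
    by (rule wp_mono) (auto simp: tcopy_def I_def B)
qed

end

text \<open>The maximum of the sums is the sum of the maxima. As \<open>p\<close> and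
  \<open>q\<close> are maxima plus 1, with 0 for the empty set, the maximum of the sums plus 1 is
  \<open>p + q - 1\<close>.\<close>

lemma add_bounds_attained:
  fixes p q :: nat
  assumes A: "\<And>v. v < p \<longleftrightarrow> (\<exists>n. A n \<and> v \<le> n)" and B: "\<And>v. v < q \<longleftrightarrow> (\<exists>n. B n \<and> v \<le> n)"
  shows "0 < p \<and> 0 < q \<and> v < p + q - 1 \<longleftrightarrow> (\<exists>n n'. A n \<and> B n' \<and> v \<le> n + n')"
proof
  assume l: "0 < p \<and> 0 < q \<and> v < p + q - 1"
  then obtain n n' where "A n" "p - 1 \<le> n" "B n'" "q - 1 \<le> n'"
    using A[of "p - 1"] B[of "q - 1"] by auto
  moreover from this l have "v \<le> n + n'" by linarith
  ultimately show "\<exists>n n'. A n \<and> B n' \<and> v \<le> n + n'" by blast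
next
  assume "\<exists>n n'. A n \<and> B n' \<and> v \<le> n + n'"
  then obtain n n' where "A n" "B n'" "v \<le> n + n'" by blast
  moreover from this have "n < p" "n' < q" using A[of n] B[of n'] by blast+
  ultimately show "0 < p \<and> 0 < q \<and> v < p + q - 1" by linarith
qed

lemma table_relD: "table_rel X T S \<Longrightarrow> \<sigma> < S \<Longrightarrow> v < T \<sigma> \<longleftrightarrow> (\<exists>n. (\<sigma>, n) \<in> X \<and> v \<le> n)"
  unfolding table_rel_def by blast

lemma table_rel_less: "table_rel X T S \<Longrightarrow> (\<sigma>, n) \<in> X \<Longrightarrow> \<sigma> < S"
  unfolding table_rel_def by blast

lemma table_rel_cong: "table_rel X T S \<Longrightarrow> (\<And>\<sigma>. \<sigma> < S \<Longrightarrow> T' \<sigma> = T \<sigma>) \<Longrightarrow> table_rel X T' S"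
  unfolding table_rel_def by simp

lemma index_less: "j < n \<Longrightarrow> \<sigma> < S \<Longrightarrow> S * j + \<sigma> < S * (n::nat)"
proof -
  assume "j < n" "\<sigma> < S"
  then have "S * j + \<sigma> < S * Suc j" by simp
  also have "\<dots> \<le> S * n" using \<open>j < n\<close> by (intro mult_le_mono2) simp
  finally show ?thesis .
qed

lemma stack_relD:
  "stack_rel Xs S s \<Longrightarrow> j < length Xs \<Longrightarrow> table_rel (Xs ! j) (\<lambda>\<sigma>. s 11 (S * j + \<sigma>)) S"
  unfolding stack_rel_def by blast

text \<open>Covers both a push and the replacement of the topmost tables: \<open>Xs\<close> is the
  part of the old stack \<open>Ys\<close> that stays.\<close>

lemma stack_rel_snoc:
  assumes "stack_rel Ys S0 s"
    and Xs: "\<And>j. j < length Xs \<Longrightarrow> Ys ! j = Xs ! j" and "length Xs \<le> length Ys"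
    and s': "s' 9 0 = S0" "s' 10 0 = S0 * Suc (length Xs)" "\<And>i. s' 12 i = 0"
    and low: "\<And>i. i < S0 * length Xs \<Longrightarrow> s' 11 i = s 11 i"
    and tab: "table_rel X (\<lambda>\<sigma>. s' 11 (S0 * length Xs + \<sigma>)) S0"
    and high: "\<And>i. i \<ge> S0 * Suc (length Xs) \<Longrightarrow> s' 11 i = 0"
  shows "stack_rel (Xs @ [X]) S0 s'"
  unfolding stack_rel_def
proof (intro conjI allI impI)
  show "s' 9 0 = S0" "s' 10 0 = S0 * length (Xs @ [X])" using s' by simp_all
  show "s' 12 i = 0" for i by (rule s')
  show "s' 11 i = 0" if "S0 * length (Xs @ [X]) \<le> i" for i using high[of i] that by simp
  show "table_rel ((Xs @ [X]) ! j) (\<lambda>\<sigma>. s' 11 (S0 * j + \<sigma>)) S0" if "j < length (Xs @ [X])" for j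
  proof (cases "j < length Xs")
    case True
    then have "table_rel (Xs ! j) (\<lambda>\<sigma>. s 11 (S0 * j + \<sigma>)) S0"
      using assms(1,3) Xs[OF True] unfolding stack_rel_def by (metis less_le_trans)
    then have "table_rel (Xs ! j) (\<lambda>\<sigma>. s' 11 (S0 * j + \<sigma>)) S0"
      by (rule table_rel_cong) (intro low index_less True)
    then show ?thesis using True by (simp add: nth_append)
  next
    case False
    then have "j = length Xs" using that by simp
    then show ?thesis using tab by simp
  qed
qed

context dp_machine
begin

definition tcomb :: nat where "tcomb = 1 + (1 + (touter + (1 + tcopy)))"

lemma wp_combine:
  assumes st: "stack_rel (Xs @ [X1, X2]) S s" and ops: "ops_ok s"
    and out: "\<And>a n b n'. (a, n) \<in> X1 \<Longrightarrow> (b, n') \<in> X2 \<Longrightarrow> dl s a b < S"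
  shows "wp ps (combine cd) s tcomb (\<lambda>s'.
    stack_rel (Xs @ [{(dl s a b, n + n') | a n b n'. (a, n) \<in> X1 \<and> (b, n') \<in> X2}]) S s' \<and>
    (\<forall>A<10. s' A = s A) \<and> s' 15 = s 15)"
proof -
  define B where "B = S * length Xs"
  let ?X = "{(dl s a b, n + n') | a n b n'. (a, n) \<in> X1 \<and> (b, n') \<in> X2}"
  define s0 where "s0 = s(10 := (s 10)(0 := B + S), 13 := (s 13)(0 := 0))"
  have base: "s 10 0 = B + S + S" and S9: "s 9 0 = S" and z12: "s 12 i = 0" for i
    using st by (simp_all add: stack_rel_def B_def algebra_simps)
  have z11: "s 11 i = 0" if "B + S + S \<le> i" for i
  proof -
    have "S * length (Xs @ [X1, X2]) = B + S + S" by (simp add: B_def algebra_simps)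
    then show ?thesis using st that unfolding stack_rel_def by auto
  qed
  have T1: "table_rel X1 (\<lambda>\<sigma>. s 11 (B + \<sigma>)) S"
  proof -
    have "table_rel ((Xs @ [X1, X2]) ! length Xs) (\<lambda>\<sigma>. s 11 (S * length Xs + \<sigma>)) S"
      by (rule stack_relD[OF st]) simp
    then show ?thesis by (simp add: B_def)
  qed
  have T2: "table_rel X2 (\<lambda>\<sigma>. s 11 (B + S + \<sigma>)) S"
  proof -
    have "table_rel ((Xs @ [X1, X2]) ! Suc (length Xs)) (\<lambda>\<sigma>. s 11 (S * Suc (length Xs) + \<sigma>)) S"
      by (rule stack_relD[OF st]) simp
    then show ?thesis by (simp add: B_def nth_append add_ac)
  qed
  have ops0: "ops_ok s0" using ops by (simp add: s0_def ops_ok_def)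
  have dl0: "dl s0 = dl s" by (simp add: s0_def dl_def fun_eq_iff)
  have t: "t1 s0 a = s 11 (B + a)" "t2 s0 a = s 11 (B + S + a)" for a
    using S9 by (simp_all add: s0_def t1_def t2_def)
  have "wp ps (outer_loop cd ;; Set 13 (Const 0) ;; copy_loop) s0 (touter + (1 + tcopy)) (\<lambda>s'.
      stack_rel (Xs @ [?X]) S s' \<and> (\<forall>A<10. s' A = s A) \<and> s' 15 = s 15)"
  proof (rule wp_Seq, rule wp_mono[OF wp_outer_loop[OF ops0] order_refl])
    show "same s0 s0" "s0 13 0 = 0" "s0 12 i = 0" for i
      using z12 by (simp_all add: same_def s0_def)
    fix s1 assume s1: "same s0 s1 \<and> maxima s0 ({..<S} \<times> {..<S}) s1"
    then have same: "same s0 s1" and mx: "maxima s0 ({..<S} \<times> {..<S}) s1" by simp_all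
    have R: "v < s1 12 \<sigma> \<longleftrightarrow> (\<exists>n. (\<sigma>, n) \<in> ?X \<and> v \<le> n)" for v \<sigma>
    proof -
      have "v < s1 12 \<sigma> \<longleftrightarrow> (\<exists>a<S. \<exists>b<S. dl s a b = \<sigma> \<and>
          (0 < s 11 (B + a) \<and> 0 < s 11 (B + S + b) \<and> v < s 11 (B + a) + s 11 (B + S + b) - 1))"
        using mx unfolding maxima_def dl0 t by auto
      also have "\<dots> \<longleftrightarrow> (\<exists>a<S. \<exists>b<S. dl s a b = \<sigma> \<and>
          (\<exists>n n'. (a, n) \<in> X1 \<and> (b, n') \<in> X2 \<and> v \<le> n + n'))"
      proof -
        have "0 < s 11 (B + a) \<and> 0 < s 11 (B + S + b) \<and> v < s 11 (B + a) + s 11 (B + S + b) - 1 \<longleftrightarrow>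
          (\<exists>n n'. (a, n) \<in> X1 \<and> (b, n') \<in> X2 \<and> v \<le> n + n')" if "a < S" "b < S" for a b
          by (rule add_bounds_attained) (rule table_relD[OF T1 that(1)] table_relD[OF T2 that(2)])+
        then show ?thesis by (simp cong: conj_cong)
      qed
      also have "\<dots> \<longleftrightarrow> (\<exists>n. (\<sigma>, n) \<in> ?X \<and> v \<le> n)"
        using table_rel_less[OF T1] table_rel_less[OF T2] by blast
      finally show ?thesis .
    qed
    have out': "\<sigma> < S" if "(\<sigma>, n) \<in> ?X" for \<sigma> n using that out by blast
    \<comment> \<open>New states are smaller than \<open>S\<close>, so array 12 is zero from
      \<open>S\<close> on and clearing its first \<open>S\<close> cells clears all of it.\<close>
    have R0: "s1 12 \<sigma> = 0" if "S \<le> \<sigma>" for \<sigma>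
      using R[of 0 \<sigma>] out'[of \<sigma>] that by (meson gr0I leD)
    have eq: "s1 9 0 = S" "s1 10 0 = B + S" "s1 11 = s 11"
      using sameD[OF same] S9 by (simp_all add: s0_def)
    have sm: "s1 A = s A" if "A < 20" "A \<notin> {10, 12, 13, 14, 16}" for A
      using same that by (simp add: same_def s0_def)
    show "wp ps (Set 13 (Const 0) ;; copy_loop) s1 (1 + tcopy) (\<lambda>s'.
        stack_rel (Xs @ [?X]) S s' \<and> (\<forall>A<10. s' A = s A) \<and> s' 15 = s 15)"
    proof (rule wp_Seq, rule wp_Assign, rule wp_mono[OF wp_copy_loop order_refl])
      let ?s = "s1(13 := (s1 13)(aval s1 (Const 0) := aval s1 (Const 0)))"
      show "?s 9 0 = S" "S \<le> ?s 10 0" "?s 13 0 = 0" using eq by simp_all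
      fix s2 assume "(\<forall>A<20. A \<notin> {11, 12, 13} \<longrightarrow> s2 A = ?s A) \<and>
        (\<forall>i. s2 12 i = (if i < S then 0 else ?s 12 i)) \<and>
        (\<forall>i. s2 11 i = (if ?s 10 0 - S \<le> i \<and> i < ?s 10 0 then ?s 12 (i - (?s 10 0 - S))
          else if ?s 10 0 \<le> i \<and> i < ?s 10 0 + S then 0 else ?s 11 i))"
      then have s2: "\<And>A. A < 20 \<Longrightarrow> A \<notin> {11, 12, 13} \<Longrightarrow> s2 A = s1 A"
        "\<And>i. s2 12 i = 0"
        "\<And>i. s2 11 i = (if B \<le> i \<and> i < B + S then s1 12 (i - B)
          else if B + S \<le> i \<and> i < B + S + S then 0 else s 11 i)"
        using eq R0 by simp_all
      have "stack_rel (Xs @ [?X]) S s2"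
      proof (rule stack_rel_snoc[OF st])
        show "s2 9 0 = S" "s2 10 0 = S * Suc (length Xs)" using s2(1) eq by (simp_all add: B_def)
        show "s2 12 i = 0" for i by (rule s2)
        show "s2 11 i = s 11 i" if "i < S * length Xs" for i
          using that s2(3)[of i] by (simp add: B_def)
        show "table_rel ?X (\<lambda>\<sigma>. s2 11 (S * length Xs + \<sigma>)) S"
          unfolding B_def[symmetric] table_rel_def
        proof (intro conjI allI impI)
          show "v < s2 11 (B + \<sigma>) \<longleftrightarrow> (\<exists>n. (\<sigma>, n) \<in> ?X \<and> v \<le> n)" if "\<sigma> < S" for \<sigma> v
            unfolding R[symmetric] using that by (simp add: s2(3))
          show "\<forall>(\<sigma>, n)\<in>?X. \<sigma> < S" using out' by blast
        qed
        show "s2 11 i = 0" if "S * Suc (length Xs) \<le> i" for i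
        proof -
          have "B + S \<le> i" using that by (simp add: B_def)
          then show ?thesis using z11[of i] s2(3)[of i] by simp
        qed
      qed (auto simp: nth_append)
      moreover have "s2 A = s A" if "A < 10 \<or> A = 15" for A
        using s2(1)[of A] sm[of A] that by auto
      ultimately show "stack_rel (Xs @ [?X]) S s2 \<and> (\<forall>A<10. s2 A = s A) \<and> s2 15 = s 15" by simp
    qed
  qed
  then have "wp ps (outer_loop cd ;; Set 13 (Const 0) ;; copy_loop)
      (s(10 := (s 10)(aval s (Const 0) := aval s (Minus (V 10) (V 9))),
         13 := (s 13)(0 := 0))) (touter + (1 + tcopy)) (\<lambda>s'.
      stack_rel (Xs @ [?X]) S s' \<and> (\<forall>A<10. s' A = s A) \<and> s' 15 = s 15)"
    using base S9 by (simp add: s0_def)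
  then show ?thesis
    unfolding combine_def tcomb_def
    by - (rule wp_Assign_Seq, rule wp_Assign_Seq, simp)
qed

lemma wp_unary:
  assumes st: "stack_rel (Xs @ [X]) S s" and ops: "ops_ok s"
    and out: "\<And>a n. (a, n) \<in> X \<Longrightarrow> dl s a 0 < S"
  shows "wp ps (unary cd) s (1 + (1 + tcomb)) (\<lambda>s'.
    stack_rel (Xs @ [{(dl s a 0, n) | a n. (a, n) \<in> X}]) S s' \<and>
    (\<forall>A<10. s' A = s A) \<and> s' 15 = s 15)"
proof -
  let ?s = "s(11 := (s 11)(s 10 0 := 1), 10 := (s 10)(0 := s 10 0 + S))"
  have base: "s 10 0 = S * Suc (length Xs)" and S9: "s 9 0 = S" and z12: "s 12 i = 0" for i
    using st by (simp_all add: stack_rel_def)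
  have z11: "s 11 i = 0" if "S * Suc (length Xs) \<le> i" for i
    using st that by (simp add: stack_rel_def)
  have pos: "0 < S" by (simp add: num_states_def Let_def)
  \<comment> \<open>The pushed table describes the empty set alone, in state 0; its cardinality 0
    adds nothing to the other operand.\<close>
  have "stack_rel ((Xs @ [X]) @ [{(0, 0)}]) S ?s"
  proof (rule stack_rel_snoc[OF st])
    show "table_rel {(0, 0)} (\<lambda>\<sigma>. ?s 11 (S * length (Xs @ [X]) + \<sigma>)) S"
      unfolding table_rel_def using base z11 pos by auto
  qed (use base S9 z12 z11 pos in auto)
  then have st': "stack_rel (Xs @ [X, {(0, 0)}]) S ?s" by simp
  have dl: "dl ?s = dl s" by (simp add: dl_def fun_eq_iff)
  have "wp ps (combine cd) ?s tcomb (\<lambda>s'.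
    stack_rel (Xs @ [{(dl ?s a b, n + n') | a n b n'. (a, n) \<in> X \<and> (b, n') \<in> {(0, 0)}}]) S s' \<and>
    (\<forall>A<10. s' A = ?s A) \<and> s' 15 = ?s 15)"
  proof (rule wp_combine[OF st'])
    show "ops_ok ?s" using ops by (simp add: ops_ok_def)
    show "dl ?s a b < S" if "(a, n) \<in> X" "(b, n') \<in> {(0, 0)}" for a n b n'
      using that out unfolding dl by auto
  qed
  then have "wp ps (combine cd) ?s tcomb (\<lambda>s'.
    stack_rel (Xs @ [{(dl s a 0, n) | a n. (a, n) \<in> X}]) S s' \<and>
    (\<forall>A<10. s' A = s A) \<and> s' 15 = s 15)"
    unfolding dl by simp
  then show ?thesis
    unfolding unary_def using S9 by - (rule wp_Assign_Seq, rule wp_Assign_Seq, simp)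
qed

lemma wp_create:
  assumes st: "stack_rel Xs S s" and ops: "ops_ok s" and out: "dl s 0 0 < S"
  shows "wp ps (create cd) s (tdelta + 5) (\<lambda>s'.
    stack_rel (Xs @ [{(0, 0), (dl s 0 0, 1)}]) S s' \<and>
    (\<forall>A<10. s' A = s A) \<and> s' 15 = s 15)"
proof -
  let ?s = "s(13 := (s 13)(0 := 0), 14 := (s 14)(0 := 0))"
  have base: "s 10 0 = S * length Xs" and S9: "s 9 0 = S" and z12: "s 12 i = 0" for i
    using st by (simp_all add: stack_rel_def)
  have z11: "s 11 i = 0" if "S * length Xs \<le> i" for i
    using st that by (simp add: stack_rel_def)
  have pos: "0 < S" by (simp add: num_states_def Let_def)
  let ?c = "Assign 11 (V 10) (Const 1) ;; Assign 11 (Plus (V 10) (V 20)) (Const 2) ;; Set 10 (Plus (V 10) (V 9))"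
  have "wp ps (cd ;; ?c) ?s (tdelta + 3) (\<lambda>s'.
    stack_rel (Xs @ [{(0, 0), (dl s 0 0, 1)}]) S s' \<and> (\<forall>A<10. s' A = s A) \<and> s' 15 = s 15)"
  proof (rule wp_Seq, rule wp_cd)
    show "ops_ok ?s" using ops by (simp add: ops_ok_def)
    fix s1 assume 1: "s1 20 0 = delta (?s 3 0) (?s 4 0) (?s 5 0) (?s 6 0) (?s 13 0) (?s 14 0) S"
      "\<And>A. A < 20 \<Longrightarrow> s1 A = ?s A"
    then have d: "s1 20 0 = dl s 0 0" by (simp add: dl_def)
    let ?r = "run ps ?c s1"
    have r11: "?r 11 = (s 11)(s 10 0 := 1, s 10 0 + dl s 0 0 := 2)" using 1(2) d by simp
    have r10: "?r 10 0 = s 10 0 + S" using 1(2) S9 by simp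
    have ro: "?r A = s A" if "A < 10 \<or> A = 12 \<or> A = 15" for A using that 1(2) by auto
    have "stack_rel (Xs @ [{(0, 0), (dl s 0 0, 1)}]) S ?r"
    proof (rule stack_rel_snoc[OF st])
      show "?r 9 0 = S" using ro[of 9] S9 by simp
      show "?r 10 0 = S * Suc (length Xs)" using r10 base by simp
      show "?r 12 i = 0" for i using ro[of 12] z12 by simp
      show "?r 11 i = s 11 i" if "i < S * length Xs" for i
        using that unfolding r11 base by simp
      show "?r 11 i = 0" if "S * Suc (length Xs) \<le> i" for i
        using that z11[of i] out pos unfolding r11 base by auto
      show "table_rel {(0, 0), (dl s 0 0, 1)} (\<lambda>\<sigma>. ?r 11 (S * length Xs + \<sigma>)) S"
        unfolding table_rel_def r11 base using z11 out pos by (auto simp: less_2_cases_iff)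
    qed auto
    moreover have "\<forall>A<10. s1 A = s A" "s1 15 = s 15" using 1(2) by simp_all
    ultimately show "wp ps ?c s1 3 (\<lambda>s'.
        stack_rel (Xs @ [{(0, 0), (dl s 0 0, 1)}]) S s' \<and> (\<forall>A<10. s' A = s A) \<and> s' 15 = s 15)"
      by (intro wp_run) simp_all
  qed simp_all
  then have "wp ps (create cd) s (1 + (1 + (tdelta + 3))) (\<lambda>s'.
    stack_rel (Xs @ [{(0, 0), (dl s 0 0, 1)}]) S s' \<and> (\<forall>A<10. s' A = s A) \<and> s' 15 = s 15)"
    unfolding create_def by - (rule wp_Assign_Seq, rule wp_Assign_Seq, simp)
  then show ?thesis by (rule wp_mono) simp_all
qed

end

section \<open>The algorithm\<close>

context dp_machine
begin

text \<open>The effect of an instruction on the stack of relations, separated from its storage. That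
  new states stay below \<open>S\<close> is included because they serve as indices into
  tables.\<close>

definition step_rel :: "nat list \<Rightarrow> (nat \<times> nat) set list \<Rightarrow> (nat \<times> nat) set list \<Rightarrow> bool" where
  "step_rel w Xs Xs' \<longleftrightarrow>
     (let \<delta> = delta (w ! 0) (g (arg1 w)) (g (arg2 w)) (g (arg3 w)) in
      w ! 0 = 1 \<and> \<delta> 0 0 S < S \<and> Xs' = Xs @ [{(0, 0), (\<delta> 0 0 S, 1)}] \<or>
      w ! 0 = 2 \<and> (\<exists>Ys X1 X2. Xs = Ys @ [X1, X2] \<and>
        (\<forall>(a, n)\<in>X1. \<forall>(b, n')\<in>X2. \<delta> a b S < S) \<and>
        Xs' = Ys @ [{(\<delta> a b S, n + n') | a n b n'. (a, n) \<in> X1 \<and> (b, n') \<in> X2}]) \<or>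
      w ! 0 \<noteq> 1 \<and> w ! 0 \<noteq> 2 \<and> (\<exists>Ys X. Xs = Ys @ [X] \<and> (\<forall>(a, n)\<in>X. \<delta> a 0 S < S) \<and>
        Xs' = Ys @ [{(\<delta> a 0 S, n) | a n. (a, n) \<in> X}]))"

definition inv :: "store \<Rightarrow> (nat \<times> nat) set list \<Rightarrow> nat list list \<Rightarrow> store \<Rightarrow> bool" where
  "inv s0 Xs ws s \<longleftrightarrow> stack_rel Xs S s \<and> code_at ws s \<and> s 7 = g \<and> (\<forall>A\<in>{0, 1, 15}. s A = s0 A)"

text \<open>\<open>tcomb + tdelta\<close> dominates each of the three kinds of instruction up to a
  constant, and 20 covers the fetching, renaming and branching.\<close>

definition tstep :: nat where "tstep = tcomb + tdelta + 20"

lemma wp_step: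
  assumes inv: "inv s0 Xs (w # ws) s" and w: "is_instr w" and st: "step_rel w Xs Xs'"
    and Q: "\<And>s'. inv s0 Xs' ws s' \<Longrightarrow> wp ps (pass2 cd) s' t Q"
  shows "wp ps (pass2 cd) s (1 + tstep + t) Q"
proof -
  have stack: "stack_rel Xs S s" and code: "code_at (w # ws) s" and g7: "s 7 = g"
    and fr: "\<And>A. A \<in> {0, 1, 15} \<Longrightarrow> s A = s0 A"
    using inv by (auto simp: inv_def)
  note ca = code_at_Cons[OF code]
  let ?case = "Cond (Equal (V 3) (Const 1)) (create cd)
    (Cond (Equal (V 3) (Const 2)) (combine cd) (unary cd))"
  have "wp ps (fetch ;; Set 4 (Cell 7 (V 4)) ;; Set 5 (Cell 7 (V 5)) ;; Set 6 (Cell 7 (V 6)) ;; ?case) s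
    (8 + (1 + (1 + (1 + (1 + (1 + (tcomb + tdelta + 5))))))) (inv s0 Xs' ws)"
  proof (rule wp_Seq, rule wp_fetch[OF w ca(1)])
    fix s1 assume s1: "s1 2 0 = s 2 0 + length w" "s1 3 0 = w ! 0" "s1 4 0 = arg1 w" "s1 5 0 = arg2 w"
      "s1 6 0 = arg3 w" "\<And>A. A \<notin> {2, 3, 4, 5, 6} \<Longrightarrow> s1 A = s A"
    define s2 where "s2 = run ps (Set 4 (Cell 7 (V 4)) ;; Set 5 (Cell 7 (V 5)) ;; Set 6 (Cell 7 (V 6))) s1"
    have s2: "s2 2 0 = s 2 0 + length w" "s2 3 0 = w ! 0" "s2 4 0 = g (arg1 w)" "s2 5 0 = g (arg2 w)"
      "s2 6 0 = g (arg3 w)" "\<And>A. A \<notin> {2, 3, 4, 5, 6} \<Longrightarrow> s2 A = s A"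
      using s1 g7 unfolding s2_def by simp_all
    have "w ! 0 \<le> 7" using w by (auto simp: is_instr_def)
    moreover have "s 9 0 = S" using stack by (simp add: stack_rel_def)
    ultimately have ops: "ops_ok s2" using s2 g_le by (simp add: ops_ok_def)
    have stack2: "stack_rel Xs S s2" using stack s2(6) by (simp add: stack_rel_def)
    have dl: "dl s2 = (\<lambda>a b. delta (w ! 0) (g (arg1 w)) (g (arg2 w)) (g (arg3 w)) a b S)"
      using s2 by (simp add: dl_def fun_eq_iff)
    have fin: "inv s0 Xs' ws s'" if "stack_rel Xs' S s' \<and> (\<forall>A<10. s' A = s2 A) \<and> s' 15 = s2 15" for s'
    proof -
      have "code_at ws s'" by (rule ca(2)) (use that s2 in simp_all)
      then show ?thesis using that s2 g7 fr by (simp add: inv_def)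
    qed
    have "wp ps ?case s2 (1 + (1 + (tcomb + tdelta + 5))) (inv s0 Xs' ws)"
    proof (rule wp_Cond)
      assume b: "bval ps s2 (Equal (V 3) (Const 1))"
      then have "dl s2 0 0 < S" "Xs' = Xs @ [{(0, 0), (dl s2 0 0, 1)}]"
        using st s2(2) unfolding step_rel_def Let_def dl by auto
      with wp_create[OF stack2 ops] fin show "wp ps (create cd) s2 (1 + (tcomb + tdelta + 5)) (inv s0 Xs' ws)"
        by (intro wp_mono[OF wp_create[OF stack2 ops]]) simp_all
    next
      assume b1: "\<not> bval ps s2 (Equal (V 3) (Const 1))"
      show "wp ps (Cond (Equal (V 3) (Const 2)) (combine cd) (unary cd)) s2
        (1 + (tcomb + tdelta + 5)) (inv s0 Xs' ws)"
      proof (rule wp_Cond)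
        assume b: "bval ps s2 (Equal (V 3) (Const 2))"
        then have "w ! 0 = 2" using s2(2) by simp
        then obtain Ys X1 X2 where Xs: "Xs = Ys @ [X1, X2]"
          and out: "\<forall>(a, n)\<in>X1. \<forall>(b, n')\<in>X2. dl s2 a b < S"
          and Xs': "Xs' = Ys @ [{(dl s2 a b, n + n') | a n b n'. (a, n) \<in> X1 \<and> (b, n') \<in> X2}]"
          using st unfolding step_rel_def Let_def dl by auto
        show "wp ps (combine cd) s2 (tcomb + tdelta + 5) (inv s0 Xs' ws)"
        proof (rule wp_mono[OF wp_combine])
          show "stack_rel (Ys @ [X1, X2]) S s2" using stack2 Xs by simp
          show "ops_ok s2" by (rule ops)
          show "dl s2 a b < S" if "(a, n) \<in> X1" "(b, n') \<in> X2" for a n b n'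
            using out that by blast
        qed (use fin Xs' in simp_all)
      next
        assume b2: "\<not> bval ps s2 (Equal (V 3) (Const 2))"
        then have "w ! 0 \<noteq> 1" "w ! 0 \<noteq> 2" using b1 s2(2) by simp_all
        then obtain Ys X where Xs: "Xs = Ys @ [X]" and out: "\<forall>(a, n)\<in>X. dl s2 a 0 < S"
          and Xs': "Xs' = Ys @ [{(dl s2 a 0, n) | a n. (a, n) \<in> X}]"
          using st unfolding step_rel_def Let_def dl by auto
        show "wp ps (unary cd) s2 (tcomb + tdelta + 5) (inv s0 Xs' ws)"
        proof (rule wp_mono[OF wp_unary])
          show "stack_rel (Ys @ [X]) S s2" using stack2 Xs by simp
          show "ops_ok s2" by (rule ops)
          show "dl s2 a 0 < S" if "(a, n) \<in> X" for a n
            using out that by blast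
        qed (use fin Xs' in simp_all)
      qed
    qed
    then show "wp ps (Set 4 (Cell 7 (V 4)) ;; Set 5 (Cell 7 (V 5)) ;; Set 6 (Cell 7 (V 6)) ;; ?case) s1
      (1 + (1 + (1 + (1 + (1 + (tcomb + tdelta + 5)))))) (inv s0 Xs' ws)"
      unfolding s2_def run.simps
      by - (rule wp_Assign_Seq, rule wp_Assign_Seq, rule wp_Assign_Seq, assumption)
  qed
  then have "wp ps (fetch ;; Set 4 (Cell 7 (V 4)) ;; Set 5 (Cell 7 (V 5)) ;; Set 6 (Cell 7 (V 6)) ;; ?case) s
    tstep (\<lambda>s'. wp ps (pass2 cd) s' t Q)"
    by (rule wp_mono) (use Q in \<open>simp_all add: tstep_def\<close>)
  with ca(3)[OF w] show ?thesis
    unfolding pass2_def by (intro wp_While_step) simp_all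
qed

lemma step_rel_unary:
  assumes "w ! 0 \<noteq> 1" "w ! 0 \<noteq> 2" "valid e" "valid e'"
    and "points (cw_eval e') = points (cw_eval e)"
    and "\<And>Q. delta (w ! 0) (g (arg1 w)) (g (arg2 w)) (g (arg3 w)) (state e Q) 0 S = state e' Q"
  shows "step_rel w (Xs @ [rel e]) (Xs @ [rel e'])"
proof -
  note eq = rel_unary[OF assms(5,6)]
  have "delta (w ! 0) (g (arg1 w)) (g (arg2 w)) (g (arg3 w)) a 0 S < S" if "(a, n) \<in> rel e" for a n
    using rel_less[OF assms(4)] that unfolding eq by blast
  then have "\<forall>(a, n)\<in>rel e. delta (w ! 0) (g (arg1 w)) (g (arg2 w)) (g (arg3 w)) a 0 S < S" by blast
  then show ?thesis unfolding step_rel_def Let_def eq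
    by (intro disjI2 conjI assms(1,2) exI[of _ Xs] exI[of _ "rel e"]) simp_all
qed

text \<open>
  The rest of the run enters as a hypothesis on the continuation, because the loop of the second
  pass processes all instructions of an expression and not only those of a subexpression.
\<close>

lemma wp_pass2_expr:
  assumes "valid e" "inv s0 Xs (instrs h e @ ws) s"
    and "\<And>s'. inv s0 (Xs @ [rel e]) ws s' \<Longrightarrow> wp ps (pass2 cd) s' t Q"
  shows "wp ps (pass2 cd) s (length (instrs h e) * Suc tstep + t) Q"
  using assms
proof (induction e arbitrary: Xs ws s t)
  case (Create p i)
  have rel: "rel (Create p i) = {(0, 0), (delta 1 (g i) (g i) (g i) 0 0 S, 1)}"
    by (rule rel_Create[OF Create.prems(1)])
  have "delta 1 (g i) (g i) (g i) 0 0 S < S"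
    using rel_less[OF Create.prems(1)] unfolding rel by blast
  then have "step_rel [1, h p, i] Xs (Xs @ [rel (Create p i)])"
    unfolding rel step_rel_def Let_def by simp
  from wp_step[OF _ _ this, of s0 ws s t Q] Create.prems(2,3)
  show ?case by (simp add: is_instr_def)
next
  case (Disjoint_Union e1 e2)
  let ?e = "Disjoint_Union e1 e2"
  have v: "valid e1" "valid e2" using Disjoint_Union.prems(1) by (auto simp: valid_def)
  \<comment> \<open>The padded arguments of the union are 0, and the machine passes their renamings
    \<open>g 0\<close>.\<close>
  note rel = rel_Union[OF Disjoint_Union.prems(1), of "g 0" "g 0" "g 0"]
  have "delta 2 (g 0) (g 0) (g 0) a b S < S" if "(a, n) \<in> rel e1" "(b, n') \<in> rel e2" for a n b n'
    using rel_less[OF Disjoint_Union.prems(1), of "delta 2 (g 0) (g 0) (g 0) a b S" "n + n'"] that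
    unfolding rel by blast
  then have st: "step_rel [2] (Xs @ [rel e1, rel e2]) (Xs @ [rel ?e])"
    unfolding rel step_rel_def Let_def by auto
  have "wp ps (pass2 cd) s (length (instrs h e1) * Suc tstep + (length (instrs h e2) * Suc tstep + (1 + tstep + t))) Q"
  proof (rule Disjoint_Union.IH(1)[OF v(1)])
    show "inv s0 Xs (instrs h e1 @ instrs h e2 @ [2] # ws) s" using Disjoint_Union.prems(2) by simp
    fix s1 assume s1: "inv s0 (Xs @ [rel e1]) (instrs h e2 @ [2] # ws) s1"
    show "wp ps (pass2 cd) s1 (length (instrs h e2) * Suc tstep + (1 + tstep + t)) Q"
    proof (rule Disjoint_Union.IH(2)[OF v(2) s1])
      fix s2 assume "inv s0 ((Xs @ [rel e1]) @ [rel e2]) ([2] # ws) s2"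
      then have s2: "inv s0 (Xs @ [rel e1, rel e2]) ([2] # ws) s2" by simp
      show "wp ps (pass2 cd) s2 (1 + tstep + t) Q"
        by (rule wp_step[OF s2 _ st Disjoint_Union.prems(3)]) (simp_all add: is_instr_def)
    qed
  qed
  then show ?case by (rule wp_mono) (simp_all add: algebra_simps)
next
  case (Label_Pairs i j k e)
  have v: "valid e" using Label_Pairs.prems(1) by (auto simp: valid_def)
  have st: "step_rel [3, i, j, k] (Ys @ [rel e]) (Ys @ [rel (Label_Pairs i j k e)])" for Ys
    by (rule step_rel_unary) (use v Label_Pairs.prems(1) delta_Label_Pairs in \<open>simp_all add: Let_def\<close>)
  have "wp ps (pass2 cd) s (length (instrs h e) * Suc tstep + (1 + tstep + t)) Q"
  proof (rule Label_Pairs.IH[OF v])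
    show "inv s0 Xs (instrs h e @ [3, i, j, k] # ws) s" using Label_Pairs.prems(2) by simp
    show "wp ps (pass2 cd) s1 (1 + tstep + t) Q" if "inv s0 (Xs @ [rel e]) ([3, i, j, k] # ws) s1" for s1
      by (rule wp_step[OF that _ st Label_Pairs.prems(3)]) (simp_all add: is_instr_def)
  qed
  then show ?case by (rule wp_mono) (simp_all add: algebra_simps)
next
  case (Add_Triples i k e)
  have v: "valid e" using Add_Triples.prems(1) by (auto simp: valid_def)
  have st: "step_rel [4, i, k] (Ys @ [rel e]) (Ys @ [rel (Add_Triples i k e)])" for Ys
    by (rule step_rel_unary) (use v Add_Triples.prems(1) delta_Add_Triples in \<open>simp_all add: Let_def\<close>)
  have "wp ps (pass2 cd) s (length (instrs h e) * Suc tstep + (1 + tstep + t)) Q"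
  proof (rule Add_Triples.IH[OF v])
    show "inv s0 Xs (instrs h e @ [4, i, k] # ws) s" using Add_Triples.prems(2) by simp
    show "wp ps (pass2 cd) s1 (1 + tstep + t) Q" if "inv s0 (Xs @ [rel e]) ([4, i, k] # ws) s1" for s1
      by (rule wp_step[OF that _ st Add_Triples.prems(3)]) (simp_all add: is_instr_def)
  qed
  then show ?case by (rule wp_mono) (simp_all add: algebra_simps)
next
  case (Add_Triples_Rev i k e)
  have v: "valid e" using Add_Triples_Rev.prems(1) by (auto simp: valid_def)
  have st: "step_rel [5, i, k] (Ys @ [rel e]) (Ys @ [rel (Add_Triples_Rev i k e)])" for Ys
    by (rule step_rel_unary) (use v Add_Triples_Rev.prems(1) delta_Add_Triples_Rev in \<open>simp_all add: Let_def\<close>)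
  have "wp ps (pass2 cd) s (length (instrs h e) * Suc tstep + (1 + tstep + t)) Q"
  proof (rule Add_Triples_Rev.IH[OF v])
    show "inv s0 Xs (instrs h e @ [5, i, k] # ws) s" using Add_Triples_Rev.prems(2) by simp
    show "wp ps (pass2 cd) s1 (1 + tstep + t) Q" if "inv s0 (Xs @ [rel e]) ([5, i, k] # ws) s1" for s1
      by (rule wp_step[OF that _ st Add_Triples_Rev.prems(3)]) (simp_all add: is_instr_def)
  qed
  then show ?case by (rule wp_mono) (simp_all add: algebra_simps)
next
  case (Relabel_Points i j e)
  have v: "valid e" using Relabel_Points.prems(1) by (auto simp: valid_def)
  have st: "step_rel [6, i, j] (Ys @ [rel e]) (Ys @ [rel (Relabel_Points i j e)])" for Ys
    by (rule step_rel_unary) (use v Relabel_Points.prems(1) delta_Relabel_Points in \<open>simp_all add: Let_def\<close>)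
  have "wp ps (pass2 cd) s (length (instrs h e) * Suc tstep + (1 + tstep + t)) Q"
  proof (rule Relabel_Points.IH[OF v])
    show "inv s0 Xs (instrs h e @ [6, i, j] # ws) s" using Relabel_Points.prems(2) by simp
    show "wp ps (pass2 cd) s1 (1 + tstep + t) Q" if "inv s0 (Xs @ [rel e]) ([6, i, j] # ws) s1" for s1
      by (rule wp_step[OF that _ st Relabel_Points.prems(3)]) (simp_all add: is_instr_def)
  qed
  then show ?case by (rule wp_mono) (simp_all add: algebra_simps)
next
  case (Relabel_Pairs i j e)
  have v: "valid e" using Relabel_Pairs.prems(1) by (auto simp: valid_def)
  have st: "step_rel [7, i, j] (Ys @ [rel e]) (Ys @ [rel (Relabel_Pairs i j e)])" for Ys
    by (rule step_rel_unary) (use v Relabel_Pairs.prems(1) delta_Relabel_Pairs in \<open>simp_all add: Let_def\<close>)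
  have "wp ps (pass2 cd) s (length (instrs h e) * Suc tstep + (1 + tstep + t)) Q"
  proof (rule Relabel_Pairs.IH[OF v])
    show "inv s0 Xs (instrs h e @ [7, i, j] # ws) s" using Relabel_Pairs.prems(2) by simp
    show "wp ps (pass2 cd) s1 (1 + tstep + t) Q" if "inv s0 (Xs @ [rel e]) ([7, i, j] # ws) s1" for s1
      by (rule wp_step[OF that _ st Relabel_Pairs.prems(3)]) (simp_all add: is_instr_def)
  qed
  then show ?case by (rule wp_mono) (simp_all add: algebra_simps)
qed

end

text \<open>Opcode 0 sends precisely the sets without an uncovered triple to state 1. A single table
  is left, at cell 0, so cell 1 holds the largest cardinality plus 1, and comparing strictly with it
  decides the problem.\<close>

definition finish :: "com \<Rightarrow> com" where
  "finish cd = Set 3 (Const 0) ;; Set 4 (Const 0) ;; Set 5 (Const 0) ;; Set 6 (Const 0) ;; unary cd ;;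
     Cond (Less (V 15) (Cell 11 (Const 1))) (Set 0 (Const 1)) (Set 0 (Const 0))"

context dp_machine
begin

lemma wp_finish:
  assumes "valid e" "stack_rel [rel e] S s"
    and Q: "\<And>s'. s' 0 0 = (if \<exists>Q \<subseteq> points (cw_eval e). s 15 0 \<le> card Q \<and> uncovered e Q = {} then 1 else 0) \<Longrightarrow> R s'"
  shows "wp ps (finish cd) s (tcomb + 8) R"
proof -
  define s1 where "s1 = run ps (Set 3 (Const 0) ;; Set 4 (Const 0) ;; Set 5 (Const 0) ;; Set 6 (Const 0)) s"
  have s1: "\<And>A. A \<notin> {3, 4, 5, 6} \<Longrightarrow> s1 A = s A" "s1 3 0 = 0" "s1 4 0 = 0" "s1 5 0 = 0" "s1 6 0 = 0"
    unfolding s1_def by simp_all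
  have stack: "stack_rel ([] @ [rel e]) S s1" using assms(2) s1(1) by (simp add: stack_rel_def)
  have ops: "ops_ok s1" using s1 assms(2) by (simp add: ops_ok_def stack_rel_def)
  have dl: "dl s1 (state e Q) 0 = (if uncovered e Q = {} then 1 else 0)" for Q
    using delta_accept[OF assms(1), of 0 0 0 Q 0] s1 by (simp add: dl_def)
  have S2: "1 < S" unfolding num_states_def Let_def using less_exp[of "Suc 0"]
    by (intro one_less_power) simp_all
  have out: "dl s1 a 0 < S" if "(a, n) \<in> rel e" for a n
    using that S2 dl unfolding rel_def by (auto split: if_splits)
  let ?X = "{(dl s1 a 0, n) | a n. (a, n) \<in> rel e}"
  have "wp ps (unary cd ;; Cond (Less (V 15) (Cell 11 (Const 1))) (Set 0 (Const 1)) (Set 0 (Const 0))) s1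
    ((1 + (1 + tcomb)) + 2) R"
  proof (rule wp_Seq, rule wp_mono[OF wp_unary[OF stack ops out] order_refl])
    fix s2 assume s2: "stack_rel ([] @ [?X]) S s2 \<and> (\<forall>A<10. s2 A = s1 A) \<and> s2 15 = s1 15"
    then have "table_rel ?X (\<lambda>\<sigma>. s2 11 (S * 0 + \<sigma>)) S" using stack_relD[of "[?X]" S s2 0] by simp
    from table_relD[OF this S2]
    have lt: "s2 15 0 < s2 11 1 \<longleftrightarrow> (\<exists>n. (1, n) \<in> ?X \<and> s 15 0 \<le> n)" using s2 s1(1) by simp
    have mem: "(1, n) \<in> ?X \<longleftrightarrow> (\<exists>Q \<subseteq> points (cw_eval e). dl s1 (state e Q) 0 = 1 \<and> n = card Q)" for n
      unfolding rel_def mem_Collect_eq prod.inject by metis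
    have one: "dl s1 (state e Q) 0 = 1 \<longleftrightarrow> uncovered e Q = {}" for Q by (simp add: dl)
    have eq: "s2 15 0 < s2 11 1 \<longleftrightarrow> (\<exists>Q \<subseteq> points (cw_eval e). s 15 0 \<le> card Q \<and> uncovered e Q = {})"
      unfolding lt mem one by blast
    show "wp ps (Cond (Less (V 15) (Cell 11 (Const 1))) (Set 0 (Const 1)) (Set 0 (Const 0))) s2 2 R"
      by (rule wp_run, simp, simp, rule Q, unfold eq[symmetric], simp)
  qed
  then have "wp ps (finish cd) s (1 + (1 + (1 + (1 + ((1 + (1 + tcomb)) + 2))))) R"
    unfolding finish_def s1_def run.simps
    by - (rule wp_Assign_Seq, rule wp_Assign_Seq, rule wp_Assign_Seq, rule wp_Assign_Seq, assumption)
  then show ?thesis by (rule wp_mono) simp_all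
qed

end

text \<open>A negative \<open>k\<close> is replaced by 0: the empty set is in general position, so
  the answer is yes in both cases.\<close>

definition solve :: "com \<Rightarrow> com \<Rightarrow> com" where
  "solve cs cd = cs ;; Set 9 (V 20) ;;
     Cond (Equal (Cell 1 (Const 1)) (Const 1)) (Set 15 (Const 0)) (Set 15 (Cell 1 (Const 2))) ;;
     Set 2 (Const 3) ;; pass2 cd ;; finish cd"

definition main :: "com \<Rightarrow> com \<Rightarrow> com" where
  "main cs cd = Set 2 (Const 3) ;; pass1 ;; solve cs cd"

section \<open>Computability of the bound and the total running time\<close>

lemma elem_tow: "elem F \<Longrightarrow> elem (\<lambda>v. tow r (F v))"
  by (induction r) (simp_all add: tow_Suc elem_pow2)

lemma elem_computable: assumes "elem (\<lambda>v. f (v 0))" shows "computable f"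
proof -
  obtain T C where C: "realizes T C (\<lambda>v. f (v 0))" using assms unfolding elem_def by blast
  have "\<exists>t s. exec [] (C (\<lambda>_. 1) 2 ;; Set 0 (V 2)) (init_store [n]) t s \<and> result s = f n" for n
  proof -
    have "wp [] (C (\<lambda>_. 1) 2 ;; Set 0 (V 2)) (init_store [n]) (T n + 1) (\<lambda>s. result s = f n)"
    proof (rule wp_Seq, rule realizes_wp[OF C])
      show "wp [] (Set 0 (V 2)) s' 1 (\<lambda>s. result s = f n)" if "s' 2 0 = f (init_store [n] 1 0)" for s'
        using that by (intro wp_run) (simp_all add: result_def init_store_def)
    qed (simp_all add: init_store_def)
    then show ?thesis unfolding wp_def by blast
  qed
  then show ?thesis unfolding computable_def by blast
qed

text \<open>The constants of the locale as a function of \<open>m\<close> alone: \<open>D\<close>,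
  \<open>I\<close>, \<open>J\<close>, \<open>K\<close> are \<open>tdelta\<close>,
  \<open>tinner\<close>, \<open>touter\<close>, \<open>tcomb\<close>. This form is needed outside
  the locale, whose parameter \<open>g\<close> is known only during a run.\<close>

definition time_bound :: "(nat \<Rightarrow> nat) \<Rightarrow> (nat \<Rightarrow> nat) \<Rightarrow> nat \<Rightarrow> nat" where
  "time_bound Ts Td m = (let S = num_states m; D = Td (m + S + 7); I = S * Suc (D + 4 + 1) + 1;
     J = S * Suc (1 + (I + 1)) + 1; K = 1 + (1 + (J + (1 + (S * Suc 4 + 1)))) in
     60 + Ts m + 3 * K + D)"

lemma elb_num_states: "elb num_states"
proof -
  have "elem (\<lambda>v. num_states (v 0))" by (intro elem_num_states elem_var)
  then obtain T C where R: "realizes T C (\<lambda>v. num_states (v 0))" unfolding elem_def by blast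
  show ?thesis
    by (rule elb_le[OF realizes_elb[OF R]]) (rule realizes_le[OF R], simp)
qed

lemma elb_time_bound: assumes "elb Ts" "elb Td" shows "elb (time_bound Ts Td)"
proof -
  have "elb (\<lambda>m. m + num_states m + 7)" by (intro elb_intros elb_num_states)
  from elb_comp[OF assms(2) this] show ?thesis
    unfolding time_bound_def Let_def by (intro elb_intros elb_num_states assms(1))
qed

context dp_machine
begin

text \<open>Each instruction pays for its rounds in both passes, and the three words of the header
  pay for computing \<open>S\<close>, for the final step and for all other fixed costs.\<close>

lemma time_bound_le:
  assumes "n + 3 \<le> l"
  shows "1 + ((18 * n + 1) + (Ts m + (1 + (2 + (1 + ((n * Suc tstep + 1) + (tcomb + 8))))))) \<le> time_bound Ts Td m * l"
proof -
  have time: "time_bound Ts Td m = 60 + Ts m + 3 * tcomb + tdelta"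
    unfolding time_bound_def Let_def tcomb_def touter_def tinner_def tcopy_def tdelta_def by (rule refl)
  have "n * (18 + Suc tstep) + 3 * (60 + Ts m + 3 * tcomb + tdelta) \<le>
      n * time_bound Ts Td m + 3 * time_bound Ts Td m"
    by (intro add_mono mult_le_mono2) (simp_all add: time tstep_def)
  also have "\<dots> = time_bound Ts Td m * (n + 3)" by (simp add: distrib_left mult.commute)
  also have "\<dots> \<le> time_bound Ts Td m * l" using assms by (rule mult_le_mono2)
  finally have "18 * n + n * Suc tstep + 3 * (60 + Ts m + 3 * tcomb + tdelta) \<le> time_bound Ts Td m * l"
    by (simp only: distrib_left mult.commute[of n 18])
  moreover have "a + b + 3 * (60 + x + 3 * y + z) \<le> w \<Longrightarrow>
      1 + ((a + 1) + (x + (1 + (2 + (1 + ((b + 1) + (y + 8))))))) \<le> w" for a b x y z w :: nat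
    by simp
  ultimately show ?thesis by blast
qed

lemma wp_solve:
  assumes cs: "realizes Ts Cs (\<lambda>v. num_states (v 0))" and v: "valid e"
    and s: "s 7 = g" "s 8 0 = m" "s 10 0 = 0" "\<And>i. s 11 i = 0" "\<And>i. s 12 i = 0"
    and code: "code_at (instrs h e) (s(2 := (s 2)(0 := 3)))"
    and kk: "(if s 1 1 = 1 then 0 else s 1 2) = kk"
    and R: "\<And>s'. s' 0 0 = (if \<exists>Q \<subseteq> points (cw_eval e). kk \<le> card Q \<and> uncovered e Q = {} then 1 else 0) \<Longrightarrow> R s'"
  shows "wp ps (solve (Cs (\<lambda>_. 8) 20) cd) s
    (Ts m + (1 + (2 + (1 + ((length (instrs h e) * Suc tstep + 1) + (tcomb + 8)))))) R"
  unfolding solve_def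
proof (rule wp_Seq, rule realizes_wp[OF cs])
  show "s 8 0 \<le> m" using s by simp
  let ?n = "length (instrs h e)"
  let ?cond = "Cond (Equal (Cell 1 (Const 1)) (Const 1)) (Set 15 (Const 0)) (Set 15 (Cell 1 (Const 2)))"
  fix s2 assume "s2 20 0 = num_states (s 8 0)" and s2: "\<And>A. A < 20 \<Longrightarrow> s2 A = s A"
  then have S: "s2 20 0 = S" using s by simp
  define s3 where "s3 = run ps ?cond (run ps (Set 9 (V 20)) s2)"
  define s4 where "s4 = run ps (Set 2 (Const 3)) s3"
  have s3: "\<And>A. A < 9 \<Longrightarrow> s3 A = s A" "s3 9 0 = S" "s3 10 = s 10" "s3 11 = s 11" "s3 12 = s 12" "s3 15 0 = kk"
    using S s2 kk unfolding s3_def by (auto split: if_splits)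
  have s4: "s4 0 = s 0" "s4 1 = s 1" "s4 2 0 = 3" "s4 7 = g" "s4 9 0 = S" "s4 10 = s 10" "s4 11 = s 11"
    "s4 12 = s 12" "s4 15 0 = kk"
    using s3 s unfolding s4_def by simp_all
  have code4: "code_at (instrs h e) s4"
    using code s4 unfolding code_at_def by simp
  have "inv s4 [] (instrs h e @ []) s4"
    using s4 s code4 unfolding inv_def stack_rel_def by simp
  then have "wp ps (pass2 cd) s4 (?n * Suc tstep + 1) (\<lambda>s. wp ps (finish cd) s (tcomb + 8) R)"
  proof (rule wp_pass2_expr[OF v])
    fix s5 assume i: "inv s4 ([] @ [rel e]) [] s5"
    then have "\<not> bval ps s5 (Less (V 2) (V 0))" by (simp add: inv_def code_at_def)
    moreover have "wp ps (finish cd) s5 (tcomb + 8) R"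
    proof (rule wp_finish[OF v])
      show "stack_rel [rel e] S s5" using i by (simp add: inv_def)
      have "s5 15 0 = kk" using i s4 by (simp add: inv_def)
      then show "R s'" if "s' 0 0 = (if \<exists>Q \<subseteq> points (cw_eval e). s5 15 0 \<le> card Q \<and> uncovered e Q = {} then 1 else 0)" for s'
        using that by (intro R) simp
    qed
    ultimately show "wp ps (pass2 cd) s5 1 (\<lambda>s. wp ps (finish cd) s (tcomb + 8) R)"
      unfolding pass2_def by - (rule wp_While_end, assumption)
  qed
  then have "wp ps (pass2 cd ;; finish cd) s4 ((?n * Suc tstep + 1) + (tcomb + 8)) R"
    by - (rule wp_Seq, assumption)
  then have *: "wp ps (Set 2 (Const 3) ;; pass2 cd ;; finish cd) s3 (1 + ((?n * Suc tstep + 1) + (tcomb + 8))) R"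
    unfolding s4_def run.simps(2) by - (rule wp_Assign_Seq, assumption)
  have "wp ps (?cond ;; Set 2 (Const 3) ;; pass2 cd ;; finish cd) (run ps (Set 9 (V 20)) s2)
      (2 + (1 + ((?n * Suc tstep + 1) + (tcomb + 8)))) R"
    by (rule wp_Seq, rule wp_run, simp, simp, rule *[unfolded s3_def])
  then show "wp ps (Set 9 (V 20) ;; ?cond ;; Set 2 (Const 3) ;; pass2 cd ;; finish cd) s2
      (1 + (2 + (1 + ((?n * Suc tstep + 1) + (tcomb + 8))))) R"
    unfolding run.simps(2) by - (rule wp_Assign_Seq, assumption)
qed simp

end

lemma card_arg_set: "card (arg_set (instrs h e)) \<le> Suc (cw_width e)"
proof -
  let ?U = "unary_labels e" and ?B = "binary_labels e"
  have "card (arg_set (instrs h e)) \<le> card (insert 0 (?U \<union> ?B))"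
    using arg_set_instrs[of e h] finite_unary_labels[of e] finite_binary_labels[of e]
    by (intro card_mono) auto
  also have "\<dots> \<le> Suc (card (?U \<union> ?B))"
    by (rule card_insert_le_m1) simp_all
  also have "\<dots> \<le> Suc (card ?U + card ?B)" using card_Un_le by simp
  also have "\<dots> \<le> Suc (cw_width e)" by (simp add: cw_width_def)
  finally show ?thesis .
qed

lemma wp_main:
  assumes cs: "realizes Ts Cs (\<lambda>v. num_states (v 0))"
    and cd: "realizes Td Cd (\<lambda>v. delta (v 0) (v 1) (v 2) (v 3) (v 4) (v 5) (v 6))"
    and e: "cw_wf e" and ws: "ws = [n, if k < 0 then 1 else 0, nat \<bar>k\<bar>] @ concat (instrs h e)"
    and m: "m = card (arg_set (instrs h e))"
  shows "wp ps (main (Cs (\<lambda>_. 8) 20) (Cd dreg 20)) (init_store ws) (time_bound Ts Td m * length ws)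
    (\<lambda>s. result s = (if \<exists>Q \<subseteq> points (cw_eval e). k \<le> int (card Q) \<and> uncovered e Q = {} then 1 else 0))"
    (is "wp ps _ ?i _ ?R")
proof -
  let ?n = "length (instrs h e)" and ?L = "arg_set (instrs h e)"
  let ?i3 = "?i(2 := (?i 2)(0 := 3))"
  have instr: "is_instr w" if "w \<in> set (instrs h e)" for w using is_instr_instrs[OF that] .
  have len: "?n + 3 \<le> length ws" using length_le_concat[of "instrs h e"] instr by (simp add: ws)
  have code: "code_at (instrs h e) ?i3"
    unfolding code_at_def ws by (simp add: init_store_def nth_Cons numeral_3_eq_3)
  have num0: "numbering {} (?i3 7) (?i3 8 0)" by (simp add: numbering_def init_store_def)
  have i1: "?i 1 1 = (if k < 0 then 1 else 0)" "?i 1 2 = nat \<bar>k\<bar>"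
    by (simp_all add: init_store_def ws)
  \<comment> \<open>The time left after the first pass. It is given by subtraction because the
    constants of the locale become available only after that pass.\<close>
  define rest where "rest = time_bound Ts Td m * length ws - (18 * ?n + 2)"
  have "wp ps (pass1 ;; solve (Cs (\<lambda>_. 8) 20) (Cd dreg 20)) ?i3 ((18 * ?n + 1) + rest) ?R"
  proof (rule wp_Seq, rule wp_pass1[OF instr code num0], assumption)
    fix s assume num: "numbering ({} \<union> ?L) (s 7) (s 8 0)"
      and s: "\<And>A. A \<notin> {2, 3, 4, 5, 6, 7, 8} \<Longrightarrow> s A = ?i3 A"
    have m8: "s 8 0 = m" using num by (simp add: m numbering_def)
    then have numL: "numbering ?L (s 7) m" using num by simp
    \<comment> \<open>The renaming is what the first pass has left in array 7.\<close>
    interpret dp_machine "s 7" m ?L Td Cd ps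
    proof unfold_locales
      show "inj_on (s 7) ?L" using numL by (simp add: numbering_def)
      show "0 < s 7 l" if "l \<in> ?L" for l using numbering_zero[OF numL, of l] that by simp
      show "s 7 l \<le> m" for l by (rule numbering_le[OF numL])
      then show "s 7 l \<le> m" for l .
    qed (rule cd)
    have v: "valid e" unfolding valid_def using e arg_set_instrs[of e h] by blast
    have "wp ps (solve (Cs (\<lambda>_. 8) 20) cd) s
      (Ts m + (1 + (2 + (1 + ((?n * Suc tstep + 1) + (tcomb + 8)))))) ?R"
    proof (rule wp_solve[OF cs v])
      show "s 7 = s 7" "s 8 0 = m" by (simp_all add: m8)
      show "s 10 0 = 0" "s 11 i = 0" "s 12 i = 0" for i using s by (simp_all add: init_store_def)
      show "code_at (instrs h e) (s(2 := (s 2)(0 := 3)))"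
        using code s unfolding code_at_def by simp
      \<comment> \<open>Word 1 is the sign flag of \<open>k\<close> and word 2 its absolute
        value.\<close>
      show "(if s 1 1 = 1 then 0 else s 1 2) = nat k" using s i1 by simp
      show "?R s'" if "s' 0 0 = (if \<exists>Q \<subseteq> points (cw_eval e). nat k \<le> card Q \<and> uncovered e Q = {} then 1 else 0)" for s'
        using that by (simp add: result_def nat_le_iff)
    qed
    then show "wp ps (solve (Cs (\<lambda>_. 8) 20) (Cd dreg 20)) s rest ?R"
      unfolding cd_def
    proof (rule wp_mono)
      show "Ts m + (1 + (2 + (1 + ((?n * Suc tstep + 1) + (tcomb + 8))))) \<le> rest"
        using time_bound_le[OF len, of Ts] unfolding rest_def by simp
    qed
  qed
  then have "wp ps (main (Cs (\<lambda>_. 8) 20) (Cd dreg 20)) ?i (1 + ((18 * ?n + 1) + rest)) ?R"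
    unfolding main_def by - (rule wp_Assign_Seq, simp)
  then show ?thesis
  proof (rule wp_mono)
    have "60 * (?n + 3) \<le> time_bound Ts Td m * length ws"
      using len by (intro mult_le_mono) (simp_all add: time_bound_def Let_def)
    moreover have "60 * (a + 3) \<le> w \<Longrightarrow> 1 + ((18 * a + 1) + (w - (18 * a + 2))) \<le> w" for a w :: nat
      by simp
    ultimately show "1 + ((18 * ?n + 1) + rest) \<le> time_bound Ts Td m * length ws"
      unfolding rest_def by blast
  qed
qed

theorem theorem4:
  "\<exists>(f :: nat \<Rightarrow> nat) (alg :: com). computable f \<and>
     (\<forall>(P :: point set) (ps :: point list) (e :: point cw_expr) (d :: nat) (k :: int).
        finite P \<and> distinct ps \<and> set ps = P \<and>
        cw_wf e \<and> cw_width e = d \<and> cw_value e = (P, order_type P) \<longrightarrow>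
        (\<exists>t s. exec ps alg (init_store (input_words ps e k)) t s \<and>
           t \<le> f d * input_size ps e k \<and>
           result s = (if general_position_subset P k then 1 else 0)))"
proof -
  have "elem (\<lambda>v. num_states (v 0))" by (intro elem_num_states elem_var)
  then obtain Ts Cs where cs: "realizes Ts Cs (\<lambda>v. num_states (v 0))" unfolding elem_def by blast
  obtain Td Cd where cd: "realizes Td Cd (\<lambda>v. delta (v 0) (v 1) (v 2) (v 3) (v 4) (v 5) (v 6))"
    using elem_delta unfolding elem_def by blast
  \<comment> \<open>The height \<open>r\<close> depends on the two subprograms only, so it is fixed
    before the width and the input.\<close>
  obtain r where r: "\<And>m. time_bound Ts Td m \<le> tow r m"
    using elb_time_bound[OF realizes_elb[OF cs] realizes_elb[OF cd]] unfolding elb_def by blast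
  define alg where "alg = main (Cs (\<lambda>_. 8) 20) (Cd dreg 20)"
  have "computable (\<lambda>d. tow r (Suc d))"
    by (intro elem_computable elem_tow elem_Suc elem_var)
  moreover have "\<exists>t s. exec ps alg (init_store (input_words ps e k)) t s \<and>
      t \<le> tow r (Suc (cw_width e)) * input_size ps e k \<and>
      result s = (if general_position_subset P k then 1 else 0)"
    if wf: "cw_wf e" and val: "cw_value e = (P, order_type P)" for P ps e k
  proof -
    let ?ws = "input_words ps e k"
    have ws: "?ws = [length ps, if k < 0 then 1 else 0, nat \<bar>k\<bar>] @ concat (instrs (index_of ps) e)"
      unfolding input_words_def encode_expr_instrs ..
    have pts: "points (cw_eval e) = P" using val by (simp add: cw_value_def)
    define m where "m = card (arg_set (instrs (index_of ps) e))"
    have m: "m \<le> Suc (cw_width e)" unfolding m_def by (rule card_arg_set)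
    have "wp ps alg (init_store ?ws) (time_bound Ts Td m * length ?ws)
      (\<lambda>s. result s = (if \<exists>Q \<subseteq> P. k \<le> int (card Q) \<and> uncovered e Q = {} then 1 else 0))"
      using wp_main[OF cs cd wf ws m_def, of ps] unfolding alg_def pts .
    then obtain t s where t: "exec ps alg (init_store ?ws) t s" "t \<le> time_bound Ts Td m * length ?ws"
      and s: "result s = (if \<exists>Q \<subseteq> P. k \<le> int (card Q) \<and> uncovered e Q = {} then 1 else 0)"
      unfolding wp_def by blast
    have "time_bound Ts Td m \<le> tow r (Suc (cw_width e))" using r[of m] tow_mono[OF m, of r] by linarith
    then have "time_bound Ts Td m * length ?ws \<le> tow r (Suc (cw_width e)) * input_size ps e k"
      by (intro mult_le_mono) (simp_all add: input_size_def)
    then have "t \<le> tow r (Suc (cw_width e)) * input_size ps e k" using t(2) by simp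
    moreover have iff: "(\<exists>Q \<subseteq> P. k \<le> int (card Q) \<and> uncovered e Q = {}) \<longleftrightarrow> general_position_subset P k"
      unfolding general_position_subset_def using general_position_iff_uncovered[OF wf val] by blast
    ultimately show ?thesis using t(1) s unfolding iff by blast
  qed
  ultimately show ?thesis by blast
qed

end
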